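(* Let $N\ge1$ be an integer, let $m,k\ge2$ be integers, let $\Omega\subset\mathbb{R}^N$ be a bounded domain (with Lipschitz boundary if $N\ge2$), and let $\lambda_{m,k}(\Omega)$ be the $k$-th Dirichlet eigenvalue in $\Omega$ of the $m$-order logarithmic Laplacian $\mathcal{L}_m$. Set $$a_m=\frac{N^{m+1}}{2^m m}\frac{(2\pi)^N}{\omega_N},\qquad b_m=\frac{2^m}{N^m}(m-1)^m+\frac1{N^m},\qquad c_m=a_mb_m .$$ There is a number $\tau_0>1$ depending only on $m$ such that the following hold. (i) If either $m$ is odd and $\lambda_{m,1}(\Omega)\ge0$, or $m$ is even, then $$\lambda_{m,k}(\Omega)\ge\Big(\frac2N\Big)^m\min\Big\{\Big(\frac{c_m}{e^{\tau_0}}\Big)^{\frac m{m-1}}\Big(\frac{k}{|\Omega|}\Big)^{\frac m{m-1}},\ \Big(\log\Big(c_m\frac{k}{|\Omega|}+\tau_0^{m-1}e^{\tau_0}\Big)-(m-1)\log\Big(\log\Big(c_m\frac{k}{|\Omega|}+e\Big)\Big)-\log2\Big)^m\Big\}-b_m.$$ (ii) If $m$ is odd and $\lambda_{m,1}(\Omega)<0$, then, with $P_m(\Omega)=-\lambda_{m,1}(\Omega)+b_m$, $$\lambda_{m,k}(\Omega)\ge\Big(\frac2N\Big)^m\min\Big\{\Big(\frac{a_m}{e^{\tau_0}}\Big)^{\frac m{m-1}}\Big(\frac{P_m(\Omega)}{|\Omega|}\Big)^{\frac m{m-1}}k^{\frac m{m-1}},\ \Big(\log\Big(a_m\frac{P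_m(\Omega)}{|\Omega|}k+\tau_0^{m-1}e^{\tau_0}\Big)-(m-1)\log\Big(2\log\Big(a_m\frac{P_m(\Omega)}{|\Omega|}k+e\Big)\Big)\Big)^m\Big\}-P_m(\Omega).$$
   Context: $\omega_N$ denotes the surface measure of the unit sphere in $\mathbb{R}^N$ and $|\Omega|$ the Lebesgue measure of $\Omega$. The Fourier transform is $\hat u(\xi)=\int_{\mathbb{R}^N}e^{-i\xi\cdot x}u(x)\,dx$. The $m$-order logarithmic Laplacian $\mathcal{L}_m$ is the operator with Fourier symbol $(2\log|\xi|)^m$. Functions on $\Omega$ are extended by zero to $\mathbb{R}^N$. Let $\mathbb{H}_{m,0}(\Omega)$ be the closure of $C_c^\infty(\Omega)$ with respect to the norm $\|u\|_m=\big(\int_{\mathbb{R}^N}(\log(e+|\xi|))^m|\hat u(\xi)|^2d\xi\big)^{1/2}$; it embeds compactly in $L^2(\Omega)$. The form $(u,v)_m=\frac1{(2\pi)^N}\int_{\mathbb{R}^N}(2\log|\xi|)^m\hat u(\xi)\overline{\hat v(\xi)}\,d\xi$ with domain $\mathbb{H}_{m,0}(\Omega)$ is closed, symmetric and semibounded from below. The Dirichlet eigenvalues of $\mathcal{L}_m$ in $\Omega$ (i.e. of $\mathcal{L}_mu=\lambda u$ in $\Omega$, $u=0$ in $\mathbb{R}^N\setminus\Omega$) are the numbers $\lambda$ for which there is $0\ne\phi\in\mathbb{H}_{m,0}(\Omega)$ with $(\phi,v)_m=\lambda\int_\Omega\phi v\,dx$ for all $v\in\mathbb{H}_{m,0}(\Omega)$;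 counted with multiplicity they form a sequence $-\infty<\lambda_{m,1}(\Omega)\le\lambda_{m,2}(\Omega)\le\cdots\to+\infty$. *)

theory Defs
  imports "HOL-Analysis.Analysis"
begin

text \<open>
  The constant of the theorem must not depend on the dimension, so the dimension \<open>N\<close> is a
  natural number and not a type. The space \<open>\<real>\<^sup>N\<close> is the set \<open>{..<N} \<rightarrow>\<^sub>E UNIV\<close> of extensional
  functions \<open>nat \<Rightarrow> real\<close>. This is both \<open>space (RN_leb N)\<close> and \<open>topspace (RN_top N)\<close>.
\<close>

definition RN_leb :: "nat \<Rightarrow> (nat \<Rightarrow> real) measure" where
  "RN_leb N = (\<Pi>\<^sub>M i\<in>{..<N}. lborel)"

definition RN_top :: "nat \<Rightarrow> (nat \<Rightarrow> real) topology" where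
  "RN_top N = product_topology (\<lambda>i. euclideanreal) {..<N}"

definition RN_dot :: "nat \<Rightarrow> (nat \<Rightarrow> real) \<Rightarrow> (nat \<Rightarrow> real) \<Rightarrow> real" where
  "RN_dot N x y = (\<Sum>i<N. x i * y i)"

definition RN_norm :: "nat \<Rightarrow> (nat \<Rightarrow> real) \<Rightarrow> real" where
  "RN_norm N x = L2_set x {..<N}"

definition RN_dist :: "nat \<Rightarrow> (nat \<Rightarrow> real) \<Rightarrow> (nat \<Rightarrow> real) \<Rightarrow> real" where
  "RN_dist N x y = RN_norm N (\<lambda>i. x i - y i)"

text \<open>
  Surface measure of a subset \<open>E\<close> of the unit sphere, from polar coordinates: \<open>N\<close> times the
  Lebesgue measure of the cone \<open>{r x | 0 < r \<le> 1, x \<in> E}\<close>. For \<open>N = 1\<close> it is the counting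
  measure on \<open>{-1, 1}\<close>.
\<close>

definition sphere_measure :: "nat \<Rightarrow> (nat \<Rightarrow> real) set \<Rightarrow> real" where
  "sphere_measure N E =
     real N * measure (RN_leb N) {\<lambda>i\<in>{..<N}. r * x i | r x. 0 < r \<and> r \<le> 1 \<and> x \<in> E}"

definition omega :: "nat \<Rightarrow> real" where
  "omega N = sphere_measure N {x \<in> space (RN_leb N). RN_norm N x = 1}"

definition bounded_domain :: "nat \<Rightarrow> (nat \<Rightarrow> real) set \<Rightarrow> bool" where
  "bounded_domain N \<Omega> \<longleftrightarrow>
     \<Omega> \<noteq> {} \<and> openin (RN_top N) \<Omega> \<and> connectedin (RN_top N) \<Omega> \<and>
     (\<exists>R. \<forall>x\<in>\<Omega>. RN_norm N x \<le> R)"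

text \<open>Orthogonal projection onto the hyperplane \<open>\<nu>\<^sup>\<bottom>\<close>, for a unit vector \<open>\<nu>\<close>.\<close>

definition hyp_proj :: "nat \<Rightarrow> (nat \<Rightarrow> real) \<Rightarrow> (nat \<Rightarrow> real) \<Rightarrow> (nat \<Rightarrow> real)" where
  "hyp_proj N \<nu> x = (\<lambda>i\<in>{..<N}. x i - RN_dot N x \<nu> * \<nu> i)"

text \<open>
  Near each boundary point, \<open>\<Omega>\<close> is the strict epigraph, in some unit direction \<open>\<nu>\<close>, of a
  Lipschitz function \<open>g\<close> on the hyperplane \<open>\<nu>\<^sup>\<bottom>\<close>.
\<close>

definition lipschitz_boundary :: "nat \<Rightarrow> (nat \<Rightarrow> real) set \<Rightarrow> bool" where
  "lipschitz_boundary N \<Omega> \<longleftrightarrow>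
     (\<forall>p \<in> RN_top N frontier_of \<Omega>.
        \<exists>r>0. \<exists>\<nu> \<in> space (RN_leb N). \<exists>L. \<exists>g :: (nat \<Rightarrow> real) \<Rightarrow> real.
          RN_norm N \<nu> = 1 \<and>
          (\<forall>y \<in> space (RN_leb N). \<forall>z \<in> space (RN_leb N).
             RN_dot N y \<nu> = 0 \<longrightarrow> RN_dot N z \<nu> = 0 \<longrightarrow> \<bar>g y - g z\<bar> \<le> L * RN_dist N y z) \<and>
          (\<forall>x \<in> space (RN_leb N). RN_dist N x p < r \<longrightarrow>
             (x \<in> \<Omega> \<longleftrightarrow> g (hyp_proj N \<nu> x) < RN_dot N x \<nu>)))"

definition partial :: "nat \<Rightarrow> ((nat \<Rightarrow> real) \<Rightarrow> real) \<Rightarrow> ((nat \<Rightarrow> real) \<Rightarrow> real)" where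
  "partial i u = (\<lambda>x. deriv (\<lambda>t. u (x(i := t))) (x i))"

text \<open>All iterated partial derivatives exist and are continuous.\<close>

definition smooth_RN :: "nat \<Rightarrow> ((nat \<Rightarrow> real) \<Rightarrow> real) \<Rightarrow> bool" where
  "smooth_RN N u \<longleftrightarrow>
     (\<forall>is. set is \<subseteq> {..<N} \<longrightarrow>
        continuous_map (RN_top N) euclideanreal (foldr partial is u) \<and>
        (\<forall>i<N. \<forall>x \<in> space (RN_leb N).
           (\<lambda>t. foldr partial is u (x(i := t))) differentiable (at (x i))))"

text \<open>Functions are real-valued, and functions on \<open>\<Omega>\<close> are identified with their extension by zero.\<close>

definition test_functions :: "nat \<Rightarrow> (nat \<Rightarrow> real) set \<Rightarrow> ((nat \<Rightarrow> real) \<Rightarrow> real) set" where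
  "test_functions N \<Omega> =
     {u. smooth_RN N u \<and> (\<exists>K. compactin (RN_top N) K \<and> K \<subseteq> \<Omega> \<and> (\<forall>x. x \<notin> K \<longrightarrow> u x = 0))}"

definition fourier :: "nat \<Rightarrow> ((nat \<Rightarrow> real) \<Rightarrow> real) \<Rightarrow> (nat \<Rightarrow> real) \<Rightarrow> complex" where
  "fourier N u \<xi> = (LINT x|RN_leb N. exp (- (\<i> * of_real (RN_dot N \<xi> x))) * of_real (u x))"

text \<open>The square of the norm \<open>\<parallel>u\<parallel>\<^sub>m\<close>, with value \<open>\<infinity>\<close> allowed.\<close>

definition Hm_norm_sq :: "nat \<Rightarrow> nat \<Rightarrow> ((nat \<Rightarrow> real) \<Rightarrow> real) \<Rightarrow> ennreal" where
  "Hm_norm_sq m N u =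
     (\<integral>\<^sup>+\<xi>. ennreal (ln (exp 1 + RN_norm N \<xi>) ^ m * (cmod (fourier N u \<xi>))\<^sup>2) \<partial>RN_leb N)"

text \<open>
  The closure is taken in \<open>L\<^sup>2(\<Omega>)\<close>, which contains the completion because \<open>\<parallel>u\<parallel>\<^sub>m\<close> dominates
  the \<open>L\<^sup>2\<close> norm. Since \<open>\<Omega>\<close> is bounded, these functions are integrable and \<open>fourier\<close> is an
  absolutely convergent integral. Elements are functions, not classes modulo null sets.
\<close>

definition Hm0 :: "nat \<Rightarrow> nat \<Rightarrow> (nat \<Rightarrow> real) set \<Rightarrow> ((nat \<Rightarrow> real) \<Rightarrow> real) set" where
  "Hm0 m N \<Omega> =
     {u. u \<in> borel_measurable (RN_leb N) \<and> integrable (RN_leb N) (\<lambda>x. (u x)\<^sup>2) \<and>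
         (\<forall>x. x \<notin> \<Omega> \<longrightarrow> u x = 0) \<and>
         (\<exists>f. (\<forall>n::nat. f n \<in> test_functions N \<Omega>) \<and>
              (\<lambda>n. Hm_norm_sq m N (\<lambda>x. f n x - u x)) \<longlonglongrightarrow> 0)}"

definition log_form ::
  "nat \<Rightarrow> nat \<Rightarrow> ((nat \<Rightarrow> real) \<Rightarrow> real) \<Rightarrow> ((nat \<Rightarrow> real) \<Rightarrow> real) \<Rightarrow> complex" where
  "log_form m N u v =
     1 / (2 * of_real pi) ^ N *
     (LINT \<xi>|RN_leb N. of_real ((2 * ln (RN_norm N \<xi>)) ^ m) * fourier N u \<xi> * cnj (fourier N v \<xi>))"

definition eigenspace ::
  "nat \<Rightarrow> nat \<Rightarrow> (nat \<Rightarrow> real) set \<Rightarrow> real \<Rightarrow> ((nat \<Rightarrow> real) \<Rightarrow> real) set" where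
  "eigenspace m N \<Omega> \<mu> =
     {\<phi> \<in> Hm0 m N \<Omega>. \<forall>v \<in> Hm0 m N \<Omega>.
        log_form m N \<phi> v = of_real (\<mu> * (LINT x:\<Omega>|RN_leb N. \<phi> x * v x))}"

text \<open>Linear independence and dimension modulo equality almost everywhere.\<close>

definition indep_ae :: "nat \<Rightarrow> nat \<Rightarrow> (nat \<Rightarrow> (nat \<Rightarrow> real) \<Rightarrow> real) \<Rightarrow> bool" where
  "indep_ae N n \<phi> \<longleftrightarrow>
     (\<forall>c :: nat \<Rightarrow> real. (AE x in RN_leb N. (\<Sum>i<n. c i * \<phi> i x) = 0) \<longrightarrow> (\<forall>i<n. c i = 0))"

definition has_dim_ae :: "nat \<Rightarrow> ((nat \<Rightarrow> real) \<Rightarrow> real) set \<Rightarrow> nat \<Rightarrow> bool" where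
  "has_dim_ae N V n \<longleftrightarrow>
     (\<exists>\<phi>. (\<forall>i<n. \<phi> i \<in> V) \<and> indep_ae N n \<phi>) \<and>
     \<not> (\<exists>\<phi>. (\<forall>i<Suc n. \<phi> i \<in> V) \<and> indep_ae N (Suc n) \<phi>)"

text \<open>
  \<open>lam 1 \<le> lam 2 \<le> \<dots>\<close> lists the Dirichlet eigenvalues with multiplicity (\<open>lam 0\<close> is unused): each
  real \<open>\<mu>\<close> occurs as often as the dimension of its eigenspace, so not at all if it is no eigenvalue.
\<close>

definition dirichlet_eigenvalues ::
  "nat \<Rightarrow> nat \<Rightarrow> (nat \<Rightarrow> real) set \<Rightarrow> (nat \<Rightarrow> real) \<Rightarrow> bool" where
  "dirichlet_eigenvalues m N \<Omega> lam \<longleftrightarrow>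
     (\<forall>i j. 1 \<le> i \<longrightarrow> i \<le> j \<longrightarrow> lam i \<le> lam j) \<and>
     filterlim lam at_top sequentially \<and>
     (\<forall>\<mu>. finite {j. 1 \<le> j \<and> lam j = \<mu>} \<and>
           has_dim_ae N (eigenspace m N \<Omega> \<mu>) (card {j. 1 \<le> j \<and> lam j = \<mu>}))"

definition a_const :: "nat \<Rightarrow> nat \<Rightarrow> real" where
  "a_const m N = real N ^ (m + 1) / (2 ^ m * real m) * ((2 * pi) ^ N / omega N)"

definition b_const :: "nat \<Rightarrow> nat \<Rightarrow> real" where
  "b_const m N = 2 ^ m / real N ^ m * (real m - 1) ^ m + 1 / real N ^ m"

definition c_const :: "nat \<Rightarrow> nat \<Rightarrow> real" where
  "c_const m N = a_const m N * b_const m N"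

end

theory Submission
  imports Defs "HOL-Probability.Probability"
begin

text \<open>
  The argument is of Berezin--Li--Yau type. For orthonormal eigenfunctions \<open>\<psi>\<^sub>1, \<dots>, \<psi>\<^sub>k\<close> put
  \<open>F(\<xi>) = \<Sum>\<^sub>j |\<psi>\<^sub>j^(\<xi>)|\<^sup>2\<close>. Bessel's inequality gives \<open>0 \<le> F \<le> |\<Omega>|\<close>, Plancherel's identity gives
  \<open>\<integral>F = (2\<pi>)\<^sup>N k\<close>, and the eigenvalue equation gives \<open>\<integral>(2 ln |\<xi>|)\<^sup>m F \<le> (2\<pi>)\<^sup>N k \<lambda>\<^sub>k\<close>. Let \<open>P\<close> be such
  that \<open>A\<^sup>m := (N/2)\<^sup>m (\<lambda>\<^sub>k + P) \<ge> 1\<close>. Then \<open>(2\<pi>)\<^sup>N k (N/2)\<^sup>m P \<le> \<integral>(A\<^sup>m - (ln s)\<^sup>m) F\<close>, where \<open>s = |\<xi>|\<^sup>N\<close>, and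
  the tangent of \<open>t \<mapsto> t\<^sup>m\<close> at \<open>A\<close> bounds the integrand by \<open>m A\<^sup>m\<^sup>-\<^sup>1 (A - ln s) |\<Omega>|\<close> on \<open>s \<le> e\<^sup>A\<close>, up to a
  correction on \<open>s < 1\<close> whose integral depends only on \<open>m\<close>. The map \<open>\<xi> \<mapsto> s\<close> sends Lebesgue measure to
  \<open>\<omega>\<^sub>N/N\<close> times Lebesgue measure, and \<open>A - ln s\<close> has integral \<open>e\<^sup>A\<close> over \<open>0 < s \<le> e\<^sup>A\<close>; hence
  \<open>X \<le> A\<^sup>m\<^sup>-\<^sup>1 e\<^sup>A + C\<^sub>m\<close> for \<open>X = a\<^sub>m P k / |\<Omega>|\<close>. Solving this for \<open>A\<close>, with \<open>P = b\<^sub>m\<close> and with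
  \<open>P = -\<lambda>\<^sub>1 + b\<^sub>m\<close>, yields the two lower bounds.
\<close>

section \<open>A scalar inequality\<close>

text \<open>Both parts are one estimate for any \<open>P > 0\<close> with
  \<open>lam k + P \<ge> b_const m N\<close>. The choice \<open>P = b\<close> qualifies as soon as
  \<open>lam k \<ge> 0\<close>, and \<open>P = - lam 1 + b\<close> qualifies because
  \<open>lam 1 \<le> lam k\<close>. The origin of \<open>b\<close> is the identity (N/2)^m b =
  (m-1)^m + 2^(-m), whose value is at least 1 in every dimension; this is what makes
  \<open>A \<ge> 1\<close>. The delicate point is that the threshold must not depend on N. In the
  variable s the dimension survives only inside X, and the remaining constant C is a function of m
  alone. C is there because t^m is concave on the negative axis for odd m, so that its tangent at A
  no longer bounds it from below. The inequality X \<le> A^(m-1) e^A + C has no closed solution, and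
  the minimum in the theorem records a dichotomy. Either A^(m-1) is at least X / e^\<tau>, which is
  the first entry after raising to the power m/(m-1), or A is large enough for the excess C to be
  absorbed, and then A is at least the approximate solution ln X - (m-1) ln ln X with its
  corrections.\<close>

lemma power_le_self: "0 \<le> r \<Longrightarrow> r \<le> 1 \<Longrightarrow> 1 \<le> n \<Longrightarrow> r ^ n \<le> (r::real)"
  using power_decreasing[of 1 n r] by simp

text \<open>Apply \<open>ln w \<le> w - 1\<close> to the root w = z^(1/(2n)); the n-th power of that
  root is \<open>sqrt z\<close>.\<close>

lemma ln_power_le_sqrt:
  fixes z :: real
  assumes "z \<ge> 1" "n \<ge> 1"
  shows "ln z ^ n \<le> (2 * real n) ^ n * sqrt z"
proof -
  have "ln z = 2 * real n * ln (z powr (1 / (2 * real n)))"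
    using assms by (simp add: ln_powr)
  also have "\<dots> \<le> 2 * real n * z powr (1 / (2 * real n))"
    using assms ln_le_minus_one[of "z powr (1 / (2 * real n))"] by (intro mult_left_mono) auto
  finally have "ln z ^ n \<le> (2 * real n * z powr (1 / (2 * real n))) ^ n"
    using assms by (intro power_mono) auto
  also have "\<dots> = (2 * real n) ^ n * sqrt z"
    using assms by (simp add: power_mult_distrib powr_half_sqrt[symmetric] powr_realpow[symmetric]
      powr_powr del: of_nat_power)
  finally show ?thesis .
qed

text \<open>Inverts X \<le> A^n e^A + C. If A were below the claimed value, then e^A would be less
  than (X + \<tau>^n e^\<tau>) / (2 L^n) with L = ln X. Multiplied by A^n, the two summands
  contribute at most X/2 each, and the second one falls short of X/2 by X ln A / (2 L). This deficit
  exceeds C once ln A > 2 C. So the term \<open>ln 2\<close> pays for the shift \<tau>^n e^\<tau>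
  inside the logarithm.\<close>

lemma scalar_threshold:
  fixes C :: real
  assumes "n \<ge> 1" "C \<ge> 0"
  obtains \<tau> :: real where "\<tau> > 1"
    "\<And>X. X \<ge> 0 \<Longrightarrow> 0 \<le> ln (X + \<tau> ^ n * exp \<tau>) - real n * ln (ln (X + exp 1)) - ln 2"
    "\<And>A X. A \<ge> 1 \<Longrightarrow> X \<ge> 0 \<Longrightarrow> X \<le> A ^ n * exp A + C \<Longrightarrow> A ^ n < X / exp \<tau> \<Longrightarrow>
       ln (X + \<tau> ^ n * exp \<tau>) - real n * ln (ln (X + exp 1)) - ln 2 \<le> A"
proof
  define M where "M = 2 * real n"
  \<comment> \<open>Each summand has one use: 2 gives \<open>\<tau> \<le> 2 * A\<close> once
    \<open>A \<ge> \<tau> - 1\<close>; \<open>exp (2 * C)\<close> then gives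
    \<open>ln A > 2 * C\<close>; \<open>exp 1 + (M ^ n)\<^sup>2\<close> makes the logarithmic
    expression nonnegative; \<open>2 * C\<close> forces \<open>A \<ge> \<tau> - 1\<close>.\<close>
  define \<tau> where "\<tau> = 2 + exp (2 * C) + exp 1 + (M ^ n)\<^sup>2 + 2 * C"
  have t2: "\<tau> \<ge> 2" "\<tau> > 1 + exp (2 * C)" "\<tau> \<ge> exp 1 + (M ^ n)\<^sup>2" "\<tau> \<ge> 2 * C"
    using assms exp_gt_zero[of "2 * C"] exp_gt_zero[of "1::real"] zero_le_power2[of "M ^ n"]
    unfolding \<tau>_def by linarith+
  show "\<tau> > 1" using t2 by simp
  have et: "exp \<tau> \<ge> \<tau>" using exp_ge_add_one_self[of \<tau>] by linarith
  have tn: "\<tau> ^ n \<ge> 1" using t2 by simp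
  have ten: "exp \<tau> \<le> \<tau> ^ n * exp \<tau>" using mult_right_mono[OF tn, of "exp \<tau>"] by simp
  show "0 \<le> ln (X + \<tau> ^ n * exp \<tau>) - real n * ln (ln (X + exp 1)) - ln 2" if X: "X \<ge> 0" for X
  proof -
    define z where "z = X + exp 1"
    have z: "z \<ge> exp 1" using X by (simp add: z_def)
    have z1: "z > 1" using z exp_gt_one[of 1] by linarith
    have lz: "ln z \<ge> 1" using z z1 by (metis exp_gt_zero ln_exp ln_mono)
    have "2 * (ln z ^ n) \<le> 2 * (M ^ n * sqrt z)"
      using ln_power_le_sqrt[of z n] z1 assms by (simp add: M_def)
    also have "\<dots> \<le> z + (M ^ n)\<^sup>2"
      using z1 sum_squares_bound[of "M ^ n" "sqrt z"] by (simp add: algebra_simps)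
    also have "\<dots> \<le> X + \<tau> ^ n * exp \<tau>" using t2 et ten unfolding z_def by linarith
    finally have 1: "2 * ln z ^ n \<le> X + \<tau> ^ n * exp \<tau>" .
    have "real n * ln (ln z) + ln 2 = ln (2 * ln z ^ n)"
      using lz by (simp add: ln_mult ln_realpow)
    also have "\<dots> \<le> ln (X + \<tau> ^ n * exp \<tau>)"
      using 1 lz by (intro ln_mono) auto
    finally show ?thesis by (simp add: z_def)
  qed
  show "ln (X + \<tau> ^ n * exp \<tau>) - real n * ln (ln (X + exp 1)) - ln 2 \<le> A" (is "?Y \<le> A")
    if A: "A \<ge> 1" and X: "X \<ge> 0" and XA: "X \<le> A ^ n * exp A + C" and AX: "A ^ n < X / exp \<tau>" for A X
  proof (rule ccontr)
    assume "\<not> ?Y \<le> A"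
    then have AY: "A < ?Y" by simp
    have An: "A ^ n \<ge> 1" using A by simp
    have AX': "A ^ n * exp \<tau> < X" using AX by (simp add: field_simps)
    have Xt: "exp \<tau> < X" using AX' mult_right_mono[OF An exp_ge_zero[of \<tau>]] by linarith
    have X1: "X > 1" using Xt et t2 by linarith
    \<comment> \<open>The two bounds on X give A^n (e^\<tau> - e^A) < C. If A were smaller than
      \<tau> - 1, then e^A \<le> e^\<tau> / 2 and the left side would be at least e^\<tau> / 2 \<ge>
      C.\<close>
    have At: "A \<ge> \<tau> - 1"
    proof (rule ccontr)
      assume "\<not> A \<ge> \<tau> - 1"
      then have "exp A \<le> exp (\<tau> - 1)" by simp
      also have "\<dots> = exp \<tau> / exp 1" by (simp add: exp_diff)
      also have "\<dots> \<le> exp \<tau> / 2" using exp_ge_add_one_self[of 1] by (intro divide_left_mono) auto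
      finally have *: "exp \<tau> / 2 \<le> exp \<tau> - exp A" by simp
      have "C \<le> exp \<tau> / 2" using et t2 by linarith
      also have "\<dots> \<le> 1 * (exp \<tau> - exp A)" using * by simp
      also have "\<dots> \<le> A ^ n * (exp \<tau> - exp A)"
        by (intro mult_right_mono An) (use * in \<open>smt (verit) exp_gt_zero half_gt_zero\<close>)
      finally show False using AX' XA by (simp add: algebra_simps)
    qed
    define L where "L = ln X"
    have "real n * ln A + \<tau> = ln (A ^ n * exp \<tau>)" using A by (simp add: ln_mult ln_realpow)
    also have "\<dots> < L" unfolding L_def using AX' A X1 by (subst ln_less_cancel_iff) auto
    finally have L: "real n * ln A + \<tau> < L" .
    have lA: "ln A > 2 * C"
    proof -
      have "exp (2 * C) < A" using At t2 by linarith
      then show ?thesis using A by (metis exp_less_cancel_iff exp_ln less_le_trans zero_less_one)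
    qed
    have nlA: "ln A \<le> real n * ln A" using assms lA by (simp add: mult_le_cancel_right1)
    have Lt: "L \<ge> \<tau>" "L > 1" "L \<ge> 0" using L nlA lA assms t2 by linarith+
    have lX: "ln (X + exp 1) \<ge> L" unfolding L_def using X1 by (intro ln_mono) (auto intro: add_pos_pos)
    define G where "G = X + \<tau> ^ n * exp \<tau>"
    have G0: "G > 0" using X1 t2 by (simp add: G_def add_pos_pos)
    have "real n * ln L \<le> real n * ln (ln (X + exp 1))"
      using lX Lt by (intro mult_left_mono ln_mono) auto
    with AY have AY': "A < ln G - real n * ln L - ln 2" by (simp add: G_def)
    also have "\<dots> = ln (G / (2 * L ^ n))"
      using G0 Lt by (simp add: ln_div ln_mult ln_realpow)
    finally have "exp A < G / (2 * L ^ n)"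
      using G0 Lt by (metis divide_pos_pos exp_less_mono exp_ln mult_pos_pos zero_less_numeral zero_less_power less_trans zero_less_one)
    then have eA: "exp A \<le> G / (2 * L ^ n)" by simp
    \<comment> \<open>Since \<tau> \<le> 2 A, the shift enlarges X by a factor of at most 1 + 2^n.
      The resulting loss n ln 2 is recovered from n ln L, because L \<ge> \<tau> \<ge> 2.\<close>
    have AL: "A \<le> L"
    proof -
      have "\<tau> ^ n \<le> (2 * A) ^ n" using t2 At by (intro power_mono) auto
      then have "\<tau> ^ n * exp \<tau> \<le> 2 ^ n * (A ^ n * exp \<tau>)"
        by (simp add: power_mult_distrib mult_right_mono)
      also have "\<dots> \<le> 2 ^ n * X" using AX' by (intro mult_left_mono) auto
      finally have "G \<le> (1 + 2 ^ n) * X" by (simp add: G_def algebra_simps)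
      also have "\<dots> \<le> (2 * 2 ^ n) * X" using X1 by (intro mult_right_mono) auto
      finally have "ln G \<le> ln ((2 * 2 ^ n) * X)" using G0 by (intro ln_mono) auto
      also have "\<dots> = ln 2 + real n * ln 2 + L" using X1 by (simp add: ln_mult ln_realpow L_def)
      finally have "ln G \<le> ln 2 + real n * ln 2 + L" .
      moreover have "real n * ln 2 \<le> real n * ln L" using Lt t2 by (intro mult_left_mono ln_mono) auto
      ultimately show ?thesis using AY' by linarith
    qed
    have "X - C \<le> A ^ n * exp A" using XA by simp
    also have "\<dots> \<le> A ^ n * (G / (2 * L ^ n))" using eA An by (intro mult_left_mono) auto
    also have "\<dots> = (X * (A / L) ^ n + (\<tau> / L) ^ n * (A ^ n * exp \<tau>)) / 2"
      using Lt by (simp add: G_def power_divide field_simps)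
    \<comment> \<open>The first half uses A \<le> L, the second A^n e^\<tau> < X. The saving comes
      next: n ln A + \<tau> < L turns \<tau> / L into at most 1 - ln A / L.\<close>
    also have "\<dots> \<le> (X * 1 + (\<tau> / L) ^ n * X) / 2"
      using Lt AL A AX' X1 t2 by (intro divide_right_mono add_mono mult_left_mono power_le_one) auto
    also have "\<dots> \<le> (X * 1 + (1 - ln A / L) * X) / 2"
    proof -
      have "(\<tau> / L) ^ n \<le> \<tau> / L" using Lt t2 assms by (intro power_le_self) auto
      also have "\<dots> \<le> 1 - ln A / L" using L nlA Lt by (simp add: field_simps)
      finally show ?thesis using X1 by (intro divide_right_mono add_mono mult_right_mono) auto
    qed
    finally have "X * ln A / L \<le> 2 * C" by (simp add: field_simps)
    moreover have "ln A \<le> X * ln A / L"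
    proof -
      have "L \<le> X" unfolding L_def using X1 ln_le_minus_one[of X] by linarith
      then have "L * ln A \<le> X * ln A" using lA assms by (intro mult_right_mono) auto
      then show ?thesis using Lt by (simp add: field_simps)
    qed
    ultimately show False using lA by linarith
  qed
qed

text \<open>For t \<ge> 0 the difference of powers factors, and every term of the sum is at most
  A^(m-1). For t < 0 the tangent term alone already covers A^m, and the correction |t|^m covers -
  t^m for either parity of m.\<close>

lemma power_diff_le_tangent:
  fixes A t :: real
  assumes "A \<ge> 0" "m \<ge> 1" "t ^ m < A ^ m"
  shows "A ^ m - t ^ m \<le> real m * A ^ (m - 1) * (A - t) + (if t < 0 then \<bar>t\<bar> ^ m else 0)" "t < A"
proof -
  show tA: "t < A"
    using assms power_mono[of A t m] by (meson linorder_not_le)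
  show "A ^ m - t ^ m \<le> real m * A ^ (m - 1) * (A - t) + (if t < 0 then \<bar>t\<bar> ^ m else 0)"
  proof (cases "t < 0")
    case True
    have "A ^ m = A ^ (m - 1) * A" using assms by (metis mult.commute power_eq_if not_one_le_zero)
    also have "\<dots> \<le> A ^ (m - 1) * (A - t)" using True assms by (intro mult_left_mono) auto
    also have "\<dots> \<le> real m * (A ^ (m - 1) * (A - t))" using assms tA
      by (intro mult_le_cancel_right1[THEN iffD2]) (auto simp: mult_less_0_iff)
    finally have "A ^ m \<le> real m * A ^ (m - 1) * (A - t)" by (simp add: mult.assoc)
    moreover have "- (t ^ m) \<le> \<bar>t\<bar> ^ m" by (metis abs_le_D2 order_refl power_abs)
    ultimately show ?thesis using True by simp
  next
    case False
    have "A ^ m - t ^ m = (A - t) * (\<Sum>i<m. t ^ (m - Suc i) * A ^ i)"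
      using power_diff_sumr2[of A m t] by simp
    also have "\<dots> \<le> (A - t) * (\<Sum>i<m. A ^ (m - 1))"
    proof (intro mult_left_mono sum_mono)
      fix i assume i: "i \<in> {..<m}"
      have "t ^ (m - Suc i) * A ^ i \<le> A ^ (m - Suc i) * A ^ i"
        using False tA assms by (intro mult_right_mono power_mono) auto
      also have "\<dots> = A ^ (m - 1)" using i by (simp add: power_add[symmetric])
      finally show "t ^ (m - Suc i) * A ^ i \<le> A ^ (m - 1)" .
    qed (use tA in auto)
    finally show ?thesis using False by (simp add: algebra_simps)
  qed
qed

section \<open>Lebesgue measure on \<open>\<real>\<^sup>N\<close>\<close>

interpretation leb: product_sigma_finite "\<lambda>_::nat. lborel :: real measure" ..

lemma sigma_finite_RN: "sigma_finite_measure (RN_leb N)"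
proof -
  interpret finite_product_sigma_finite "\<lambda>_::nat. lborel :: real measure" "{..<N}"
    by standard simp
  show ?thesis unfolding RN_leb_def by (rule sigma_finite_measure_axioms)
qed

interpretation RN: sigma_finite_measure "RN_leb N" for N
  by (rule sigma_finite_RN)

interpretation RN2: pair_sigma_finite "RN_leb N" "RN_leb M" for N M
  by (simp add: pair_sigma_finite_def sigma_finite_RN)

lemma space_RN: "space (RN_leb N) = {..<N} \<rightarrow>\<^sub>E UNIV"
  by (simp add: RN_leb_def space_PiM)

lemma topspace_RN: "topspace (RN_top N) = {..<N} \<rightarrow>\<^sub>E UNIV"
  by (simp add: RN_top_def)

lemma sets_RN [measurable_cong]: "sets (RN_leb N) = sets (Pi\<^sub>M {..<N} (\<lambda>_. borel))"
  unfolding RN_leb_def by (intro sets_PiM_cong) auto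

lemma measurable_RN_component [measurable]: "(\<lambda>x. x i) \<in> borel_measurable (RN_leb N)"
proof (cases "i < N")
  case True
  then show ?thesis unfolding RN_leb_def using measurable_component_singleton[of i "{..<N}" "\<lambda>_. lborel"] by simp
next
  case False
  then have "(\<lambda>x. x i) \<in> borel_measurable (RN_leb N) \<longleftrightarrow>
    (\<lambda>x. undefined::real) \<in> borel_measurable (RN_leb N)"
    by (intro measurable_cong) (auto simp: space_RN)
  then show ?thesis by simp
qed

lemma measurable_RN_restrict [measurable (raw)]:
  assumes "\<And>i. i < N \<Longrightarrow> f i \<in> borel_measurable M"
  shows "(\<lambda>x. \<lambda>i\<in>{..<N}. f i x) \<in> measurable M (RN_leb N)"
  unfolding RN_leb_def using assms by (intro measurable_restrict) simp

lemma measurable_RN_norm [measurable]: "RN_norm N \<in> borel_measurable (RN_leb M)"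
  unfolding RN_norm_def L2_set_def by measurable

lemma measurable_RN_dot [measurable (raw)]:
  assumes f: "f \<in> measurable M (RN_leb N)" and g: "g \<in> measurable M (RN_leb N)"
  shows "(\<lambda>x. RN_dot N (f x) (g x)) \<in> borel_measurable M"
  unfolding RN_dot_def
  using measurable_compose[OF f measurable_RN_component] measurable_compose[OF g measurable_RN_component]
  by measurable

text \<open>It suffices to compare the two measures on boxes, where the one-dimensional substitution
  contributes a factor |c| per coordinate. Translation invariance is the case c = 1; the scaling by
  c is needed for the Gaussians of small width.\<close>

lemma RN_affine:
  assumes "c \<noteq> 0"
  shows "RN_leb N = density (distr (RN_leb N) (RN_leb N) (\<lambda>x. \<lambda>i\<in>{..<N}. t i + c * x i)) (\<lambda>_. ennreal (\<bar>c\<bar> ^ N))"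
    (is "_ = ?D")
proof -
  have "?D = Pi\<^sub>M {..<N} (\<lambda>_. lborel)"
  proof (rule leb.PiM_eqI)
    fix A :: "nat \<Rightarrow> real set" assume A: "\<And>i. i \<in> {..<N} \<Longrightarrow> A i \<in> sets lborel"
    have PA: "Pi\<^sub>E {..<N} A \<in> sets (RN_leb N)" unfolding RN_leb_def using A by (intro sets_PiM_I_finite) auto
    have pre: "(\<lambda>x. \<lambda>i\<in>{..<N}. t i + c * x i) -` Pi\<^sub>E {..<N} A \<inter> space (RN_leb N)
       = Pi\<^sub>E {..<N} (\<lambda>i. (\<lambda>s. t i + c * s) -` A i)"
      by (auto simp: space_RN PiE_iff)
    have m: "(\<lambda>s. t i + c * s) -` A i \<in> sets borel" if "i < N" for i
      using A[of i] that measurable_sets_borel[of "\<lambda>s. t i + c * s" borel "A i"] by simp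
    have e: "emeasure lborel (A i) = ennreal \<bar>c\<bar> * emeasure lborel ((\<lambda>s. t i + c * s) -` A i)" if "i < N" for i
      using A[of i] that assms by (subst lborel_real_affine[of c "t i"])
        (auto simp: emeasure_density_const emeasure_distr)
    have "emeasure ?D (Pi\<^sub>E {..<N} A) = ennreal (\<bar>c\<bar> ^ N) * emeasure (RN_leb N) (Pi\<^sub>E {..<N} (\<lambda>i. (\<lambda>s. t i + c * s) -` A i))"
      using PA by (subst emeasure_density_const) (auto simp: emeasure_distr pre)
    also have "\<dots> = ennreal (\<bar>c\<bar> ^ N) * (\<Prod>i<N. emeasure lborel ((\<lambda>s. t i + c * s) -` A i))"
      unfolding RN_leb_def using m by (subst leb.emeasure_PiM) auto
    also have "\<dots> = (\<Prod>i<N. ennreal \<bar>c\<bar> * emeasure lborel ((\<lambda>s. t i + c * s) -` A i))"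
      by (simp add: prod.distrib ennreal_power)
    also have "\<dots> = (\<Prod>i<N. emeasure lborel (A i))"
      using e by (intro prod.cong) auto
    finally show "emeasure ?D (Pi\<^sub>E {..<N} A) = (\<Prod>i<N. emeasure lborel (A i))" .
  qed (auto simp: RN_leb_def)
  then show ?thesis by (simp add: RN_leb_def)
qed

lemma nn_integral_RN_affine:
  assumes "c \<noteq> 0" and [measurable]: "f \<in> borel_measurable (RN_leb N)"
  shows "(\<integral>\<^sup>+x. f x \<partial>RN_leb N) = ennreal (\<bar>c\<bar> ^ N) * (\<integral>\<^sup>+x. f (\<lambda>i\<in>{..<N}. t i + c * x i) \<partial>RN_leb N)"
  by (subst RN_affine[OF assms(1), of N t])
     (auto simp: nn_integral_density nn_integral_distr nn_integral_cmult)

lemma nn_integral_RN_translate: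
  assumes [measurable]: "f \<in> borel_measurable (RN_leb N)"
  shows "(\<integral>\<^sup>+x. f (\<lambda>i\<in>{..<N}. x i + t i) \<partial>RN_leb N) = (\<integral>\<^sup>+x. f x \<partial>RN_leb N)"
  using nn_integral_RN_affine[of 1 f N t] by (simp add: add.commute)

lemma integral_RN_affine:
  fixes f :: "_ \<Rightarrow> _::{banach, second_countable_topology}"
  assumes "c \<noteq> 0" and [measurable]: "f \<in> borel_measurable (RN_leb N)"
  shows "(LINT x|RN_leb N. f x) = \<bar>c\<bar> ^ N *\<^sub>R (LINT x|RN_leb N. f (\<lambda>i\<in>{..<N}. t i + c * x i))"
  by (subst RN_affine[OF assms(1), of N t])
     (auto simp: integral_density integral_distr)

text \<open>On the full product over \<open>nat\<close> the Borel sets are the product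
  sigma-algebra. An open set is carried there by restriction to \<open>{..<N}\<close> and pulled
  back along extension by 0, which restriction undoes.\<close>

lemma openin_RN_sets:
  assumes "openin (RN_top N) U"
  shows "U \<in> sets (RN_leb N)"
proof -
  have "continuous_map euclidean (RN_top N) (\<lambda>x. restrict x {..<N})"
    unfolding RN_top_def continuous_map_componentwise
    by (auto intro: continuous_on_product_coordinates)
  from openin_continuous_map_preimage[OF this assms]
  have "open {x. restrict x {..<N} \<in> U}" by simp
  then have "{x. restrict x {..<N} \<in> U} \<in> sets (Pi\<^sub>M UNIV (\<lambda>_::nat. borel::real measure))"
    by (simp add: sets_PiM_equal_borel)
  moreover have "(\<lambda>x i. if i < N then x i else 0) \<in> measurable (RN_leb N) (Pi\<^sub>M UNIV (\<lambda>_::nat. borel::real measure))"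
    by (rule measurable_PiM_single') (auto simp: space_PiM)
  ultimately have "(\<lambda>x i. if i < N then x i else 0) -` {x. restrict x {..<N} \<in> U} \<inter> space (RN_leb N) \<in> sets (RN_leb N)"
    by (rule measurable_sets[rotated])
  moreover have "(\<lambda>x i. if i < N then x i else 0) -` {x. restrict x {..<N} \<in> U} \<inter> space (RN_leb N) = U"
  proof -
    have "restrict (\<lambda>i. if i < N then x i else 0) {..<N} = x" if "x \<in> {..<N} \<rightarrow>\<^sub>E UNIV" for x :: "nat \<Rightarrow> real"
      using that by (auto simp: fun_eq_iff PiE_def extensional_def)
    moreover have "U \<subseteq> {..<N} \<rightarrow>\<^sub>E UNIV" using openin_subset[OF assms] by (simp add: topspace_RN)
    ultimately show ?thesis by (auto simp: space_RN subset_eq)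
  qed
  ultimately show ?thesis by simp
qed

lemma continuous_map_RN_measurable:
  assumes "continuous_map (RN_top N) euclideanreal f"
  shows "f \<in> borel_measurable (RN_leb N)"
proof (rule borel_measurableI)
  fix S :: "real set" assume "open S"
  then have "openin (RN_top N) {x \<in> topspace (RN_top N). f x \<in> S}"
    using assms by (intro openin_continuous_map_preimage) auto
  then have "{x \<in> topspace (RN_top N). f x \<in> S} \<in> sets (RN_leb N)" by (rule openin_RN_sets)
  moreover have "{x \<in> topspace (RN_top N). f x \<in> S} = f -` S \<inter> space (RN_leb N)"
    by (auto simp: topspace_RN space_RN)
  ultimately show "f -` S \<inter> space (RN_leb N) \<in> sets (RN_leb N)" by simp
qed

lemma RN_norm_nonneg [simp]: "RN_norm N x \<ge> 0"
  by (simp add: RN_norm_def)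

lemma abs_component_le_RN_norm: "i < N \<Longrightarrow> \<bar>x i\<bar> \<le> RN_norm N x"
  unfolding RN_norm_def using member_le_L2_set[of "{..<N}" i "\<lambda>i. \<bar>x i\<bar>"]
  by (simp add: L2_set_def)

lemma emeasure_RN_cball:
  assumes "r > 0"
  shows "emeasure (RN_leb N) {x \<in> space (RN_leb N). RN_norm N x \<le> r} = ennreal (unit_ball_vol (real N) * r ^ N)"
  using emeasure_cball_aux[of "{..<N}" r] assms
  by (simp add: RN_leb_def RN_norm_def L2_set_def Int_def conj_commute)

lemma emeasure_RN_zero:
  assumes "N \<ge> 1" shows "emeasure (RN_leb N) {\<lambda>i\<in>{..<N}. 0} = 0"
proof -
  have "{\<lambda>i\<in>{..<N}. 0::real} = Pi\<^sub>E {..<N} (\<lambda>_. {0})"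
    by (simp add: PiE_over_singleton_iff)
  moreover have "emeasure (RN_leb N) (Pi\<^sub>E {..<N} (\<lambda>_. {0})) = 0"
    unfolding RN_leb_def using assms by (subst leb.emeasure_PiM) auto
  ultimately show ?thesis by simp
qed

lemma singleton_RN_sets: "{\<lambda>i\<in>{..<N}. 0} \<in> sets (RN_leb N)"
proof -
  have "{\<lambda>i\<in>{..<N}. 0::real} = Pi\<^sub>E {..<N} (\<lambda>_. {0})"
    by (simp add: PiE_over_singleton_iff)
  moreover have "Pi\<^sub>E {..<N} (\<lambda>_. {0}) \<in> sets (RN_leb N)"
    unfolding RN_leb_def by (intro sets_PiM_I_finite) auto
  ultimately show ?thesis by simp
qed

lemma RN_norm_eq_0:
  assumes "x \<in> space (RN_leb N)" "RN_norm N x = 0" shows "x = (\<lambda>i\<in>{..<N}. 0)"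
proof
  fix i show "x i = (\<lambda>i\<in>{..<N}. 0) i"
    using assms abs_component_le_RN_norm[of i N x] by (cases "i < N") (auto simp: space_RN)
qed

lemma RN_norm_scale: "RN_norm N (\<lambda>i\<in>{..<N}. r * x i) = \<bar>r\<bar> * RN_norm N x"
proof -
  have "RN_norm N (\<lambda>i\<in>{..<N}. r * x i) = L2_set (\<lambda>i. r * x i) {..<N}"
    unfolding RN_norm_def by (intro L2_set_cong) auto
  also have "\<dots> = \<bar>r\<bar> * RN_norm N x"
    by (simp add: RN_norm_def L2_set_def power_mult_distrib sum_distrib_left[symmetric] real_sqrt_mult)
  finally show ?thesis .
qed

text \<open>The cone over the unit sphere is the closed unit ball without its centre, and the centre
  is a null set.\<close>

lemma omega_eq:
  assumes "N \<ge> 1"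
  shows "omega N = real N * unit_ball_vol (real N)"
proof -
  let ?Z = "\<lambda>i\<in>{..<N}. 0::real" and ?B = "{x \<in> space (RN_leb N). RN_norm N x \<le> 1}"
  let ?C = "{\<lambda>i\<in>{..<N}. r * x i | r x. 0 < r \<and> r \<le> 1 \<and> x \<in> {x \<in> space (RN_leb N). RN_norm N x = 1}}"
  have C: "?C = ?B - {?Z}"
  proof (intro set_eqI iffI)
    fix y assume "y \<in> ?C"
    then obtain r x where rx: "y = (\<lambda>i\<in>{..<N}. r * x i)" "0 < r" "r \<le> 1" "RN_norm N x = 1" by auto
    have "RN_norm N y = r" using rx by (simp add: RN_norm_scale)
    moreover have "RN_norm N ?Z = 0" by (simp add: RN_norm_def L2_set_def)
    ultimately show "y \<in> ?B - {?Z}" using rx by (auto simp: space_RN)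
  next
    fix y assume y: "y \<in> ?B - {?Z}"
    define r where "r = RN_norm N y"
    have r: "r > 0" "r \<le> 1" using y RN_norm_eq_0[of y N] by (auto simp: r_def less_le)
    have "y = (\<lambda>i\<in>{..<N}. r * (\<lambda>i\<in>{..<N}. (1/r) * y i) i)"
      using r y by (auto simp: fun_eq_iff space_RN)
    moreover have "RN_norm N (\<lambda>i\<in>{..<N}. (1/r) * y i) = 1"
      using r by (subst RN_norm_scale) (simp add: r_def)
    ultimately show "y \<in> ?C" using r by (intro CollectI exI[of _ r] exI[of _ "\<lambda>i\<in>{..<N}. (1/r) * y i"])
      (auto simp: space_RN)
  qed
  have B: "emeasure (RN_leb N) ?B = ennreal (unit_ball_vol (real N))"
    using emeasure_RN_cball[of 1 N] by simp
  have e: "emeasure (RN_leb N) (?B - {?Z}) = emeasure (RN_leb N) ?B"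
    using emeasure_RN_zero[OF assms] singleton_RN_sets[of N] by (intro emeasure_Diff_null_set) (auto simp: null_sets_def)
  then have "measure (RN_leb N) ?C = unit_ball_vol (real N)"
    unfolding C measure_def e B using unit_ball_vol_pos[of "real N"] by simp
  then show ?thesis unfolding omega_def sphere_measure_def by simp
qed

section \<open>Logarithmic integrals\<close>

text \<open>The set where the N-th power of the norm is at most a is a ball of radius a^(1/N), so
  its volume is linear in a; half-lines determine both measures. This linearity is the reason for
  the exponent N.\<close>

lemma distr_RN_norm_power:
  assumes "N \<ge> 1"
  shows "distr (RN_leb N) borel (\<lambda>x. RN_norm N x ^ N) =
    density lborel (\<lambda>s. ennreal (unit_ball_vol (real N)) * indicator {0..} s)" (is "?L = ?R")
proof (rule measure_eqI_generator_eq)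
  let ?E = "range (\<lambda>a::real. {..a})"
  show "Int_stable ?E" by (auto simp: Int_stable_def)
  show "?E \<subseteq> Pow UNIV" by simp
  show "sets ?L = sigma_sets UNIV ?E" "sets ?R = sigma_sets UNIV ?E"
    by (simp_all add: borel_eq_atMost)
  show "range (\<lambda>i::nat. {..real i}) \<subseteq> ?E" by auto
  show "(\<Union>i::nat. {..real i}) = UNIV" by (auto intro: real_arch_simple)
  have L: "emeasure ?L {..a} = ennreal (unit_ball_vol (real N) * max 0 a)" for a
  proof -
    have "emeasure ?L {..a} = emeasure (RN_leb N) {x \<in> space (RN_leb N). RN_norm N x ^ N \<le> a}"
      by (subst emeasure_distr) (auto intro!: arg_cong[where f = "emeasure _"])
    also have "\<dots> = ennreal (unit_ball_vol (real N) * max 0 a)"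
    proof (cases "a > 0")
      case True
      have "RN_norm N x ^ N \<le> a \<longleftrightarrow> RN_norm N x \<le> root N a" for x
        using True assms real_root_le_iff[of N "RN_norm N x ^ N" a] by (simp add: real_root_power_cancel)
      then show ?thesis using True assms emeasure_RN_cball[of "root N a" N] by simp
    next
      case False
      have "{x \<in> space (RN_leb N). RN_norm N x ^ N \<le> a} \<subseteq> {\<lambda>i\<in>{..<N}. 0}"
      proof
        fix x assume x: "x \<in> {x \<in> space (RN_leb N). RN_norm N x ^ N \<le> a}"
        then have "RN_norm N x ^ N = 0" using False zero_le_power[OF RN_norm_nonneg[of N x], of N] by (smt (verit) mem_Collect_eq)
        then have "RN_norm N x = 0" by simp
        then show "x \<in> {\<lambda>i\<in>{..<N}. 0}" using x RN_norm_eq_0[of x N] by simp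
      qed
      then have "emeasure (RN_leb N) {x \<in> space (RN_leb N). RN_norm N x ^ N \<le> a} \<le> emeasure (RN_leb N) {\<lambda>i\<in>{..<N}. 0}"
        by (intro emeasure_mono singleton_RN_sets)
      then show ?thesis using False emeasure_RN_zero[OF assms] by simp
    qed
    finally show ?thesis .
  qed
  show "emeasure ?L {..real i} \<noteq> \<infinity>" for i by (simp add: L)
  fix X assume "X \<in> ?E"
  then obtain a where X: "X = {..a}" by auto
  have "emeasure ?R {..a} = (\<integral>\<^sup>+s. ennreal (unit_ball_vol (real N)) * indicator {0..a} s \<partial>lborel)"
    by (subst emeasure_density) (auto intro!: nn_integral_cong simp: indicator_def)
  also have "\<dots> = ennreal (unit_ball_vol (real N) * max 0 a)"
    by (subst nn_integral_cmult) (auto simp: ennreal_mult unit_ball_vol_pos less_imp_le max_def)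
  finally show "emeasure ?L X = emeasure ?R X" by (simp add: L X)
qed

lemma nn_integral_RN_norm_power:
  assumes "N \<ge> 1" and [measurable]: "f \<in> borel_measurable borel"
  shows "(\<integral>\<^sup>+x. f (RN_norm N x ^ N) \<partial>RN_leb N) =
    ennreal (unit_ball_vol (real N)) * (\<integral>\<^sup>+s. f s * indicator {0..} s \<partial>lborel)"
proof -
  have "(\<integral>\<^sup>+x. f (RN_norm N x ^ N) \<partial>RN_leb N) = (\<integral>\<^sup>+s. f s \<partial>distr (RN_leb N) borel (\<lambda>x. RN_norm N x ^ N))"
    by (subst nn_integral_distr) auto
  also have "\<dots> = (\<integral>\<^sup>+s. ennreal (unit_ball_vol (real N)) * (f s * indicator {0..} s) \<partial>lborel)"
    unfolding distr_RN_norm_power[OF assms(1)] by (subst nn_integral_density) (auto simp: ac_simps)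
  finally show ?thesis by (simp add: nn_integral_cmult)
qed

lemma abs_ln_power_le:
  fixes s :: real
  assumes "0 < s" "s < 1" "m \<ge> 1"
  shows "\<bar>ln s\<bar> ^ m \<le> (2 * real m) ^ m * (1 / sqrt s)"
  using ln_power_le_sqrt[of "1 / s" m] assms by (simp add: ln_div real_sqrt_divide)

text \<open>Comparison with a multiple of s^(-1/2), whose integral over the unit interval is 2. The
  resulting number is the only error in the whole estimate, and it depends on m alone.\<close>

lemma nn_integral_ln_power:
  assumes "m \<ge> 1"
  shows "(\<integral>\<^sup>+s. ennreal (\<bar>ln s\<bar> ^ m * indicator {0..<1} s) \<partial>lborel) \<le> ennreal (2 * (2 * real m) ^ m)"
proof -
  have "((\<lambda>s. 1 / sqrt s) has_integral (2 * sqrt 1 - 2 * sqrt 0)) {0..1::real}"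
    by (rule fundamental_theorem_of_calculus_interior)
       (auto intro!: continuous_intros derivative_eq_intros simp: has_real_derivative_iff_has_vector_derivative[symmetric] divide_simps)
  then have *: "(\<integral>\<^sup>+s. ennreal (1 / sqrt s) * indicator {0..1} s \<partial>lborel) = ennreal 2"
    using nn_integral_has_integral_lebesgue'[of "{0..1}" "\<lambda>s::real. 1 / sqrt s" 2] by simp
  have "(\<integral>\<^sup>+s. ennreal (\<bar>ln s\<bar> ^ m * indicator {0..<1} s) \<partial>lborel)
     \<le> (\<integral>\<^sup>+s. ennreal ((2 * real m) ^ m) * (ennreal (1 / sqrt s) * indicator {0..1} s) \<partial>lborel)"
  proof (rule nn_integral_mono)
    fix s :: real
    show "ennreal (\<bar>ln s\<bar> ^ m * indicator {0..<1} s) \<le> ennreal ((2 * real m) ^ m) * (ennreal (1 / sqrt s) * indicator {0..1} s)"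
    proof (cases "0 < s \<and> s < 1")
      case True
      then show ?thesis using abs_ln_power_le[of s m] assms
        by (simp add: ennreal_mult'[symmetric] ennreal_leI)
    next
      case False
      \<comment> \<open>At s = 0 the left side vanishes because \<open>ln 0 = 0\<close> and m is
        positive; at all other remaining points its indicator vanishes.\<close>
      then show ?thesis using assms by (cases "s = 0") (auto simp: indicator_def)
    qed
  qed
  also have "\<dots> = ennreal ((2 * real m) ^ m) * ennreal 2"
    by (subst nn_integral_cmult) (auto simp: *)
  also have "\<dots> = ennreal (2 * (2 * real m) ^ m)"
    by (subst ennreal_mult'[symmetric]) (simp_all add: mult.commute)
  finally show ?thesis .
qed

lemma log_gap_nonneg:
  fixes A s :: real
  assumes "A \<ge> 0" "0 \<le> s" "s \<le> exp A"
  shows "0 \<le> A - ln s"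
proof (cases "s = 0")
  case False
  then show ?thesis using assms ln_mono[of s "exp A"] by simp
qed (use assms in simp)

lemma nn_integral_log_gap:
  fixes A :: real
  assumes "A \<ge> 0"
  shows "(\<integral>\<^sup>+s. ennreal ((A - ln s) * indicator {0..exp A} s) \<partial>lborel) = ennreal (exp A)"
proof -
  \<comment> \<open>An antiderivative of A - ln s. It extends continuously by 0 to s = 0, and its
    value at e^A is e^A (A + 1) - e^A A = e^A.\<close>
  let ?H = "\<lambda>s. s * (A + 1) - s * ln s :: real"
  have lim: "((\<lambda>s. s * ln s) \<longlongrightarrow> 0) (at_right (0::real))"
  proof (rule Lim_null_comparison)
    show "((\<lambda>s. 2 * sqrt s) \<longlongrightarrow> 0) (at_right (0::real))"
      by (auto intro!: tendsto_eq_intros)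
    have "\<forall>\<^sub>F s in at_right (0::real). s \<in> {0<..<1}"
      by (rule eventually_at_right_real) simp
    then show "\<forall>\<^sub>F s in at_right (0::real). norm (s * ln s) \<le> 2 * sqrt s"
    proof eventually_elim
      case (elim s)
      have "norm (s * ln s) = s * \<bar>ln s\<bar>" using elim by (simp add: abs_mult)
      also have "\<dots> \<le> s * (2 * (1 / sqrt s))"
        using abs_ln_power_le[of s 1] elim by (intro mult_left_mono) auto
      also have "\<dots> = 2 * sqrt s" using elim by (simp add: real_div_sqrt field_simps)
      finally show ?case .
    qed
  qed
  have cont: "continuous_on {0..exp A} ?H"
    unfolding continuous_on_eq_continuous_within
  proof
    fix x assume x: "x \<in> {0..exp A}"
    show "continuous (at x within {0..exp A}) ?H"
    proof (cases "x = 0")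
      case True
      have "(?H \<longlongrightarrow> 0 * (A + 1) - 0) (at_right 0)" by (intro tendsto_intros lim)
      then show ?thesis using True by (simp add: continuous_within at_within_Icc_at_right)
    next
      case False
      then show ?thesis using x by (intro continuous_intros continuous_at_imp_continuous_at_within) auto
    qed
  qed
  have "((\<lambda>s. A - ln s) has_integral (?H (exp A) - ?H 0)) {0..exp A}"
    using cont by (rule fundamental_theorem_of_calculus_interior[rotated])
       (auto intro!: derivative_eq_intros simp: has_real_derivative_iff_has_vector_derivative[symmetric] divide_simps)
  then have I: "((\<lambda>s. A - ln s) has_integral exp A) {0..exp A}" by (simp add: algebra_simps)
  have "(\<integral>\<^sup>+s. ennreal ((A - ln s) * indicator {0..exp A} s) \<partial>lborel) = (\<integral>\<^sup>+s. ennreal (A - ln s) * indicator {0..exp A} s \<partial>lborel)"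
    by (intro nn_integral_cong) (auto simp: indicator_def)
  also have "\<dots> = ennreal (exp A)"
    by (rule nn_integral_has_integral_lebesgue'[OF _ I]) (simp add: log_gap_nonneg[OF assms, simplified])
  finally show ?thesis .
qed

text \<open>The tangent bound of \<open>power_diff_le_tangent\<close> at t = ln s, cut off where it
  would become negative, plus the correction for t < 0.\<close>

definition log_majorant :: "nat \<Rightarrow> real \<Rightarrow> real \<Rightarrow> real" where
  "log_majorant m A s =
     real m * A ^ (m - 1) * ((A - ln s) * indicator {0..exp A} s) + \<bar>ln s\<bar> ^ m * indicator {0..<1} s"

lemma log_majorant_nonneg:
  assumes "A \<ge> 0"
  shows "log_majorant m A s \<ge> 0"
  using assms log_gap_nonneg[OF assms, of s] unfolding log_majorant_def by (auto simp: indicator_def)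

text \<open>Where the left side is not positive, nonnegativity of the majorant suffices. Elsewhere
  ln s < A, so s lies in the range of the first indicator and the tangent bound applies.\<close>

lemma diff_le_log_majorant:
  assumes "A \<ge> 0" "m \<ge> 1" "s \<ge> 0"
  shows "A ^ m - ln s ^ m \<le> log_majorant m A s"
proof (cases "ln s ^ m < A ^ m")
  case False
  then show ?thesis using log_majorant_nonneg[OF assms(1), of m s] by simp
next
  case True
  from power_diff_le_tangent[OF assms(1,2) True]
  have *: "A ^ m - ln s ^ m \<le> real m * A ^ (m - 1) * (A - ln s) + (if ln s < 0 then \<bar>ln s\<bar> ^ m else 0)" "ln s < A"
    by auto
  have "s \<le> exp A"
  proof (cases "s = 0")
    case False
    then have "s = exp (ln s)" using assms by simp
    also have "\<dots> \<le> exp A" using *(2) by simp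
    finally show ?thesis .
  qed simp
  moreover have "ln s < 0 \<Longrightarrow> s < 1" using assms by (cases "s = 0") auto
  then have "(if ln s < 0 then \<bar>ln s\<bar> ^ m else 0) \<le> \<bar>ln s\<bar> ^ m * indicator {0..<1} s"
    using assms by (auto simp: indicator_def)
  ultimately show ?thesis using *(1) assms unfolding log_majorant_def
    by (auto simp: indicator_def)
qed

lemma nn_integral_log_majorant:
  assumes "A \<ge> 0" "m \<ge> 1" "N \<ge> 1"
  shows "(\<integral>\<^sup>+x. ennreal (log_majorant m A (RN_norm N x ^ N)) \<partial>RN_leb N) \<le>
    ennreal (unit_ball_vol (real N) * (real m * (A ^ (m - 1) * exp A) + 2 * (2 * real m) ^ m))"
proof -
  have [measurable]: "log_majorant m A \<in> borel_measurable borel"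
    unfolding log_majorant_def by measurable
  have nn: "0 \<le> (A - ln s) * indicator {0..exp A} s" for s
    using log_gap_nonneg[OF assms(1), of s] by (auto simp: indicator_def)
  have "(\<integral>\<^sup>+x. ennreal (log_majorant m A (RN_norm N x ^ N)) \<partial>RN_leb N) =
    ennreal (unit_ball_vol (real N)) * (\<integral>\<^sup>+s. ennreal (log_majorant m A s) * indicator {0..} s \<partial>lborel)"
    using nn_integral_RN_norm_power[OF assms(3), of "\<lambda>s. ennreal (log_majorant m A s)"] by simp
  also have "\<dots> \<le> ennreal (unit_ball_vol (real N)) * (\<integral>\<^sup>+s. ennreal (log_majorant m A s) \<partial>lborel)"
    by (intro mult_left_mono nn_integral_mono) (auto simp: indicator_def)
  also have "(\<integral>\<^sup>+s. ennreal (log_majorant m A s) \<partial>lborel) =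
     (\<integral>\<^sup>+s. ennreal (real m * A ^ (m - 1)) * ennreal ((A - ln s) * indicator {0..exp A} s) + ennreal (\<bar>ln s\<bar> ^ m * indicator {0..<1} s) \<partial>lborel)"
    unfolding log_majorant_def using nn assms
    by (intro nn_integral_cong) (simp add: ennreal_mult ennreal_plus)
  also have "\<dots> = ennreal (real m * A ^ (m - 1)) * ennreal (exp A) + (\<integral>\<^sup>+s. ennreal (\<bar>ln s\<bar> ^ m * indicator {0..<1} s) \<partial>lborel)"
    using nn_integral_log_gap[OF assms(1)] by (subst nn_integral_add) (auto simp: nn_integral_cmult)
  also have "\<dots> \<le> ennreal (real m * A ^ (m - 1)) * ennreal (exp A) + ennreal (2 * (2 * real m) ^ m)"
    by (intro add_left_mono nn_integral_ln_power assms)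
  also have "\<dots> = ennreal (real m * (A ^ (m - 1) * exp A) + 2 * (2 * real m) ^ m)"
    using assms by (simp add: ennreal_mult[symmetric] ennreal_plus[symmetric] mult.assoc del: ennreal_plus)
  finally show ?thesis using unit_ball_vol_pos[of "real N"] assms
    by (simp add: ennreal_mult mult_left_mono)
qed

text \<open>Integrability of the symbol at the origin, a region in which the weight of
  \<open>Hm_norm_sq\<close> gives no control of it. Passing from the norm to its N-th power only
  enlarges the logarithm and reduces the claim to one variable.\<close>

lemma nn_integral_ln_norm_power_finite:
  assumes "N \<ge> 1" "m \<ge> 1"
  shows "(\<integral>\<^sup>+x. ennreal (\<bar>ln (RN_norm N x)\<bar> ^ m * indicator {..<1} (RN_norm N x)) \<partial>RN_leb N) < \<infinity>"
proof -
  have "(\<integral>\<^sup>+x. ennreal (\<bar>ln (RN_norm N x)\<bar> ^ m * indicator {..<1} (RN_norm N x)) \<partial>RN_leb N) \<le>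
    (\<integral>\<^sup>+x. ennreal (\<bar>ln (RN_norm N x ^ N)\<bar> ^ m * indicator {0..<1} (RN_norm N x ^ N)) \<partial>RN_leb N)"
  proof (intro nn_integral_mono ennreal_leI)
    fix x :: "nat \<Rightarrow> real"
    have ln: "ln (RN_norm N x ^ N) = real N * ln (RN_norm N x)"
      using assms RN_norm_nonneg[of N x] by (cases "RN_norm N x = 0") (auto simp: ln_realpow less_le)
    have "\<bar>ln (RN_norm N x)\<bar> \<le> \<bar>ln (RN_norm N x ^ N)\<bar>"
      unfolding ln abs_mult using assms mult_right_mono[of 1 "real N" "\<bar>ln (RN_norm N x)\<bar>"] by simp
    then have "\<bar>ln (RN_norm N x)\<bar> ^ m \<le> \<bar>ln (RN_norm N x ^ N)\<bar> ^ m" by (rule power_mono) simp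
    then show "\<bar>ln (RN_norm N x)\<bar> ^ m * indicator {..<1} (RN_norm N x) \<le>
      \<bar>ln (RN_norm N x ^ N)\<bar> ^ m * indicator {0..<1} (RN_norm N x ^ N)"
      using assms power_strict_mono[of "RN_norm N x" 1 N] by (auto simp: indicator_def)
  qed
  also have "\<dots> = ennreal (unit_ball_vol (real N)) * (\<integral>\<^sup>+s. ennreal (\<bar>ln s\<bar> ^ m * indicator {0..<1} s) * indicator {0..} s \<partial>lborel)"
    by (subst nn_integral_RN_norm_power[OF assms(1), of "\<lambda>s. ennreal (\<bar>ln s\<bar> ^ m * indicator {0..<1} s)", symmetric]) auto
  also have "\<dots> \<le> ennreal (unit_ball_vol (real N)) * (\<integral>\<^sup>+s. ennreal (\<bar>ln s\<bar> ^ m * indicator {0..<1} s) \<partial>lborel)"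
    by (intro mult_left_mono nn_integral_mono) (auto simp: indicator_def)
  also have "\<dots> \<le> ennreal (unit_ball_vol (real N)) * ennreal (2 * (2 * real m) ^ m)"
    by (intro mult_left_mono nn_integral_ln_power assms) auto
  also have "\<dots> < \<infinity>" by (simp add: ennreal_mult_less_top)
  finally show ?thesis .
qed

section \<open>Gaussian regularisation of the Fourier transform\<close>

lemma fourier_measurable [measurable]:
  assumes [measurable]: "u \<in> borel_measurable (RN_leb N)"
  shows "fourier N u \<in> borel_measurable (RN_leb N)"
  unfolding fourier_def by measurable

lemma borel_measurable_cnj [measurable (raw)]:
  assumes "f \<in> borel_measurable M" shows "(\<lambda>x. cnj (f x)) \<in> borel_measurable M"
  by (rule borel_measurable_continuous_on[OF _ assms]) (intro continuous_intros)

lemma norm_exp_i_real [simp]: "cmod (exp (- (\<i> * complex_of_real r))) = 1"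
  by (metis mult_minus_right norm_exp_i_times of_real_minus)

lemma integrable_fourier_kernel:
  assumes "integrable (RN_leb N) u" "\<xi> \<in> space (RN_leb N)"
  shows "integrable (RN_leb N) (\<lambda>x. exp (- (\<i> * of_real (RN_dot N \<xi> x))) * of_real (u x))"
  using assms by (intro Bochner_Integration.integrable_bound[OF assms(1)]) (auto simp: norm_mult)

lemma cmod_fourier_le: "cmod (fourier N u \<xi>) \<le> (LINT x|RN_leb N. \<bar>u x\<bar>)"
  unfolding fourier_def by (rule order_trans[OF integral_norm_bound]) (simp add: norm_mult)

text \<open>Fubini: the kernel has modulus 1, so the double integral is dominated by |u(x)|
  |g(\<xi>)|.\<close>

lemma fourier_mult:
  assumes u: "integrable (RN_leb N) u" and g: "integrable (RN_leb N) g"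
  shows "(LINT \<xi>|RN_leb N. fourier N u \<xi> * g \<xi>) =
    (LINT x|RN_leb N. of_real (u x) * (LINT \<xi>|RN_leb N. exp (- (\<i> * of_real (RN_dot N \<xi> x))) * g \<xi>))"
proof -
  have [measurable]: "u \<in> borel_measurable (RN_leb N)" "g \<in> borel_measurable (RN_leb N)"
    using u g by auto
  let ?f = "\<lambda>x \<xi>. exp (- (\<i> * complex_of_real (RN_dot N \<xi> x))) * of_real (u x) * g \<xi>"
  have "integrable (RN_leb N \<Otimes>\<^sub>M RN_leb N) (case_prod ?f)"
  proof (rule RN2.Fubini_integrable)
    show "AE x in RN_leb N. integrable (RN_leb N) (\<lambda>y. case (x, y) of (x, \<xi>) \<Rightarrow> ?f x \<xi>)"
    proof (rule AE_I2)
      fix x assume "x \<in> space (RN_leb N)"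
      then show "integrable (RN_leb N) (\<lambda>y. case (x, y) of (x, \<xi>) \<Rightarrow> ?f x \<xi>)"
        by (intro Bochner_Integration.integrable_bound[OF integrable_mult_right[OF g, of "of_real (u x)"]])
           (auto simp: norm_mult)
    qed
    show "integrable (RN_leb N) (\<lambda>x. LINT y|RN_leb N. norm (case (x, y) of (x, \<xi>) \<Rightarrow> ?f x \<xi>))"
      using u by (simp add: norm_mult)
  qed measurable
  from RN2.Fubini_integral[OF this]
  have "(LINT \<xi>|RN_leb N. (LINT x|RN_leb N. ?f x \<xi>)) = (LINT x|RN_leb N. (LINT \<xi>|RN_leb N. ?f x \<xi>))" .
  moreover have "(LINT x|RN_leb N. ?f x \<xi>) = fourier N u \<xi> * g \<xi>" for \<xi>
    unfolding fourier_def by (rule integral_mult_left_zero)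
  moreover have "(LINT \<xi>|RN_leb N. ?f x \<xi>) = of_real (u x) * (LINT \<xi>|RN_leb N. exp (- (\<i> * of_real (RN_dot N \<xi> x))) * g \<xi>)" for x
    by (subst integral_mult_right_zero[symmetric]) (simp add: ac_simps)
  ultimately show ?thesis by (simp only:)
qed

lemma integrable_gauss_weight:
  fixes \<eta> :: real assumes "\<eta> > 0"
  shows "integrable lborel (\<lambda>s::real. exp (- (\<eta>\<^sup>2 * s\<^sup>2 / 2)))"
proof -
  have "integrable lborel (\<lambda>s. sqrt (2 * pi / \<eta>\<^sup>2) * normal_density 0 (1 / \<eta>) s)"
    by (intro integrable_mult_right integrable_normal_density) (use assms in auto)
  moreover have "(\<lambda>s. sqrt (2 * pi / \<eta>\<^sup>2) * normal_density 0 (1 / \<eta>) s) = (\<lambda>s. exp (- (\<eta>\<^sup>2 * s\<^sup>2 / 2)))"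
    using assms by (simp add: normal_density_def fun_eq_iff power_divide real_sqrt_divide real_sqrt_mult field_simps)
  ultimately show ?thesis by simp
qed

text \<open>The substitution s = x / \<eta> turns the integral into the characteristic function of
  the standard normal law at - v / \<eta>, which is again a Gaussian.\<close>

lemma fourier_gauss_1d:
  fixes \<eta> :: real assumes "\<eta> > 0"
  shows "(LINT s|lborel. exp (- (\<i> * complex_of_real (s * v))) * of_real (exp (- (\<eta>\<^sup>2 * s\<^sup>2 / 2)))) =
    of_real (2 * pi / \<eta> * std_normal_density (v / \<eta>))"
proof -
  have "(LINT s|lborel. exp (- (\<i> * complex_of_real (s * v))) * of_real (exp (- (\<eta>\<^sup>2 * s\<^sup>2 / 2)))) =
    \<bar>1 / \<eta>\<bar> *\<^sub>R (LINT x|lborel. exp (- (\<i> * complex_of_real ((0 + 1 / \<eta> * x) * v))) * of_real (exp (- (\<eta>\<^sup>2 * (0 + 1 / \<eta> * x)\<^sup>2 / 2))))"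
    using assms by (intro lborel_integral_real_affine) auto
  also have "(LINT x|lborel. exp (- (\<i> * complex_of_real ((0 + 1 / \<eta> * x) * v))) * of_real (exp (- (\<eta>\<^sup>2 * (0 + 1 / \<eta> * x)\<^sup>2 / 2)))) =
     (LINT x|lborel. of_real (sqrt (2 * pi)) * (std_normal_density x *\<^sub>R iexp ((- v / \<eta>) * x)))"
    using assms by (intro Bochner_Integration.integral_cong)
      (auto simp: std_normal_density_def power_divide scaleR_conv_of_real field_simps)
  also have "\<dots> = of_real (sqrt (2 * pi)) * (LINT x|lborel. std_normal_density x *\<^sub>R iexp ((- v / \<eta>) * x))"
    by (rule integral_mult_right_zero)
  also have "(LINT x|lborel. std_normal_density x *\<^sub>R iexp ((- v / \<eta>) * x)) = char std_normal_distribution (- v / \<eta>)"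
    unfolding char_def by (subst integral_density) (auto simp: normal_density_nonneg)
  also have "\<dots> = of_real (exp (- (v / \<eta>)\<^sup>2 / 2))"
    by (simp add: char_std_normal_distribution)
  also have "\<bar>1 / \<eta>\<bar> *\<^sub>R (of_real (sqrt (2 * pi)) * of_real (exp (- (v / \<eta>)\<^sup>2 / 2))) =
      complex_of_real (1 / \<eta> * (sqrt (2 * pi) * exp (- (v / \<eta>)\<^sup>2 / 2)))"
    using assms by (simp add: scaleR_conv_of_real)
  also have "1 / \<eta> * (sqrt (2 * pi) * exp (- (v / \<eta>)\<^sup>2 / 2)) = 2 * pi / \<eta> * std_normal_density (v / \<eta>)"
    using assms real_sqrt_mult_self[of "2 * pi"] by (simp add: std_normal_density_def field_simps)
  finally show ?thesis .
qed

definition gauss :: "nat \<Rightarrow> (nat \<Rightarrow> real) \<Rightarrow> real" where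
  "gauss N z = (\<Prod>i<N. std_normal_density (z i))"

text \<open>This is exp (- \<eta>^2 |\<xi>|^2 / 2), written as a product so that its integrals
  factor over the coordinates.\<close>

definition gauss_weight :: "nat \<Rightarrow> real \<Rightarrow> (nat \<Rightarrow> real) \<Rightarrow> real" where
  "gauss_weight N \<eta> \<xi> = (\<Prod>i<N. exp (- (\<eta>\<^sup>2 * (\<xi> i)\<^sup>2 / 2)))"

lemma gauss_nonneg [simp]: "gauss N z \<ge> 0"
  unfolding gauss_def by (intro prod_nonneg) auto

lemma gauss_measurable [measurable (raw)]:
  assumes f: "f \<in> measurable M (RN_leb N)"
  shows "(\<lambda>x. gauss N (f x)) \<in> borel_measurable M"
  unfolding gauss_def std_normal_density_def
  using measurable_compose[OF f measurable_RN_component] by measurable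

lemma gauss_weight_measurable [measurable]: "gauss_weight N \<eta> \<in> borel_measurable (RN_leb N)"
  unfolding gauss_weight_def by measurable

lemma gauss_weight_nonneg [simp]: "gauss_weight N \<eta> \<xi> \<ge> 0"
  unfolding gauss_weight_def by (intro prod_nonneg) auto

lemma gauss_weight_le_1: "gauss_weight N \<eta> \<xi> \<le> 1"
  unfolding gauss_weight_def by (intro prod_le_1) auto

lemma integrable_gauss: "integrable (RN_leb N) (gauss N)"
  unfolding gauss_def RN_leb_def by (intro leb.product_integrable_prod) auto

lemma integral_gauss: "(LINT z|RN_leb N. gauss N z) = 1"
  unfolding gauss_def RN_leb_def by (subst leb.product_integral_prod) auto

lemma nn_integral_gauss: "(\<integral>\<^sup>+z. ennreal (gauss N z) \<partial>RN_leb N) = 1"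
  using nn_integral_eq_integral[OF integrable_gauss[of N]] by (simp add: integral_gauss)

lemma integrable_gauss_weight_RN: "\<eta> > 0 \<Longrightarrow> integrable (RN_leb N) (gauss_weight N \<eta>)"
  unfolding gauss_weight_def RN_leb_def by (intro leb.product_integrable_prod integrable_gauss_weight) auto

lemma fourier_gauss:
  assumes "\<eta> > 0"
  shows "(LINT \<xi>|RN_leb N. exp (- (\<i> * complex_of_real (RN_dot N \<xi> v))) * of_real (gauss_weight N \<eta> \<xi>)) =
    of_real ((2 * pi / \<eta>) ^ N * gauss N (\<lambda>i. v i / \<eta>))"
proof -
  have "exp (- (\<i> * complex_of_real (RN_dot N \<xi> v))) * of_real (gauss_weight N \<eta> \<xi>) =
    (\<Prod>i<N. exp (- (\<i> * complex_of_real (\<xi> i * v i))) * of_real (exp (- (\<eta>\<^sup>2 * (\<xi> i)\<^sup>2 / 2))))" for \<xi>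
    unfolding prod.distrib gauss_weight_def RN_dot_def
    by (simp add: sum_distrib_left sum_negf[symmetric] exp_sum)
  moreover have "(LINT \<xi>|RN_leb N. (\<Prod>i<N. exp (- (\<i> * complex_of_real (\<xi> i * v i))) * of_real (exp (- (\<eta>\<^sup>2 * (\<xi> i)\<^sup>2 / 2))))) =
    (\<Prod>i<N. LINT s|lborel. exp (- (\<i> * complex_of_real (s * v i))) * of_real (exp (- (\<eta>\<^sup>2 * s\<^sup>2 / 2))))"
    unfolding RN_leb_def
    by (subst leb.product_integral_prod[symmetric])
       (auto intro!: Bochner_Integration.integrable_bound[OF integrable_gauss_weight[OF assms]] simp: norm_mult)
  moreover have "\<dots> = of_real ((2 * pi / \<eta>) ^ N * gauss N (\<lambda>i. v i / \<eta>))"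
    unfolding fourier_gauss_1d[OF assms] of_real_prod[symmetric] by (simp only: prod.distrib gauss_def) simp
  ultimately show ?thesis by simp
qed

lemma fourier_bounded_gauss_integrable:
  assumes u: "integrable (RN_leb N) u" and "\<eta> > 0"
  shows "integrable (RN_leb N) (\<lambda>\<xi>. (cmod (fourier N u \<xi>))\<^sup>2 * gauss_weight N \<eta> \<xi>)"
proof (rule Bochner_Integration.integrable_bound)
  show "integrable (RN_leb N) (\<lambda>\<xi>. (LINT x|RN_leb N. \<bar>u x\<bar>)\<^sup>2 * gauss_weight N \<eta> \<xi>)"
    by (intro integrable_mult_right integrable_gauss_weight_RN assms)
  show "AE \<xi> in RN_leb N. norm ((cmod (fourier N u \<xi>))\<^sup>2 * gauss_weight N \<eta> \<xi>) \<le> norm ((LINT x|RN_leb N. \<bar>u x\<bar>)\<^sup>2 * gauss_weight N \<eta> \<xi>)"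
    by (intro AE_I2) (auto simp: abs_mult intro!: mult_right_mono power_mono cmod_fourier_le)
  have [measurable]: "u \<in> borel_measurable (RN_leb N)" using u by auto
  show "(\<lambda>\<xi>. (cmod (fourier N u \<xi>))\<^sup>2 * gauss_weight N \<eta> \<xi>) \<in> borel_measurable (RN_leb N)" by measurable
qed

text \<open>\<open>fourier_mult\<close> is used twice. With g the conjugate transform times the
  weight it opens the first factor of |u^|^2; for each fixed x it then opens the second one, where
  the weight transforms into a Gaussian of width \<eta> centred at x. The substitution y = x +
  \<eta> z cancels the powers of \<eta>.\<close>

lemma gauss_energy:
  assumes u: "integrable (RN_leb N) u" and "\<eta> > 0"
  shows "(LINT \<xi>|RN_leb N. (cmod (fourier N u \<xi>))\<^sup>2 * gauss_weight N \<eta> \<xi>) =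
    (2 * pi) ^ N * (LINT x|RN_leb N. u x * (LINT z|RN_leb N. u (\<lambda>i\<in>{..<N}. x i + \<eta> * z i) * gauss N z))"
proof -
  have [measurable]: "u \<in> borel_measurable (RN_leb N)" using u by auto
  let ?w = "\<lambda>\<xi>. complex_of_real (gauss_weight N \<eta> \<xi>)"
  have w: "integrable (RN_leb N) ?w" using integrable_gauss_weight_RN[OF assms(2)] by simp
  have bd: "integrable (RN_leb N) g" if [measurable]: "g \<in> borel_measurable (RN_leb N)" and "\<And>\<xi>. cmod (g \<xi>) \<le> C * gauss_weight N \<eta> \<xi>" for g :: "_ \<Rightarrow> complex" and C :: real
    by (rule Bochner_Integration.integrable_bound[OF integrable_mult_right[OF integrable_gauss_weight_RN[OF assms(2)], where c = C]])
       (use that in \<open>auto intro!: order_trans[OF that(2)]\<close>)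
  have inner: "(LINT \<xi>|RN_leb N. exp (- (\<i> * of_real (RN_dot N \<xi> x))) * (cnj (fourier N u \<xi>) * ?w \<xi>)) =
     of_real ((2 * pi) ^ N * (LINT z|RN_leb N. u (\<lambda>i\<in>{..<N}. x i + \<eta> * z i) * gauss N z))" (is "?L = _")
    if x [simp]: "x \<in> space (RN_leb N)" for x
  proof -
    \<comment> \<open>Conjugation replaces the conjugate transform by the transform itself, so that
      \<open>fourier_mult\<close> applies with the modulated weight in the role of g.\<close>
    have "cnj ?L = (LINT \<xi>|RN_leb N. fourier N u \<xi> * (exp (\<i> * of_real (RN_dot N \<xi> x)) * ?w \<xi>))"
      unfolding Bochner_Integration.integral_cnj[symmetric] by (intro Bochner_Integration.integral_cong) (auto simp: exp_cnj ac_simps)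
    also have "\<dots> = (LINT y|RN_leb N. of_real (u y) * (LINT \<xi>|RN_leb N. exp (- (\<i> * of_real (RN_dot N \<xi> y))) * (exp (\<i> * of_real (RN_dot N \<xi> x)) * ?w \<xi>)))"
      by (intro fourier_mult u bd[where C = 1]) (auto simp: norm_mult)
    also have "\<dots> = (LINT y|RN_leb N. of_real (u y * ((2 * pi / \<eta>) ^ N * gauss N (\<lambda>i\<in>{..<N}. (y i - x i) / \<eta>))))"
    proof (intro Bochner_Integration.integral_cong refl)
      fix y
      have e: "exp (- (\<i> * of_real (RN_dot N \<xi> y))) * (exp (\<i> * of_real (RN_dot N \<xi> x)) * ?w \<xi>) =
        exp (- (\<i> * complex_of_real (RN_dot N \<xi> (\<lambda>i. y i - x i)))) * ?w \<xi>" for \<xi>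
        unfolding mult.assoc[symmetric] exp_add[symmetric]
        by (simp add: RN_dot_def right_diff_distrib sum_subtractf)
      have "(LINT \<xi>|RN_leb N. exp (- (\<i> * of_real (RN_dot N \<xi> y))) * (exp (\<i> * of_real (RN_dot N \<xi> x)) * ?w \<xi>)) =
         of_real ((2 * pi / \<eta>) ^ N * gauss N (\<lambda>i. (y i - x i) / \<eta>))"
        unfolding e by (rule fourier_gauss[OF assms(2)])
      moreover have "gauss N (\<lambda>i. (y i - x i) / \<eta>) = gauss N (\<lambda>i\<in>{..<N}. (y i - x i) / \<eta>)"
        unfolding gauss_def by (intro prod.cong) auto
      ultimately show "of_real (u y) * (LINT \<xi>|RN_leb N. exp (- (\<i> * of_real (RN_dot N \<xi> y))) * (exp (\<i> * of_real (RN_dot N \<xi> x)) * ?w \<xi>))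
         = of_real (u y * ((2 * pi / \<eta>) ^ N * gauss N (\<lambda>i\<in>{..<N}. (y i - x i) / \<eta>)))" by simp
    qed
    also have "\<dots> = of_real (LINT y|RN_leb N. u y * ((2 * pi / \<eta>) ^ N * gauss N (\<lambda>i\<in>{..<N}. (y i - x i) / \<eta>)))"
      by (rule integral_complex_of_real)
    also have "(LINT y|RN_leb N. u y * ((2 * pi / \<eta>) ^ N * gauss N (\<lambda>i\<in>{..<N}. (y i - x i) / \<eta>))) =
      \<bar>\<eta>\<bar> ^ N *\<^sub>R (LINT z|RN_leb N. u (\<lambda>i\<in>{..<N}. x i + \<eta> * z i) * ((2 * pi / \<eta>) ^ N * gauss N (\<lambda>i\<in>{..<N}. ((\<lambda>i\<in>{..<N}. x i + \<eta> * z i) i - x i) / \<eta>)))"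
      using assms by (intro integral_RN_affine) auto
    also have "(LINT z|RN_leb N. u (\<lambda>i\<in>{..<N}. x i + \<eta> * z i) * ((2 * pi / \<eta>) ^ N * gauss N (\<lambda>i\<in>{..<N}. ((\<lambda>i\<in>{..<N}. x i + \<eta> * z i) i - x i) / \<eta>))) =
      (LINT z|RN_leb N. (2 * pi / \<eta>) ^ N * (u (\<lambda>i\<in>{..<N}. x i + \<eta> * z i) * gauss N z))"
    proof (intro Bochner_Integration.integral_cong refl)
      fix z
      have "gauss N (\<lambda>i\<in>{..<N}. ((\<lambda>i\<in>{..<N}. x i + \<eta> * z i) i - x i) / \<eta>) = gauss N z"
        unfolding gauss_def using assms by (intro prod.cong) auto
      then show "u (\<lambda>i\<in>{..<N}. x i + \<eta> * z i) * ((2 * pi / \<eta>) ^ N * gauss N (\<lambda>i\<in>{..<N}. ((\<lambda>i\<in>{..<N}. x i + \<eta> * z i) i - x i) / \<eta>)) =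
        (2 * pi / \<eta>) ^ N * (u (\<lambda>i\<in>{..<N}. x i + \<eta> * z i) * gauss N z)" by simp
    qed
    also have "\<bar>\<eta>\<bar> ^ N *\<^sub>R (LINT z|RN_leb N. (2 * pi / \<eta>) ^ N * (u (\<lambda>i\<in>{..<N}. x i + \<eta> * z i) * gauss N z)) =
      (2 * pi) ^ N * (LINT z|RN_leb N. u (\<lambda>i\<in>{..<N}. x i + \<eta> * z i) * gauss N z)"
      using assms by (simp add: power_divide)
    finally have "cnj ?L = of_real ((2 * pi) ^ N * (LINT z|RN_leb N. u (\<lambda>i\<in>{..<N}. x i + \<eta> * z i) * gauss N z))" .
    from arg_cong[OF this, of cnj] show ?thesis
      by (simp only: complex_cnj_cnj complex_cnj_complex_of_real)
  qed
  have "complex_of_real (LINT \<xi>|RN_leb N. (cmod (fourier N u \<xi>))\<^sup>2 * gauss_weight N \<eta> \<xi>) =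
    (LINT \<xi>|RN_leb N. of_real ((cmod (fourier N u \<xi>))\<^sup>2 * gauss_weight N \<eta> \<xi>))"
    by (rule integral_complex_of_real[symmetric])
  also have "\<dots> = (LINT \<xi>|RN_leb N. fourier N u \<xi> * (cnj (fourier N u \<xi>) * ?w \<xi>))"
    by (intro Bochner_Integration.integral_cong) (simp_all only: of_real_mult complex_norm_square mult.assoc)
  also have "\<dots> = (LINT x|RN_leb N. of_real (u x) * (LINT \<xi>|RN_leb N. exp (- (\<i> * of_real (RN_dot N \<xi> x))) * (cnj (fourier N u \<xi>) * ?w \<xi>)))"
    by (intro fourier_mult u bd[where C = "LINT x|RN_leb N. \<bar>u x\<bar>"])
       (auto simp: norm_mult intro!: mult_right_mono cmod_fourier_le)
  also have "\<dots> = (LINT x|RN_leb N. of_real ((2 * pi) ^ N * (u x * (LINT z|RN_leb N. u (\<lambda>i\<in>{..<N}. x i + \<eta> * z i) * gauss N z))))"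
    by (intro Bochner_Integration.integral_cong refl, subst inner) (auto simp: ac_simps)
  also have "\<dots> = of_real (LINT x|RN_leb N. (2 * pi) ^ N * (u x * (LINT z|RN_leb N. u (\<lambda>i\<in>{..<N}. x i + \<eta> * z i) * gauss N z)))"
    by (rule integral_complex_of_real)
  also have "(LINT x|RN_leb N. (2 * pi) ^ N * (u x * (LINT z|RN_leb N. u (\<lambda>i\<in>{..<N}. x i + \<eta> * z i) * gauss N z)))
     = (2 * pi) ^ N * (LINT x|RN_leb N. (u x * (LINT z|RN_leb N. u (\<lambda>i\<in>{..<N}. x i + \<eta> * z i) * gauss N z)))"
    by (rule integral_mult_right_zero)
  finally show ?thesis by (simp only: of_real_eq_iff)
qed

section \<open>Continuity of translations in \<open>L\<^sup>2\<close>\<close>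

text \<open>The coordinates are already measurable for the sigma-algebra generated by the open sets,
  so the product sigma-algebra lies in it. The open sets thereby become an intersection-stable
  generator for the induction in \<open>trans_cont_indicator\<close>.\<close>

lemma sets_RN_sigma_open:
  assumes "A \<in> sets (RN_leb N)"
  shows "A \<in> sigma_sets (space (RN_leb N)) {U. openin (RN_top N) U}"
proof -
  let ?S = "sigma (space (RN_leb N)) {U. openin (RN_top N) U}"
  have sub: "{U. openin (RN_top N) U} \<subseteq> Pow (space (RN_leb N))"
    using openin_subset by (fastforce simp: space_RN topspace_RN)
  have sp: "space ?S = space (RN_leb N)" by (simp add: space_measure_of_conv)
  have c: "(\<lambda>x. x i) \<in> borel_measurable ?S" if "i < N" for i
  proof (rule borel_measurableI)
    fix S :: "real set" assume "open S"
    have "continuous_map (RN_top N) euclideanreal (\<lambda>x. x i)"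
      unfolding RN_top_def using that by (intro continuous_map_product_projection) auto
    then have "openin (RN_top N) {x \<in> topspace (RN_top N). x i \<in> S}"
      using \<open>open S\<close> by (intro openin_continuous_map_preimage) auto
    moreover have "(\<lambda>x. x i) -` S \<inter> space ?S = {x \<in> topspace (RN_top N). x i \<in> S}"
      unfolding sp by (auto simp: space_RN topspace_RN)
    ultimately show "(\<lambda>x. x i) -` S \<inter> space ?S \<in> sets ?S"
      using sub by (simp add: sets_measure_of)
  qed
  have "(\<lambda>x. x) \<in> measurable ?S (Pi\<^sub>M {..<N} (\<lambda>_. borel))"
    by (rule measurable_PiM_single') (use c in \<open>auto simp: space_RN space_measure_of_conv\<close>)
  moreover have "A \<in> sets (Pi\<^sub>M {..<N} (\<lambda>_. borel))" using assms by (simp add: sets_RN)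
  ultimately have "(\<lambda>x. x) -` A \<inter> space ?S \<in> sets ?S" by (rule measurable_sets)
  moreover have "(\<lambda>x. x) -` A \<inter> space ?S = A" using sets.sets_into_space[OF assms] unfolding sp by auto
  ultimately show ?thesis using sub by (simp add: sets_measure_of)
qed

definition shift :: "nat \<Rightarrow> (nat \<Rightarrow> real) \<Rightarrow> (nat \<Rightarrow> real) \<Rightarrow> (nat \<Rightarrow> real)" where
  "shift N h x = (\<lambda>i\<in>{..<N}. x i + h i)"

lemma shift_measurable [measurable]: "shift N h \<in> measurable (RN_leb N) (RN_leb N)"
  unfolding shift_def by measurable

lemma shift_space [simp]: "shift N h x \<in> space (RN_leb N)"
  by (auto simp: shift_def space_RN)

lemma shift_shift:
  assumes "x \<in> space (RN_leb N)"
  shows "shift N h (shift N (\<lambda>i. - h i) x) = x" "shift N (\<lambda>i. - h i) (shift N h x) = x"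
proof -
  have "x i = undefined" if "\<not> i < N" for i
    using assms that by (simp add: space_RN PiE_def extensional_def)
  then show "shift N h (shift N (\<lambda>i. - h i) x) = x" "shift N (\<lambda>i. - h i) (shift N h x) = x"
    by (auto simp: shift_def restrict_def)
qed

lemma nn_integral_shift:
  assumes "f \<in> borel_measurable (RN_leb N)"
  shows "(\<integral>\<^sup>+x. f (shift N h x) \<partial>RN_leb N) = (\<integral>\<^sup>+x. f x \<partial>RN_leb N)"
  unfolding shift_def by (rule nn_integral_RN_translate[OF assms])

definition trans_diff :: "nat \<Rightarrow> ((nat \<Rightarrow> real) \<Rightarrow> real) \<Rightarrow> (nat \<Rightarrow> real) \<Rightarrow> ennreal" where
  "trans_diff N u h = (\<integral>\<^sup>+x. ennreal ((u (shift N h x) - u x)\<^sup>2) \<partial>RN_leb N)"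

text \<open>Continuity at 0 of translation in the L^2 norm, stated by sequences because it is used
  in dominated convergence. Only the first N coordinates of the shifts are required to
  converge.\<close>

definition trans_cont :: "nat \<Rightarrow> ((nat \<Rightarrow> real) \<Rightarrow> real) \<Rightarrow> bool" where
  "trans_cont N u \<longleftrightarrow> u \<in> borel_measurable (RN_leb N) \<and>
     (\<forall>h. (\<forall>i<N. (\<lambda>n::nat. h n i) \<longlonglongrightarrow> 0) \<longrightarrow> (\<lambda>n. trans_diff N u (h n)) \<longlonglongrightarrow> 0)"

lemma trans_diff_add:
  assumes [measurable]: "u \<in> borel_measurable (RN_leb N)" "v \<in> borel_measurable (RN_leb N)"
  shows "trans_diff N (\<lambda>x. u x + v x) h \<le> 2 * trans_diff N u h + 2 * trans_diff N v h"
proof -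
  have *: "ennreal ((a + b)\<^sup>2) \<le> 2 * ennreal (a\<^sup>2) + 2 * ennreal (b\<^sup>2)" for a b :: real
  proof -
    have "(a + b)\<^sup>2 \<le> 2 * a\<^sup>2 + 2 * b\<^sup>2" using sum_squares_bound[of a b] by (simp add: power2_sum)
    then have "ennreal ((a + b)\<^sup>2) \<le> ennreal (2 * a\<^sup>2 + 2 * b\<^sup>2)" by (rule ennreal_leI)
    also have "\<dots> = 2 * ennreal (a\<^sup>2) + 2 * ennreal (b\<^sup>2)" by (simp add: ennreal_mult ennreal_plus)
    finally show ?thesis .
  qed
  have "trans_diff N (\<lambda>x. u x + v x) h \<le> (\<integral>\<^sup>+x. 2 * ennreal ((u (shift N h x) - u x)\<^sup>2) + 2 * ennreal ((v (shift N h x) - v x)\<^sup>2) \<partial>RN_leb N)"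
    unfolding trans_diff_def
  proof (rule nn_integral_mono)
    fix x
    show "ennreal ((u (shift N h x) + v (shift N h x) - (u x + v x))\<^sup>2) \<le> 2 * ennreal ((u (shift N h x) - u x)\<^sup>2) + 2 * ennreal ((v (shift N h x) - v x)\<^sup>2)"
      using *[of "u (shift N h x) - u x" "v (shift N h x) - v x"] by (simp add: algebra_simps)
  qed
  also have "\<dots> = 2 * trans_diff N u h + 2 * trans_diff N v h"
    unfolding trans_diff_def by (simp add: nn_integral_add nn_integral_cmult)
  finally show ?thesis .
qed

lemma trans_diff_cmult:
  assumes [measurable]: "u \<in> borel_measurable (RN_leb N)"
  shows "trans_diff N (\<lambda>x. c * u x) h = ennreal (c\<^sup>2) * trans_diff N u h"
proof -
  have "ennreal ((c * a - c * b)\<^sup>2) = ennreal (c\<^sup>2) * ennreal ((a - b)\<^sup>2)" for a b :: real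
    by (simp add: ennreal_mult[symmetric] power_mult_distrib[symmetric] right_diff_distrib)
  then show ?thesis unfolding trans_diff_def by (simp add: nn_integral_cmult)
qed

text \<open>The bound is uniform in the shift, by translation invariance. It serves both as the
  error term in approximation and as the dominating function when the shift is averaged.\<close>

lemma trans_diff_bound:
  assumes [measurable]: "u \<in> borel_measurable (RN_leb N)"
  shows "trans_diff N u h \<le> 4 * (\<integral>\<^sup>+x. ennreal ((u x)\<^sup>2) \<partial>RN_leb N)"
proof -
  have *: "ennreal ((a - b)\<^sup>2) \<le> 2 * ennreal (a\<^sup>2) + 2 * ennreal (b\<^sup>2)" for a b :: real
  proof -
    have "0 \<le> (a + b)\<^sup>2" by simp
    then have "(a - b)\<^sup>2 \<le> 2 * a\<^sup>2 + 2 * b\<^sup>2" by (simp add: power2_sum power2_diff)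
    then have "ennreal ((a - b)\<^sup>2) \<le> ennreal (2 * a\<^sup>2 + 2 * b\<^sup>2)" by (rule ennreal_leI)
    also have "\<dots> = 2 * ennreal (a\<^sup>2) + 2 * ennreal (b\<^sup>2)" by (simp add: ennreal_mult ennreal_plus)
    finally show ?thesis .
  qed
  have "trans_diff N u h \<le> (\<integral>\<^sup>+x. 2 * ennreal ((u (shift N h x))\<^sup>2) + 2 * ennreal ((u x)\<^sup>2) \<partial>RN_leb N)"
    unfolding trans_diff_def by (intro nn_integral_mono *)
  also have "\<dots> = 2 * (\<integral>\<^sup>+x. ennreal ((u x)\<^sup>2) \<partial>RN_leb N) + 2 * (\<integral>\<^sup>+x. ennreal ((u x)\<^sup>2) \<partial>RN_leb N)"
    using nn_integral_shift[of "\<lambda>x. ennreal ((u x)\<^sup>2)" N h] by (simp add: nn_integral_add nn_integral_cmult)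
  also have "\<dots> = 4 * (\<integral>\<^sup>+x. ennreal ((u x)\<^sup>2) \<partial>RN_leb N)"
    by (simp add: distrib_right[symmetric])
  finally show ?thesis .
qed

lemma trans_cont_measurable: "trans_cont N u \<Longrightarrow> u \<in> borel_measurable (RN_leb N)"
  by (simp add: trans_cont_def)

lemma trans_cont_add:
  assumes u: "trans_cont N u" and v: "trans_cont N v"
  shows "trans_cont N (\<lambda>x. u x + v x)"
  unfolding trans_cont_def
proof (intro conjI allI impI)
  note [measurable] = trans_cont_measurable[OF u] trans_cont_measurable[OF v]
  show "(\<lambda>x. u x + v x) \<in> borel_measurable (RN_leb N)" by measurable
  fix h :: "nat \<Rightarrow> nat \<Rightarrow> real" assume h: "\<forall>i<N. (\<lambda>n::nat. h n i) \<longlonglongrightarrow> 0"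
  have "(\<lambda>n. 2 * trans_diff N u (h n) + 2 * trans_diff N v (h n)) \<longlonglongrightarrow> 2 * 0 + 2 * 0"
    using u v h unfolding trans_cont_def by (intro tendsto_add ennreal_tendsto_cmult) auto
  then have "(\<lambda>n. 2 * trans_diff N u (h n) + 2 * trans_diff N v (h n)) \<longlonglongrightarrow> 0" by simp
  then show "(\<lambda>n. trans_diff N (\<lambda>x. u x + v x) (h n)) \<longlonglongrightarrow> 0"
    by (rule tendsto_sandwich[OF _ _ tendsto_const, rotated 2])
       (auto intro!: always_eventually trans_diff_add)
qed

lemma trans_cont_cmult:
  assumes u: "trans_cont N u"
  shows "trans_cont N (\<lambda>x. c * u x)"
  unfolding trans_cont_def
proof (intro conjI allI impI)
  note [measurable] = trans_cont_measurable[OF u]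
  show "(\<lambda>x. c * u x) \<in> borel_measurable (RN_leb N)" by measurable
  fix h :: "nat \<Rightarrow> nat \<Rightarrow> real" assume h: "\<forall>i<N. (\<lambda>n::nat. h n i) \<longlonglongrightarrow> 0"
  have "(\<lambda>n. ennreal (c\<^sup>2) * trans_diff N u (h n)) \<longlonglongrightarrow> ennreal (c\<^sup>2) * 0"
    using u h unfolding trans_cont_def by (intro ennreal_tendsto_cmult) auto
  then show "(\<lambda>n. trans_diff N (\<lambda>x. c * u x) (h n)) \<longlonglongrightarrow> 0"
    by (simp add: trans_diff_cmult)
qed

lemma trans_cont_diff:
  assumes u: "trans_cont N u" and v: "trans_cont N v"
  shows "trans_cont N (\<lambda>x. u x - v x)"
  using trans_cont_add[OF u trans_cont_cmult[OF v, of "-1"]] by simp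

lemma trans_cont_cong:
  assumes "trans_cont N u" "\<And>x. x \<in> space (RN_leb N) \<Longrightarrow> u x = v x"
  shows "trans_cont N v"
proof -
  have "trans_diff N v h = trans_diff N u h" for h
    unfolding trans_diff_def using assms(2) by (intro nn_integral_cong) auto
  then show ?thesis using assms measurable_cong[of "RN_leb N" u v borel] unfolding trans_cont_def by simp
qed

text \<open>Write u as U_k plus a remainder. The remainder costs at most 8 times its squared norm
  for every shift, so the limit superior over the shifts is bounded by that quantity for each k, and
  then k tends to infinity.\<close>

lemma trans_cont_limit:
  assumes U: "\<And>k::nat. trans_cont N (U k)" and [measurable]: "u \<in> borel_measurable (RN_leb N)"
    and lim: "(\<lambda>k. \<integral>\<^sup>+x. ennreal ((U k x - u x)\<^sup>2) \<partial>RN_leb N) \<longlonglongrightarrow> 0"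
  shows "trans_cont N u"
  unfolding trans_cont_def
proof (intro conjI allI impI)
  note [measurable] = trans_cont_measurable[OF U]
  show "u \<in> borel_measurable (RN_leb N)" by measurable
  fix h :: "nat \<Rightarrow> nat \<Rightarrow> real" assume h: "\<forall>i<N. (\<lambda>n::nat. h n i) \<longlonglongrightarrow> 0"
  define I where "I k = (\<integral>\<^sup>+x. ennreal ((U k x - u x)\<^sup>2) \<partial>RN_leb N)" for k
  have le: "limsup (\<lambda>n. trans_diff N u (h n)) \<le> 2 * (4 * I k)" for k
  proof -
    have b: "trans_diff N u (h n) \<le> 2 * trans_diff N (U k) (h n) + 2 * (4 * I k)" for n
    proof -
      have "trans_diff N (\<lambda>x. U k x + (u x - U k x)) (h n) \<le> 2 * trans_diff N (U k) (h n) + 2 * trans_diff N (\<lambda>x. u x - U k x) (h n)"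
        by (rule trans_diff_add) measurable
      also have "trans_diff N (\<lambda>x. u x - U k x) (h n) \<le> 4 * (\<integral>\<^sup>+x. ennreal ((u x - U k x)\<^sup>2) \<partial>RN_leb N)"
        by (rule trans_diff_bound) measurable
      finally show ?thesis by (simp add: I_def power2_commute mult_left_mono add_left_mono)
    qed
    have "(\<lambda>n. 2 * trans_diff N (U k) (h n) + 2 * (4 * I k)) \<longlonglongrightarrow> 2 * 0 + 2 * (4 * I k)"
      using U[of k] h unfolding trans_cont_def by (intro tendsto_add ennreal_tendsto_cmult tendsto_const) auto
    then have "limsup (\<lambda>n. 2 * trans_diff N (U k) (h n) + 2 * (4 * I k)) = 2 * (4 * I k)"
      by (intro lim_imp_Limsup) auto
    moreover have "limsup (\<lambda>n. trans_diff N u (h n)) \<le> limsup (\<lambda>n. 2 * trans_diff N (U k) (h n) + 2 * (4 * I k))"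
      by (intro Limsup_mono always_eventually allI b)
    ultimately show ?thesis by simp
  qed
  have "(\<lambda>k. 2 * (4 * I k)) \<longlonglongrightarrow> 2 * (4 * 0)"
    using lim unfolding I_def by (intro ennreal_tendsto_cmult) auto
  then have "limsup (\<lambda>n. trans_diff N u (h n)) \<le> 0"
    using le by (intro LIMSEQ_le_const[of "\<lambda>k. 2 * (4 * I k)"]) auto
  then have "limsup (\<lambda>n. trans_diff N u (h n)) = 0" by simp
  moreover from this have "liminf (\<lambda>n. trans_diff N u (h n)) = 0"
    using Liminf_le_Limsup[of sequentially "\<lambda>n. trans_diff N u (h n)"] by simp
  ultimately show "(\<lambda>n. trans_diff N u (h n)) \<longlonglongrightarrow> 0"
    by (intro tendsto_iff_Liminf_eq_Limsup[THEN iffD2]) auto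
qed

lemma eventually_shift_open:
  assumes U: "openin (RN_top N) U" and x: "x \<in> U" and h: "\<forall>i<N. (\<lambda>n::nat. h n i) \<longlonglongrightarrow> 0"
  shows "\<forall>\<^sub>F n in sequentially. shift N (h n) x \<in> U"
proof -
  have xs: "x \<in> topspace (RN_top N)" using openin_subset[OF U] x by auto
  have "limitin (RN_top N) (\<lambda>n. shift N (h n) x) x sequentially"
    unfolding RN_top_def limitin_componentwise
  proof (intro conjI ballI)
    show "x \<in> extensional {..<N}" using xs by (auto simp: topspace_RN PiE_def)
    show "\<forall>\<^sub>F n in sequentially. shift N (h n) x \<in> topspace (product_topology (\<lambda>i. euclideanreal) {..<N})"
      by (auto simp: shift_def)
    fix i assume i: "i \<in> {..<N}"
    have "(\<lambda>n. x i + h n i) \<longlonglongrightarrow> x i + 0" using h i by (intro tendsto_intros) auto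
    then show "limitin euclideanreal (\<lambda>n. shift N (h n) x i) (x i) sequentially"
      using i by (simp add: shift_def)
  qed
  then show ?thesis using U x by (auto simp: limitin_def)
qed

text \<open>The two indicators differ at points that leave U under the shift and at points that
  enter it. After a translation, the latter are points that leave U under the opposite shift. A
  point of an open set is not moved out by small shifts, so dominated convergence with the indicator
  of U applies.\<close>

lemma trans_cont_open:
  assumes U: "openin (RN_top N) U" and fin: "emeasure (RN_leb N) U < \<infinity>"
  shows "trans_cont N (indicator U)"
  unfolding trans_cont_def
proof (intro conjI allI impI)
  note [measurable] = openin_RN_sets[OF U]
  show m[measurable]: "indicator U \<in> borel_measurable (RN_leb N)" by measurable
  have lim: "(\<lambda>n. \<integral>\<^sup>+x. indicator U x * indicator (- U) (shift N (h n) x) \<partial>RN_leb N) \<longlonglongrightarrow> 0"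
    if h: "\<forall>i<N. (\<lambda>n::nat. h n i) \<longlonglongrightarrow> 0" for h
  proof -
    have meas: "(\<lambda>x. indicator U x * indicator (- U) (shift N g x) :: ennreal) \<in> borel_measurable (RN_leb N)" for g
    proof -
      have "(\<lambda>x. indicator U x * (1 - indicator U (shift N g x)) :: ennreal) \<in> borel_measurable (RN_leb N)"
        by measurable
      then show ?thesis by (rule measurable_cong[THEN iffD1, rotated]) (auto simp: indicator_def)
    qed
    have "(\<lambda>n. \<integral>\<^sup>+x. indicator U x * indicator (- U) (shift N (h n) x) \<partial>RN_leb N) \<longlonglongrightarrow> (\<integral>\<^sup>+x. 0 \<partial>RN_leb N)"
    proof (rule nn_integral_dominated_convergence[where w = "indicator U"])
      show "AE x in RN_leb N. (\<lambda>n. indicator U x * indicator (- U) (shift N (h n) x) :: ennreal) \<longlonglongrightarrow> 0"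
      proof (rule AE_I2)
        fix x
        show "(\<lambda>n. indicator U x * indicator (- U) (shift N (h n) x) :: ennreal) \<longlonglongrightarrow> 0"
        proof (cases "x \<in> U")
          case True
          have "\<forall>\<^sub>F n in sequentially. indicator U x * indicator (- U) (shift N (h n) x) = (0::ennreal)"
            using eventually_shift_open[OF U True h] by eventually_elim (simp add: indicator_def)
          then show ?thesis by (rule tendsto_eventually)
        qed simp
      qed
      show "(\<integral>\<^sup>+x. indicator U x \<partial>RN_leb N) < \<infinity>" using fin by simp
    qed (auto simp: indicator_def meas)
    then show ?thesis by simp
  qed
  fix h :: "nat \<Rightarrow> nat \<Rightarrow> real" assume h: "\<forall>i<N. (\<lambda>n::nat. h n i) \<longlonglongrightarrow> 0"
  have eq: "trans_diff N (indicator U) g = (\<integral>\<^sup>+x. indicator U x * indicator (- U) (shift N g x) \<partial>RN_leb N)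
      + (\<integral>\<^sup>+x. indicator U x * indicator (- U) (shift N (\<lambda>i. - g i) x) \<partial>RN_leb N)" for g
  proof -
    have c: "(1::ennreal) - indicator U y = indicator (- U) y" for y
      by (simp add: indicator_def)
    let ?f = "\<lambda>x. indicator U x * (1 - indicator U (shift N (\<lambda>i. - g i) x)) :: ennreal"
    have "trans_diff N (indicator U) g = (\<integral>\<^sup>+x. indicator U x * (1 - indicator U (shift N g x)) + ?f (shift N g x) \<partial>RN_leb N)"
      unfolding trans_diff_def by (intro nn_integral_cong) (auto simp: indicator_def shift_shift)
    also have "\<dots> = (\<integral>\<^sup>+x. indicator U x * (1 - indicator U (shift N g x)) \<partial>RN_leb N) + (\<integral>\<^sup>+x. ?f (shift N g x) \<partial>RN_leb N)"
      by (rule nn_integral_add) measurable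
    also have "(\<integral>\<^sup>+x. ?f (shift N g x) \<partial>RN_leb N) = (\<integral>\<^sup>+x. ?f x \<partial>RN_leb N)"
      by (rule nn_integral_shift) measurable
    finally show ?thesis unfolding c .
  qed
  have "(\<lambda>n. trans_diff N (indicator U) (h n)) \<longlonglongrightarrow> 0 + 0"
    unfolding eq using h by (intro tendsto_add lim) (auto intro: tendsto_minus_cancel)
  then show "(\<lambda>n. trans_diff N (indicator U) (h n)) \<longlonglongrightarrow> 0" by simp
qed

definition open_box :: "nat \<Rightarrow> real \<Rightarrow> (nat \<Rightarrow> real) set" where
  "open_box N R = {..<N} \<rightarrow>\<^sub>E {-R<..<R}"

lemma openin_open_box: "openin (RN_top N) (open_box N R)"
  unfolding RN_top_def open_box_def by (simp add: openin_PiE)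

lemma emeasure_open_box: "emeasure (RN_leb N) (open_box N R) < \<infinity>"
proof -
  have "emeasure lborel {-R<..<R} < \<infinity>" by (intro emeasure_bounded_finite) simp
  then obtain c where "emeasure lborel {-R<..<R} = ennreal c" "c \<ge> 0"
    by (cases "emeasure lborel {-R<..<R}") auto
  then show ?thesis
    unfolding RN_leb_def open_box_def by (subst leb.emeasure_PiM) (auto simp: ennreal_power)
qed

text \<open>Dynkin induction over the open sets. Intersecting with a fixed box keeps all measures
  finite: complements become differences of two admissible functions, and disjoint unions become L^2
  limits dominated by the indicator of the box.\<close>

lemma trans_cont_indicator:
  assumes "A \<in> sets (RN_leb N)"
  shows "trans_cont N (indicator (A \<inter> open_box N R))"
proof -
  let ?B = "open_box N R" and ?O = "{U. openin (RN_top N) U}"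
  have fin: "emeasure (RN_leb N) (A \<inter> ?B) < \<infinity>" if "A \<in> sets (RN_leb N)" for A
    using emeasure_mono[of "A \<inter> ?B" ?B "RN_leb N"] emeasure_open_box[of N R] openin_RN_sets[OF openin_open_box[of N R]]
    by (auto intro: le_less_trans)
  have sub: "?O \<subseteq> Pow (space (RN_leb N))"
    using openin_subset by (fastforce simp: space_RN topspace_RN)
  have sets: "sigma_sets (space (RN_leb N)) ?O = sets (RN_leb N)"
    using sets_RN_sigma_open sets.sigma_sets_subset[of ?O "RN_leb N"] openin_RN_sets by blast
  have "Int_stable ?O" by (auto simp: Int_stable_def)
  then show ?thesis
    using sub sets_RN_sigma_open[OF assms]
  proof (induction rule: sigma_sets_induct_disjoint)
    fix U assume "U \<in> ?O"
    then show "trans_cont N (indicator (U \<inter> ?B))"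
      using openin_open_box[of N R] fin[of U] openin_RN_sets[of N U] by (intro trans_cont_open) auto
  next
    show "trans_cont N (indicator ({} \<inter> ?B))" by (intro trans_cont_open) auto
  next
    fix A assume "trans_cont N (indicator (A \<inter> ?B))"
    from trans_cont_diff[OF trans_cont_open[OF openin_open_box emeasure_open_box] this]
    show "trans_cont N (indicator ((space (RN_leb N) - A) \<inter> ?B))"
      by (rule trans_cont_cong) (auto simp: indicator_def)
  next
    fix A :: "nat \<Rightarrow> (nat \<Rightarrow> real) set"
    assume disj: "disjoint_family A" and A: "range A \<subseteq> sigma_sets (space (RN_leb N)) ?O"
      and IH: "\<And>i. trans_cont N (indicator (A i \<inter> ?B))"
    have [measurable]: "A i \<in> sets (RN_leb N)" for i using A sets by auto
    have [measurable]: "?B \<in> sets (RN_leb N)" using openin_RN_sets[OF openin_open_box] .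
    define U :: "nat \<Rightarrow> (nat \<Rightarrow> real) \<Rightarrow> real" where "U k = (\<lambda>x. \<Sum>i<k. indicator (A i \<inter> ?B) x)" for k
    have Ut: "trans_cont N (U k)" for k
    proof (induction k)
      case 0
      show ?case by (rule trans_cont_cong[OF trans_cont_open[of N "{}"]]) (auto simp: U_def)
    next
      case (Suc k)
      then show ?case using trans_cont_add[OF Suc IH[of k]] by (simp add: U_def)
    qed
    have Ui: "U k x = indicator ((\<Union>i<k. A i) \<inter> ?B) x" for k x
    proof (induction k)
      case (Suc k)
      have un: "(\<Union>i<Suc k. A i) \<inter> ?B = ((\<Union>i<k. A i) \<inter> ?B) \<union> (A k \<inter> ?B)"
        by (auto simp: less_Suc_eq)
      have "((\<Union>i<k. A i) \<inter> ?B) \<inter> (A k \<inter> ?B) = {}"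
      proof -
        have "A i \<inter> A k = {}" if "i < k" for i
          using disjoint_family_onD[OF disj, of i k] that by simp
        then show ?thesis by blast
      qed
      then have "indicator ((\<Union>i<Suc k. A i) \<inter> ?B) x = (indicator ((\<Union>i<k. A i) \<inter> ?B) x + indicator (A k \<inter> ?B) x :: real)"
        unfolding un by (rule indicator_add[symmetric])
      moreover have "U (Suc k) x = U k x + indicator (A k \<inter> ?B) x" unfolding U_def by simp
      ultimately show ?case using Suc by linarith
    qed (simp add: U_def)
    show "trans_cont N (indicator ((\<Union>i. A i) \<inter> ?B))"
    proof (rule trans_cont_limit[OF Ut])
      note trans_cont_measurable[OF Ut, measurable]
      have "(\<lambda>k. \<integral>\<^sup>+x. ennreal ((U k x - indicator ((\<Union>i. A i) \<inter> ?B) x)\<^sup>2) \<partial>RN_leb N) \<longlonglongrightarrow> (\<integral>\<^sup>+x. 0 \<partial>RN_leb N)"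
      proof (rule nn_integral_dominated_convergence[where w = "indicator ?B"])
        show "AE x in RN_leb N. (\<lambda>k. ennreal ((U k x - indicator ((\<Union>i. A i) \<inter> ?B) x)\<^sup>2)) \<longlonglongrightarrow> 0"
        proof (rule AE_I2)
          fix x
          have "\<forall>\<^sub>F k in sequentially. ennreal ((U k x - indicator ((\<Union>i. A i) \<inter> ?B) x)\<^sup>2) = 0"
          proof (cases "\<exists>i. x \<in> A i")
            case True
            then obtain i where "x \<in> A i" by auto
            show ?thesis
            proof (rule eventually_mono[OF eventually_gt_at_top[of i]])
              fix k assume "i < k"
              then show "ennreal ((U k x - indicator ((\<Union>i. A i) \<inter> ?B) x)\<^sup>2) = 0"
                using \<open>x \<in> A i\<close> by (auto simp: Ui indicator_def)
            qed
          qed (auto simp: Ui indicator_def)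
          then show "(\<lambda>k. ennreal ((U k x - indicator ((\<Union>i. A i) \<inter> ?B) x)\<^sup>2)) \<longlonglongrightarrow> 0"
            by (rule tendsto_eventually)
        qed
        show "(\<integral>\<^sup>+x. indicator ?B x \<partial>RN_leb N) < \<infinity>" using emeasure_open_box[of N R] by simp
        show "AE x in RN_leb N. ennreal ((U k x - indicator ((\<Union>i. A i) \<inter> ?B) x)\<^sup>2) \<le> indicator ?B x" for k
          by (intro AE_I2) (auto simp: Ui indicator_def)
      qed measurable
      then show "(\<lambda>k. \<integral>\<^sup>+x. ennreal ((U k x - indicator ((\<Union>i. A i) \<inter> ?B) x)\<^sup>2) \<partial>RN_leb N) \<longlonglongrightarrow> 0" by simp
    qed measurable
  qed
qed

text \<open>Induction over nonnegative measurable functions. Finiteness of the norm is a premise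
  inside the induction, since it passes from a function to the smaller ones from which it is
  built.\<close>

lemma trans_cont_nonneg:
  assumes "u \<in> borel_measurable (RN_leb N)" "\<And>x. 0 \<le> u x"
    "(\<integral>\<^sup>+x. ennreal ((u x * indicator (open_box N R) x)\<^sup>2) \<partial>RN_leb N) < \<infinity>"
  shows "trans_cont N (\<lambda>x. u x * indicator (open_box N R) x)"
  using assms
proof (induction rule: borel_measurable_induct_real)
  case (set A)
  show ?case by (rule trans_cont_cong[OF trans_cont_indicator[OF set(1), of R]]) (simp add: indicator_inter_arith)
next
  case (mult u c)
  note [measurable] = mult.hyps(2) openin_RN_sets[OF openin_open_box]
  show ?case
  proof (cases "c = 0")
    case True
    then show ?thesis using trans_cont_open[of N "{}"] trans_cont_cong[of N "indicator {}" "\<lambda>x. 0"] by simp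
  next
    case False
    have "(\<integral>\<^sup>+x. ennreal ((c * u x * indicator (open_box N R) x)\<^sup>2) \<partial>RN_leb N) =
      ennreal (c\<^sup>2) * (\<integral>\<^sup>+x. ennreal ((u x * indicator (open_box N R) x)\<^sup>2) \<partial>RN_leb N)"
      by (subst nn_integral_cmult[symmetric]) (auto simp: ennreal_mult[symmetric] power_mult_distrib mult.assoc)
    then have "(\<integral>\<^sup>+x. ennreal ((u x * indicator (open_box N R) x)\<^sup>2) \<partial>RN_leb N) < \<infinity>"
      using mult.prems False by (auto simp: ennreal_mult_less_top)
    from trans_cont_cmult[OF mult.IH[OF this], of c] show ?thesis by (simp add: mult.assoc)
  qed
next
  case (add u v)
  have "(\<integral>\<^sup>+x. ennreal ((u x * indicator (open_box N R) x)\<^sup>2) \<partial>RN_leb N) \<le> (\<integral>\<^sup>+x. ennreal (((v x + u x) * indicator (open_box N R) x)\<^sup>2) \<partial>RN_leb N)"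
    using add.hyps by (intro nn_integral_mono ennreal_leI power_mono mult_right_mono) auto
  moreover have "(\<integral>\<^sup>+x. ennreal ((v x * indicator (open_box N R) x)\<^sup>2) \<partial>RN_leb N) \<le> (\<integral>\<^sup>+x. ennreal (((v x + u x) * indicator (open_box N R) x)\<^sup>2) \<partial>RN_leb N)"
    using add.hyps by (intro nn_integral_mono ennreal_leI power_mono mult_right_mono) auto
  ultimately have "trans_cont N (\<lambda>x. v x * indicator (open_box N R) x + u x * indicator (open_box N R) x)"
    using add.prems by (intro trans_cont_add add.IH) (auto intro: le_less_trans)
  then show ?case by (simp add: algebra_simps)
next
  case (seq U)
  note [measurable] = seq.hyps(1) assms(1) openin_RN_sets[OF openin_open_box]
  have le: "U i x \<le> u x" if "x \<in> space (RN_leb N)" for i x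
    using seq.hyps(3) seq.hyps(4)[OF that] by (intro incseq_le[of "\<lambda>i. U i x"]) (auto simp: incseq_def le_fun_def)
  have fin: "(\<integral>\<^sup>+x. ennreal ((U i x * indicator (open_box N R) x)\<^sup>2) \<partial>RN_leb N) < \<infinity>" for i
  proof -
    have "(\<integral>\<^sup>+x. ennreal ((U i x * indicator (open_box N R) x)\<^sup>2) \<partial>RN_leb N) \<le> (\<integral>\<^sup>+x. ennreal ((u x * indicator (open_box N R) x)\<^sup>2) \<partial>RN_leb N)"
      using seq.hyps(2) le by (intro nn_integral_mono ennreal_leI power_mono mult_right_mono) auto
    then show ?thesis using seq.prems by (auto intro: le_less_trans)
  qed
  show ?case
  proof (rule trans_cont_limit[of N "\<lambda>i x. U i x * indicator (open_box N R) x"])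
    show "trans_cont N (\<lambda>x. U k x * indicator (open_box N R) x)" for k by (rule seq.IH[OF fin])
    have "(\<lambda>k. \<integral>\<^sup>+x. ennreal ((U k x * indicator (open_box N R) x - u x * indicator (open_box N R) x)\<^sup>2) \<partial>RN_leb N) \<longlonglongrightarrow> (\<integral>\<^sup>+x. 0 \<partial>RN_leb N)"
    proof (rule nn_integral_dominated_convergence[where w = "\<lambda>x. ennreal ((u x * indicator (open_box N R) x)\<^sup>2)"])
      show "AE x in RN_leb N. (\<lambda>k. ennreal ((U k x * indicator (open_box N R) x - u x * indicator (open_box N R) x)\<^sup>2)) \<longlonglongrightarrow> 0"
      proof (rule AE_I2)
        fix x assume "x \<in> space (RN_leb N)"
        then have "(\<lambda>k. (U k x * indicator (open_box N R) x - u x * indicator (open_box N R) x)\<^sup>2) \<longlonglongrightarrow> (u x * indicator (open_box N R) x - u x * indicator (open_box N R) x)\<^sup>2"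
          by (intro tendsto_intros seq.hyps(4))
        then have "(\<lambda>k. (U k x * indicator (open_box N R) x - u x * indicator (open_box N R) x)\<^sup>2) \<longlonglongrightarrow> 0" by simp
        from tendsto_ennrealI[OF this] show "(\<lambda>k. ennreal ((U k x * indicator (open_box N R) x - u x * indicator (open_box N R) x)\<^sup>2)) \<longlonglongrightarrow> 0"
          by simp
      qed
      show "AE x in RN_leb N. ennreal ((U k x * indicator (open_box N R) x - u x * indicator (open_box N R) x)\<^sup>2) \<le> ennreal ((u x * indicator (open_box N R) x)\<^sup>2)" for k
      proof (intro AE_I2 ennreal_leI)
        fix x assume x: "x \<in> space (RN_leb N)"
        have "(U k x - u x)\<^sup>2 \<le> (u x)\<^sup>2"
          using le[OF x, of k] seq.hyps(2)[of k x] by (subst power2_commute) (intro power_mono, auto)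
        then show "(U k x * indicator (open_box N R) x - u x * indicator (open_box N R) x)\<^sup>2 \<le> (u x * indicator (open_box N R) x)\<^sup>2"
          by (auto simp: indicator_def)
      qed
    qed (use seq.prems in \<open>auto\<close>)
    then show "(\<lambda>k. \<integral>\<^sup>+x. ennreal ((U k x * indicator (open_box N R) x - u x * indicator (open_box N R) x)\<^sup>2) \<partial>RN_leb N) \<longlonglongrightarrow> 0" by simp
  qed measurable
qed

lemma trans_cont_L2:
  assumes [measurable]: "u \<in> borel_measurable (RN_leb N)"
    and sq: "integrable (RN_leb N) (\<lambda>x. (u x)\<^sup>2)"
    and supp: "\<And>x. x \<in> space (RN_leb N) \<Longrightarrow> x \<notin> open_box N R \<Longrightarrow> u x = 0"
  shows "trans_cont N u"
proof -
  note [measurable] = openin_RN_sets[OF openin_open_box]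
  have fin: "(\<integral>\<^sup>+x. ennreal ((max 0 (c * u x) * indicator (open_box N R) x)\<^sup>2) \<partial>RN_leb N) < \<infinity>" if "c\<^sup>2 = 1" for c
  proof -
    have "(\<integral>\<^sup>+x. ennreal ((max 0 (c * u x) * indicator (open_box N R) x)\<^sup>2) \<partial>RN_leb N) \<le> (\<integral>\<^sup>+x. ennreal ((u x)\<^sup>2) \<partial>RN_leb N)"
      using that by (intro nn_integral_mono ennreal_leI) (auto simp: indicator_def max_def power_mult_distrib)
    also have "\<dots> = ennreal (LINT x|RN_leb N. (u x)\<^sup>2)" by (intro nn_integral_eq_integral sq) auto
    finally show ?thesis by (auto intro: le_less_trans)
  qed
  have "trans_cont N (\<lambda>x. max 0 (1 * u x) * indicator (open_box N R) x - max 0 ((-1) * u x) * indicator (open_box N R) x)"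
    by (intro trans_cont_diff trans_cont_nonneg fin) auto
  then show ?thesis
    by (rule trans_cont_cong) (use supp in \<open>auto simp: indicator_def max_def\<close>)
qed

section \<open>Plancherel identity\<close>

lemma abs_mult_le_sum_squares: "\<bar>a * b\<bar> \<le> a\<^sup>2 + (b::real)\<^sup>2"
proof -
  have "2 * \<bar>a * b\<bar> \<le> a\<^sup>2 + b\<^sup>2"
    using sum_squares_bound[of "\<bar>a\<bar>" "\<bar>b\<bar>"] by (simp add: abs_mult mult.assoc)
  then show ?thesis using abs_ge_zero[of "a * b"] by linarith
qed

text \<open>Expand 2 u v = u^2 + v^2 - (v - u)^2 for v the shifted function. Under the Gaussian
  average both squares integrate to the squared norm of u, by translation invariance and because the
  Gaussian has mass 1.\<close>

lemma integral_gauss_convolution: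
  assumes [measurable]: "u \<in> borel_measurable (RN_leb N)"
    and sq: "integrable (RN_leb N) (\<lambda>x. (u x)\<^sup>2)"
  shows "2 * (LINT x|RN_leb N. u x * (LINT z|RN_leb N. u (\<lambda>i\<in>{..<N}. x i + \<eta> * z i) * gauss N z)) =
    2 * (LINT x|RN_leb N. (u x)\<^sup>2) - enn2real (\<integral>\<^sup>+z. ennreal (gauss N z) * trans_diff N u (\<lambda>i. \<eta> * z i) \<partial>RN_leb N)"
proof -
  let ?S = "LINT x|RN_leb N. (u x)\<^sup>2" and ?P = "RN_leb N \<Otimes>\<^sub>M RN_leb N"
  let ?v = "\<lambda>x z. u (\<lambda>i\<in>{..<N}. x i + \<eta> * z i)"
  have S: "(\<integral>\<^sup>+x. ennreal ((u x)\<^sup>2) \<partial>RN_leb N) = ennreal ?S"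
    by (intro nn_integral_eq_integral sq) auto
  have vm: "(\<lambda>(x, z). ?v x z) \<in> borel_measurable ?P"
    using measurable_compose[OF measurable_RN_restrict assms(1)]
    by (simp add: split_beta')
  then have [measurable]: "(\<lambda>p. ?v (fst p) (snd p)) \<in> borel_measurable ?P" by (simp add: split_beta')
  have shift: "?v x z = u (shift N (\<lambda>i. \<eta> * z i) x)" for x z by (simp add: shift_def)
  have I1: "(\<integral>\<^sup>+p. ennreal ((u (fst p))\<^sup>2 * gauss N (snd p)) \<partial>?P) = ennreal ?S"
  proof -
    have "(\<integral>\<^sup>+p. ennreal ((u (fst p))\<^sup>2 * gauss N (snd p)) \<partial>?P) = (\<integral>\<^sup>+z. (\<integral>\<^sup>+x. ennreal (gauss N z) * ennreal ((u x)\<^sup>2) \<partial>RN_leb N) \<partial>RN_leb N)"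
      by (subst RN2.nn_integral_snd[symmetric]) (auto simp: ennreal_mult mult.commute split_beta')
    then show ?thesis by (simp add: nn_integral_cmult S nn_integral_multc nn_integral_gauss)
  qed
  have I2: "(\<integral>\<^sup>+p. ennreal ((?v (fst p) (snd p))\<^sup>2 * gauss N (snd p)) \<partial>?P) = ennreal ?S"
  proof -
    have "(\<integral>\<^sup>+p. ennreal ((?v (fst p) (snd p))\<^sup>2 * gauss N (snd p)) \<partial>?P) = (\<integral>\<^sup>+z. (\<integral>\<^sup>+x. ennreal (gauss N z) * ennreal ((?v x z)\<^sup>2) \<partial>RN_leb N) \<partial>RN_leb N)"
      by (subst RN2.nn_integral_snd[symmetric]) (auto simp: ennreal_mult mult.commute split_beta')
    also have "\<dots> = (\<integral>\<^sup>+z. ennreal (gauss N z) * ennreal ?S \<partial>RN_leb N)"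
      unfolding shift S[symmetric] using nn_integral_shift[of "\<lambda>x. ennreal ((u x)\<^sup>2)" N]
      by (intro nn_integral_cong) (simp add: nn_integral_cmult)
    finally show ?thesis by (simp add: nn_integral_multc nn_integral_gauss)
  qed
  have i1: "integrable ?P (\<lambda>p. (u (fst p))\<^sup>2 * gauss N (snd p))" "(LINT p|?P. (u (fst p))\<^sup>2 * gauss N (snd p)) = ?S"
    using I1 by (auto intro!: integrableI_nonneg simp: integral_eq_nn_integral)
  have i2: "integrable ?P (\<lambda>p. (?v (fst p) (snd p))\<^sup>2 * gauss N (snd p))" "(LINT p|?P. (?v (fst p) (snd p))\<^sup>2 * gauss N (snd p)) = ?S"
    using I2 by (auto intro!: integrableI_nonneg simp: integral_eq_nn_integral)
  have i3: "integrable ?P (\<lambda>p. u (fst p) * ?v (fst p) (snd p) * gauss N (snd p))"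
  proof (rule Bochner_Integration.integrable_bound[OF Bochner_Integration.integrable_add[OF i1(1) i2(1)]])
    show "AE p in ?P. norm (u (fst p) * ?v (fst p) (snd p) * gauss N (snd p)) \<le> norm ((u (fst p))\<^sup>2 * gauss N (snd p) + (?v (fst p) (snd p))\<^sup>2 * gauss N (snd p))"
    proof (rule AE_I2)
      fix p
      have "\<bar>u (fst p) * ?v (fst p) (snd p)\<bar> * gauss N (snd p) \<le> ((u (fst p))\<^sup>2 + (?v (fst p) (snd p))\<^sup>2) * gauss N (snd p)"
        by (intro mult_right_mono abs_mult_le_sum_squares) auto
      then show "norm (u (fst p) * ?v (fst p) (snd p) * gauss N (snd p)) \<le> norm ((u (fst p))\<^sup>2 * gauss N (snd p) + (?v (fst p) (snd p))\<^sup>2 * gauss N (snd p))"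
        by (simp add: abs_mult distrib_right)
    qed
  qed measurable
  have "(LINT p|?P. (?v (fst p) (snd p) - u (fst p))\<^sup>2 * gauss N (snd p)) =
    (LINT p|?P. ((u (fst p))\<^sup>2 * gauss N (snd p) + (?v (fst p) (snd p))\<^sup>2 * gauss N (snd p)) - 2 * (u (fst p) * ?v (fst p) (snd p) * gauss N (snd p)))"
    by (intro Bochner_Integration.integral_cong) (auto simp: power2_diff algebra_simps)
  also have "\<dots> = 2 * ?S - 2 * (LINT p|?P. u (fst p) * ?v (fst p) (snd p) * gauss N (snd p))"
    using i1 i2 i3 by simp
  also have "(LINT p|?P. u (fst p) * ?v (fst p) (snd p) * gauss N (snd p)) = (LINT x|RN_leb N. u x * (LINT z|RN_leb N. ?v x z * gauss N z))"
    using RN2.integral_fst[of N N "\<lambda>x z. u x * ?v x z * gauss N z"] i3 by (simp add: mult.assoc split_beta')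
  finally have "2 * (LINT x|RN_leb N. u x * (LINT z|RN_leb N. ?v x z * gauss N z)) = 2 * ?S - (LINT p|?P. (?v (fst p) (snd p) - u (fst p))\<^sup>2 * gauss N (snd p))"
    by linarith
  moreover have "(LINT p|?P. (?v (fst p) (snd p) - u (fst p))\<^sup>2 * gauss N (snd p)) = enn2real (\<integral>\<^sup>+p. ennreal ((?v (fst p) (snd p) - u (fst p))\<^sup>2 * gauss N (snd p)) \<partial>?P)"
    by (rule integral_eq_nn_integral) auto
  moreover have "(\<integral>\<^sup>+p. ennreal ((?v (fst p) (snd p) - u (fst p))\<^sup>2 * gauss N (snd p)) \<partial>?P) = (\<integral>\<^sup>+z. (\<integral>\<^sup>+x. ennreal (gauss N z) * ennreal ((?v x z - u x)\<^sup>2) \<partial>RN_leb N) \<partial>RN_leb N)"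
    by (subst RN2.nn_integral_snd[symmetric]) (auto simp: ennreal_mult mult.commute split_beta')
  moreover have "\<dots> = (\<integral>\<^sup>+z. ennreal (gauss N z) * trans_diff N u (\<lambda>i. \<eta> * z i) \<partial>RN_leb N)"
    unfolding shift trans_diff_def by (intro nn_integral_cong nn_integral_cmult) auto
  ultimately show ?thesis by simp
qed

lemma trans_diff_gauss_tendsto_0:
  assumes u: "trans_cont N u" and sq: "integrable (RN_leb N) (\<lambda>x. (u x)\<^sup>2)"
    and \<eta>: "\<eta> \<longlonglongrightarrow> 0"
  shows "(\<lambda>n::nat. \<integral>\<^sup>+z. ennreal (gauss N z) * trans_diff N u (\<lambda>i. \<eta> n * z i) \<partial>RN_leb N) \<longlonglongrightarrow> 0"
proof -
  note [measurable] = trans_cont_measurable[OF u]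
  let ?S = "LINT x|RN_leb N. (u x)\<^sup>2"
  have S: "(\<integral>\<^sup>+x. ennreal ((u x)\<^sup>2) \<partial>RN_leb N) = ennreal ?S"
    by (intro nn_integral_eq_integral sq) auto
  have m: "(\<lambda>z. trans_diff N u (\<lambda>i. r * z i)) \<in> borel_measurable (RN_leb N)" for r
  proof -
    have "(\<lambda>(z, x). u (\<lambda>i\<in>{..<N}. x i + r * z i)) \<in> borel_measurable (RN_leb N \<Otimes>\<^sub>M RN_leb N)"
      using measurable_compose[OF measurable_RN_restrict trans_cont_measurable[OF u]]
      by (simp add: split_beta')
    then show ?thesis unfolding trans_diff_def shift_def by measurable
  qed
  have "(\<lambda>n. \<integral>\<^sup>+z. ennreal (gauss N z) * trans_diff N u (\<lambda>i. \<eta> n * z i) \<partial>RN_leb N) \<longlonglongrightarrow> (\<integral>\<^sup>+z. 0 \<partial>RN_leb N)"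
  proof (rule nn_integral_dominated_convergence[where w = "\<lambda>z. ennreal (gauss N z) * (4 * ennreal ?S)"])
    show "(\<integral>\<^sup>+z. ennreal (gauss N z) * (4 * ennreal ?S) \<partial>RN_leb N) < \<infinity>"
      by (simp add: nn_integral_multc nn_integral_gauss ennreal_mult_less_top)
    show "AE z in RN_leb N. (\<lambda>n. ennreal (gauss N z) * trans_diff N u (\<lambda>i. \<eta> n * z i)) \<longlonglongrightarrow> 0"
    proof (rule AE_I2)
      fix z
      have "\<forall>i<N. (\<lambda>n. \<eta> n * z i) \<longlonglongrightarrow> 0"
        using tendsto_mult_left_zero[OF \<eta>] by blast
      then have "(\<lambda>n. trans_diff N u (\<lambda>i. \<eta> n * z i)) \<longlonglongrightarrow> 0"
        using u unfolding trans_cont_def by auto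
      then have "(\<lambda>n. ennreal (gauss N z) * trans_diff N u (\<lambda>i. \<eta> n * z i)) \<longlonglongrightarrow> ennreal (gauss N z) * 0"
        by (intro ennreal_tendsto_cmult) auto
      then show "(\<lambda>n. ennreal (gauss N z) * trans_diff N u (\<lambda>i. \<eta> n * z i)) \<longlonglongrightarrow> 0" by simp
    qed
    show "AE z in RN_leb N. ennreal (gauss N z) * trans_diff N u (\<lambda>i. \<eta> n * z i) \<le> ennreal (gauss N z) * (4 * ennreal ?S)" for n
      unfolding S[symmetric] by (intro AE_I2 mult_left_mono trans_diff_bound) auto
  qed (use m in measurable)
  then show ?thesis by simp
qed

text \<open>By \<open>gauss_energy\<close> and \<open>integral_gauss_convolution\<close> the
  weighted energy equals (2 pi)^N times the squared norm of u minus half of a nonnegative quantity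
  \<open>Q n\<close>, which tends to 0 by continuity of translations. Fatou's lemma gives one
  inequality, and the weight being at most 1 gives the other.\<close>

theorem plancherel:
  assumes u: "integrable (RN_leb N) u" and sq: "integrable (RN_leb N) (\<lambda>x. (u x)\<^sup>2)"
    and supp: "\<And>x. x \<in> space (RN_leb N) \<Longrightarrow> x \<notin> open_box N R \<Longrightarrow> u x = 0"
  shows "(\<integral>\<^sup>+\<xi>. ennreal ((cmod (fourier N u \<xi>))\<^sup>2) \<partial>RN_leb N) = ennreal ((2 * pi) ^ N * (LINT x|RN_leb N. (u x)\<^sup>2))"
proof -
  have [measurable]: "u \<in> borel_measurable (RN_leb N)" using u by auto
  let ?S = "LINT x|RN_leb N. (u x)\<^sup>2"
  let ?F = "\<integral>\<^sup>+\<xi>. ennreal ((cmod (fourier N u \<xi>))\<^sup>2) \<partial>RN_leb N"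
  define \<eta> :: "nat \<Rightarrow> real" where "\<eta> n = 1 / real (Suc n)" for n
  have \<eta>: "\<eta> n > 0" "\<eta> \<longlonglongrightarrow> 0" for n
    using LIMSEQ_inverse_real_of_nat unfolding \<eta>_def[abs_def] inverse_eq_divide by simp_all
  define Q where "Q n = (\<integral>\<^sup>+z. ennreal (gauss N z) * trans_diff N u (\<lambda>i. \<eta> n * z i) \<partial>RN_leb N)" for n
  have Q: "Q \<longlonglongrightarrow> 0" unfolding Q_def
    by (intro trans_diff_gauss_tendsto_0 trans_cont_L2[OF _ sq supp] sq \<eta>) auto
  have E: "(\<integral>\<^sup>+\<xi>. ennreal ((cmod (fourier N u \<xi>))\<^sup>2 * gauss_weight N (\<eta> n) \<xi>) \<partial>RN_leb N) = ennreal ((2 * pi) ^ N * (?S - enn2real (Q n) / 2))" for n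
  proof -
    have "(\<integral>\<^sup>+\<xi>. ennreal ((cmod (fourier N u \<xi>))\<^sup>2 * gauss_weight N (\<eta> n) \<xi>) \<partial>RN_leb N) = ennreal (LINT \<xi>|RN_leb N. (cmod (fourier N u \<xi>))\<^sup>2 * gauss_weight N (\<eta> n) \<xi>)"
      using fourier_bounded_gauss_integrable[OF u \<eta>(1)] by (intro nn_integral_eq_integral) auto
    moreover have "(LINT x|RN_leb N. u x * (LINT z|RN_leb N. u (\<lambda>i\<in>{..<N}. x i + \<eta> n * z i) * gauss N z)) = ?S - enn2real (Q n) / 2"
      using integral_gauss_convolution[OF _ sq, of "\<eta> n"] by (simp add: Q_def)
    ultimately show ?thesis
      using gauss_energy[OF u \<eta>(1), of n] by (simp only:)
  qed
  show ?thesis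
  proof (rule antisym)
    have lim: "(\<lambda>n. ennreal ((cmod (fourier N u \<xi>))\<^sup>2 * gauss_weight N (\<eta> n) \<xi>)) \<longlonglongrightarrow> ennreal ((cmod (fourier N u \<xi>))\<^sup>2)" for \<xi>
    proof -
      have "(\<lambda>n. (cmod (fourier N u \<xi>))\<^sup>2 * (\<Prod>i<N. exp (- ((\<eta> n)\<^sup>2 * (\<xi> i)\<^sup>2 / 2)))) \<longlonglongrightarrow> (cmod (fourier N u \<xi>))\<^sup>2 * (\<Prod>i<N. exp (- (0\<^sup>2 * (\<xi> i)\<^sup>2 / 2)))"
        by (intro tendsto_intros \<eta>) auto
      then show ?thesis unfolding gauss_weight_def by (intro tendsto_ennrealI) simp
    qed
    have "?F = (\<integral>\<^sup>+\<xi>. liminf (\<lambda>n. ennreal ((cmod (fourier N u \<xi>))\<^sup>2 * gauss_weight N (\<eta> n) \<xi>)) \<partial>RN_leb N)"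
      by (intro nn_integral_cong, subst lim_imp_Liminf[OF _ lim]) auto
    also have "\<dots> \<le> liminf (\<lambda>n. \<integral>\<^sup>+\<xi>. ennreal ((cmod (fourier N u \<xi>))\<^sup>2 * gauss_weight N (\<eta> n) \<xi>) \<partial>RN_leb N)"
      by (rule nn_integral_liminf) measurable
    also have "\<dots> \<le> liminf (\<lambda>n::nat. ennreal ((2 * pi) ^ N * ?S))"
      unfolding E by (intro Liminf_mono always_eventually allI ennreal_leI mult_left_mono) auto
    also have "\<dots> = ennreal ((2 * pi) ^ N * ?S)" by (simp add: Liminf_const)
    finally show "?F \<le> ennreal ((2 * pi) ^ N * ?S)" .
  next
    have "(\<lambda>n. enn2real (Q n)) \<longlonglongrightarrow> enn2real 0"
      using Q by (intro tendsto_enn2real) auto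
    then have "(\<lambda>n. (2 * pi) ^ N * (?S - enn2real (Q n) / 2)) \<longlonglongrightarrow> (2 * pi) ^ N * (?S - enn2real 0 / 2)"
      by (intro tendsto_mult tendsto_diff tendsto_divide tendsto_const) auto
    then have "(\<lambda>n. ennreal ((2 * pi) ^ N * (?S - enn2real (Q n) / 2))) \<longlonglongrightarrow> ennreal ((2 * pi) ^ N * ?S)"
      by (intro tendsto_ennrealI) simp
    moreover have "ennreal ((2 * pi) ^ N * (?S - enn2real (Q n) / 2)) \<le> ?F" for n
      unfolding E[symmetric]
    proof (intro nn_integral_mono ennreal_leI)
      fix \<xi> show "(cmod (fourier N u \<xi>))\<^sup>2 * gauss_weight N (\<eta> n) \<xi> \<le> (cmod (fourier N u \<xi>))\<^sup>2"
        using mult_left_mono[OF gauss_weight_le_1[of N "\<eta> n" \<xi>], of "(cmod (fourier N u \<xi>))\<^sup>2"] by simp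
    qed
    ultimately show "ennreal ((2 * pi) ^ N * ?S) \<le> ?F"
      by (intro LIMSEQ_le_const2[of "\<lambda>n. ennreal ((2 * pi) ^ N * (?S - enn2real (Q n) / 2))"]) auto
  qed
qed

section \<open>Functions of finite energy\<close>

lemma open_boxD: "x \<in> open_box N R \<Longrightarrow> j < N \<Longrightarrow> \<bar>x j\<bar> < R"
  by (auto simp: open_box_def abs_less_iff dest!: PiE_mem[of x "{..<N}" "\<lambda>_. {-R<..<R}" j])

lemma continuous_box_integrable:
  assumes f: "continuous_map (RN_top N) euclideanreal f"
    and supp: "\<And>x. x \<in> space (RN_leb N) \<Longrightarrow> x \<notin> open_box N R \<Longrightarrow> f x = 0"
  shows "integrable (RN_leb N) f" "integrable (RN_leb N) (\<lambda>x. (f x)\<^sup>2)"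
proof -
  have [measurable]: "f \<in> borel_measurable (RN_leb N)" by (rule continuous_map_RN_measurable[OF f])
  note [measurable] = openin_RN_sets[OF openin_open_box]
  have "compactin (RN_top N) ({..<N} \<rightarrow>\<^sub>E {-R..R})"
    unfolding RN_top_def by (simp add: compactin_PiE)
  from image_compactin[OF this f] have "bounded (f ` ({..<N} \<rightarrow>\<^sub>E {-R..R}))"
    by (simp add: compact_imp_bounded)
  then obtain M where M: "\<And>x. x \<in> {..<N} \<rightarrow>\<^sub>E {-R..R} \<Longrightarrow> \<bar>f x\<bar> \<le> M"
    by (auto simp: bounded_iff)
  have b: "\<bar>f x\<bar> \<le> M * indicator (open_box N R) x" if "x \<in> space (RN_leb N)" for x
  proof (cases "x \<in> open_box N R")
    case True
    moreover have "open_box N R \<subseteq> {..<N} \<rightarrow>\<^sub>E {-R..R}" unfolding open_box_def by (intro PiE_mono) auto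
    ultimately have "x \<in> {..<N} \<rightarrow>\<^sub>E {-R..R}" by blast
    then show ?thesis using M True by simp
  qed (use supp that in simp)
  have i: "integrable (RN_leb N) (\<lambda>x. c * indicator (open_box N R) x)" for c :: real
    using emeasure_open_box[of N R] by (intro integrable_mult_right integrable_real_indicator) auto
  show "integrable (RN_leb N) f"
    by (rule Bochner_Integration.integrable_bound[OF i[of M]]) (auto intro!: AE_I2 order_trans[OF b] abs_ge_self)
  show "integrable (RN_leb N) (\<lambda>x. (f x)\<^sup>2)"
  proof (rule Bochner_Integration.integrable_bound[OF i[of "M\<^sup>2"]])
    show "AE x in RN_leb N. norm ((f x)\<^sup>2) \<le> norm (M\<^sup>2 * indicator (open_box N R) x)"
    proof (rule AE_I2)
      fix x assume "x \<in> space (RN_leb N)"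
      from power_mono[OF b[OF this], of 2] show "norm ((f x)\<^sup>2) \<le> norm (M\<^sup>2 * indicator (open_box N R) x)"
        by (auto simp: indicator_def split: if_splits)
    qed
  qed measurable
qed

lemma fun_upd_space_RN: "x \<in> space (RN_leb N) \<Longrightarrow> i < N \<Longrightarrow> x(i := t) \<in> space (RN_leb N)"
  by (auto simp: space_RN PiE_def extensional_def)

text \<open>The margin 1 keeps f zero along the whole coordinate line near the point, so that the
  derivative is that of a constant. At a point just outside the original box the line could enter
  it.\<close>

lemma partial_support:
  assumes supp: "\<And>x. x \<in> space (RN_leb N) \<Longrightarrow> x \<notin> open_box N R \<Longrightarrow> f x = 0"
    and x: "x \<in> space (RN_leb N)" "x \<notin> open_box N (R + 1)" and i: "i < N"
  shows "partial i f x = 0"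
proof -
  obtain j where j: "j < N" "\<bar>x j\<bar> \<ge> R + 1"
    using x by (auto simp: open_box_def space_RN PiE_iff abs_less_iff)
  have "\<forall>\<^sub>F t in nhds (x i). f (x(i := t)) = 0"
  proof -
    have "\<forall>\<^sub>F t in nhds (x i). t \<in> ball (x i) 1" by (intro eventually_nhds_in_open) auto
    then show ?thesis
    proof eventually_elim
      case (elim t)
      have "\<bar>(x(i := t)) j\<bar> \<ge> R" using j elim by (cases "j = i") (auto simp: dist_real_def)
      then have "x(i := t) \<notin> open_box N R" using open_boxD[of "x(i := t)" N R j] j by linarith
      then show ?case using supp fun_upd_space_RN[OF x(1) i] by blast
    qed
  qed
  then have "deriv (\<lambda>t. f (x(i := t))) (x i) = deriv (\<lambda>t. 0) (x i)"
    by (intro deriv_cong_ev) auto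
  then show ?thesis by (simp add: partial_def)
qed

text \<open>Integration by parts in the i-th coordinate. The integrand \<open>?g\<close> of the
  difference of both sides is the derivative, along that coordinate, of the kernel times f, which
  vanishes for large arguments; Fubini then makes the full integral vanish.\<close>

lemma fourier_partial:
  assumes cf: "continuous_map (RN_top N) euclideanreal f"
    and cp: "continuous_map (RN_top N) euclideanreal (partial i f)"
    and diff: "\<And>x. x \<in> space (RN_leb N) \<Longrightarrow> (\<lambda>t. f (x(i := t))) differentiable (at (x i))"
    and supp: "\<And>x. x \<in> space (RN_leb N) \<Longrightarrow> x \<notin> open_box N R \<Longrightarrow> f x = 0"
    and i: "i < N" and \<xi>: "\<xi> \<in> space (RN_leb N)"
  shows "fourier N (partial i f) \<xi> = \<i> * of_real (\<xi> i) * fourier N f \<xi>"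
proof -
  have if1: "integrable (RN_leb N) f" by (rule continuous_box_integrable[OF cf supp])
  have if2: "integrable (RN_leb N) (partial i f)"
    by (rule continuous_box_integrable[OF cp, of "R + 1"]) (rule partial_support[OF supp _ _ i])
  let ?e = "\<lambda>x. exp (- (\<i> * complex_of_real (RN_dot N \<xi> x)))"
  let ?g = "\<lambda>x. ?e x * of_real (partial i f x) - \<i> * of_real (\<xi> i) * (?e x * of_real (f x))"
  have ig: "integrable (RN_leb N) ?g"
    by (intro Bochner_Integration.integrable_diff integrable_mult_right integrable_fourier_kernel if1 if2 \<xi>)
  define I where "I = {..<N} - {i}"
  have I: "insert i I = {..<N}" "finite I" "i \<notin> I" using i by (auto simp: I_def)
  have inner: "(LINT y|lborel. ?g (x(i := y))) = 0" if x: "x \<in> space (Pi\<^sub>M I (\<lambda>_. lborel::real measure))" for x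
  proof -
    have xs: "x(i := y) \<in> space (RN_leb N)" for y
      using x i by (auto simp: space_RN space_PiM I_def PiE_def extensional_def)
    define h where "h y = ?e (x(i := y)) * complex_of_real (f (x(i := y)))" for y
    \<comment> \<open>Large enough that the product vanishes at both ends and that f and its partial
      derivative vanish beyond them, whatever the sign of R.\<close>
    define a where "a = \<bar>R\<bar> + 1"
    define d where "d = RN_dot N \<xi> (x(i := 0))"
    have dot: "RN_dot N \<xi> (x(i := y)) = d + \<xi> i * y" for y
    proof -
      have "RN_dot N \<xi> (x(i := y)) = (\<Sum>j\<in>insert i I. \<xi> j * (x(i := y)) j)" for y by (simp add: RN_dot_def I)
      also have "\<dots> y = \<xi> i * y + (\<Sum>j\<in>I. \<xi> j * x j)" for y
      proof -
        have "(\<Sum>j\<in>I. \<xi> j * (x(i := y)) j) = (\<Sum>j\<in>I. \<xi> j * x j)" using I(3) by (intro sum.cong) auto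
        then show ?thesis using I(2,3) by (simp add: sum.insert)
      qed
      finally show ?thesis by (simp add: d_def)
    qed
    have dv: "((\<lambda>y. f (x(i := y))) has_real_derivative partial i f (x(i := y))) (at y)" for y
      using diff[OF xs[of y]] by (simp add: partial_def DERIV_deriv_iff_real_differentiable)
    have hd: "(h has_vector_derivative ?g (x(i := y))) (at y)" for y
      unfolding h_def dot
      by (auto intro!: derivative_eq_intros has_vector_derivative_real_field dv simp: dot algebra_simps)
    have cup: "continuous_map euclideanreal (RN_top N) (\<lambda>y. x(i := y))"
      unfolding RN_top_def continuous_map_componentwise
      using xs by (auto simp: space_RN PiE_iff)
    have c1: "continuous_on UNIV (\<lambda>y. f (x(i := y)))" "continuous_on UNIV (\<lambda>y. partial i f (x(i := y)))"
      using continuous_map_compose[OF cup cf] continuous_map_compose[OF cup cp] by (auto simp: o_def)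
    have cont: "continuous_on {-a..a} (\<lambda>y. ?g (x(i := y)))"
      unfolding dot by (intro continuous_intros continuous_on_subset[OF c1(1)] continuous_on_subset[OF c1(2)]) auto
    have "has_bochner_integral lborel (\<lambda>y. indicator {-a..a} y *\<^sub>R ?g (x(i := y))) (h a - h (-a))"
      using hd cont by (intro has_bochner_integral_FTC_Icc) (auto simp: a_def intro: has_vector_derivative_at_within)
    moreover have out: "x(i := y) \<notin> open_box N R" if "\<bar>y\<bar> \<ge> R" for y
      using that i by (auto simp: open_box_def PiE_iff)
    have "h a = 0" "h (-a) = 0"
      using supp[OF xs out, of a] supp[OF xs out, of "-a"] by (auto simp: h_def a_def)
    moreover have "indicator {-a..a} y *\<^sub>R ?g (x(i := y)) = ?g (x(i := y))" for y
    proof (cases "y \<in> {-a..a}")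
      case False
      then have "f (x(i := y)) = 0" using supp[OF xs out, of y] by (auto simp: a_def)
      moreover have "x(i := y) \<notin> open_box N (R + 1)" using False i by (auto simp: open_box_def PiE_iff a_def)
      then have "partial i f (x(i := y)) = 0" by (intro partial_support[OF supp xs _ i])
      ultimately show ?thesis by simp
    qed simp
    ultimately show ?thesis by (simp add: has_bochner_integral_integral_eq)
  qed
  have "(LINT x|RN_leb N. ?g x) = (LINT x|Pi\<^sub>M I (\<lambda>_. lborel). (LINT y|lborel. ?g (x(i := y))))"
    using leb.product_integral_insert[OF I(2,3), of ?g] ig unfolding RN_leb_def I(1) by simp
  also have "\<dots> = (LINT x|Pi\<^sub>M I (\<lambda>_. lborel :: real measure). 0)"
    by (rule Bochner_Integration.integral_cong[OF refl]) (rule inner)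
  finally have "(LINT x|RN_leb N. ?g x) = 0" by simp
  moreover have "(LINT x|RN_leb N. ?g x) = fourier N (partial i f) \<xi> - \<i> * of_real (\<xi> i) * fourier N f \<xi>"
    unfolding fourier_def using integrable_fourier_kernel[OF if1 \<xi>] integrable_fourier_kernel[OF if2 \<xi>]
    by (subst Bochner_Integration.integral_diff) (auto simp: integral_mult_right_zero simp del: integral_mult_right)
  ultimately show ?thesis by simp
qed

lemma RN_norm_sq: "(RN_norm N x)\<^sup>2 = (\<Sum>i<N. (x i)\<^sup>2)"
  by (simp add: RN_norm_def L2_set_def sum_nonneg)

lemma ln_e_power_le:
  assumes "m \<ge> 1" "r \<ge> 0"
  shows "ln (exp 1 + r) ^ m \<le> 4 * (2 * real m) ^ m * (1 + r\<^sup>2)"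
proof -
  have e: "exp 1 + r \<ge> (1::real)" using assms exp_ge_add_one_self[of 1] by linarith
  have *: "ln (exp 1 + r) ^ m \<le> (2 * real m) ^ m * sqrt (exp 1 + r)"
    by (rule ln_power_le_sqrt[OF e assms(1)])
  have "sqrt (exp 1 + r) \<le> exp 1 + r"
    using e by (intro real_le_lsqrt) (auto simp: power2_eq_square)
  also have "exp 1 + r \<le> 4 * (1 + r\<^sup>2)"
  proof -
    have "r \<le> 1 + r\<^sup>2" using sum_squares_bound[of 1 r] assms by simp
    then show ?thesis using exp_le zero_le_power2[of r] unfolding distrib_left by linarith
  qed
  finally have "(2 * real m) ^ m * sqrt (exp 1 + r) \<le> (2 * real m) ^ m * (4 * (1 + r\<^sup>2))"
    by (intro mult_left_mono) auto
  from order_trans[OF * this] show ?thesis by (simp only: ac_simps)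
qed

text \<open>First derivatives suffice: the logarithmic weight is at most a constant times 1 +
  |\<xi>|^2, and |\<xi>|^2 |f^|^2 is the sum of the squared transforms of the partial derivatives,
  each of finite integral by \<open>plancherel\<close>.\<close>

lemma Hm_norm_sq_test_function:
  assumes m: "m \<ge> 1" and f: "f \<in> test_functions N \<Omega>" and \<Omega>: "\<Omega> \<subseteq> open_box N R"
  shows "Hm_norm_sq m N f < \<infinity>"
proof -
  have sm: "smooth_RN N f" and s0: "x \<notin> \<Omega> \<Longrightarrow> f x = 0" for x using f by (auto simp: test_functions_def)
  have supp: "x \<notin> open_box N R \<Longrightarrow> f x = 0" for x using s0 \<Omega> by auto
  have cf: "continuous_map (RN_top N) euclideanreal f"
    using sm unfolding smooth_RN_def by (elim allE[of _ "[]"]) simp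
  have cp: "continuous_map (RN_top N) euclideanreal (partial i f)" if "i < N" for i
    using sm that unfolding smooth_RN_def by (elim allE[of _ "[i]"]) simp
  have diff: "(\<lambda>t. f (x(i := t))) differentiable (at (x i))" if "i < N" "x \<in> space (RN_leb N)" for i x
    using sm that unfolding smooth_RN_def by (elim allE[of _ "[]"]) simp
  have [measurable]: "f \<in> borel_measurable (RN_leb N)" by (rule continuous_map_RN_measurable[OF cf])
  let ?C = "4 * (2 * real m) ^ m"
  let ?F = "\<lambda>\<xi>. ennreal ((cmod (fourier N f \<xi>))\<^sup>2)" and ?G = "\<lambda>i \<xi>. ennreal ((cmod (fourier N (partial i f) \<xi>))\<^sup>2)"
  have pm: "partial i f \<in> borel_measurable (RN_leb N)" if "i < N" for i
    by (rule continuous_map_RN_measurable[OF cp[OF that]])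
  have Gm: "?G i \<in> borel_measurable (RN_leb N)" if "i < N" for i
    using fourier_measurable[OF pm[OF that]] by measurable
  have F: "(\<integral>\<^sup>+\<xi>. ?F \<xi> \<partial>RN_leb N) < \<infinity>"
    using plancherel[OF continuous_box_integrable[OF cf supp] supp] by simp
  have G: "(\<integral>\<^sup>+\<xi>. ?G i \<xi> \<partial>RN_leb N) < \<infinity>" if i: "i < N" for i
  proof -
    have s: "x \<in> space (RN_leb N) \<Longrightarrow> x \<notin> open_box N (R + 1) \<Longrightarrow> partial i f x = 0" for x
      by (rule partial_support[OF supp _ _ i])
    show ?thesis using plancherel[OF continuous_box_integrable[OF cp[OF i] s] s] by simp
  qed
  have "Hm_norm_sq m N f \<le> (\<integral>\<^sup>+\<xi>. ennreal ?C * (?F \<xi> + (\<Sum>i<N. ?G i \<xi>)) \<partial>RN_leb N)"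
    unfolding Hm_norm_sq_def
  proof (rule nn_integral_mono)
    fix \<xi> assume \<xi>: "\<xi> \<in> space (RN_leb N)"
    have "(cmod (fourier N (partial i f) \<xi>))\<^sup>2 = (\<xi> i)\<^sup>2 * (cmod (fourier N f \<xi>))\<^sup>2" if "i < N" for i
      using fourier_partial[OF cf cp[OF that] diff[OF that] supp that \<xi>] by (simp add: norm_mult power_mult_distrib)
    then have "(\<Sum>i<N. (cmod (fourier N (partial i f) \<xi>))\<^sup>2) = (RN_norm N \<xi>)\<^sup>2 * (cmod (fourier N f \<xi>))\<^sup>2"
      by (simp add: RN_norm_sq sum_distrib_right)
    then have *: "?C * ((cmod (fourier N f \<xi>))\<^sup>2 + (\<Sum>i<N. (cmod (fourier N (partial i f) \<xi>))\<^sup>2)) = ?C * (1 + (RN_norm N \<xi>)\<^sup>2) * (cmod (fourier N f \<xi>))\<^sup>2"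
      by (simp add: algebra_simps)
    have "ennreal (ln (exp 1 + RN_norm N \<xi>) ^ m * (cmod (fourier N f \<xi>))\<^sup>2) \<le> ennreal (?C * ((cmod (fourier N f \<xi>))\<^sup>2 + (\<Sum>i<N. (cmod (fourier N (partial i f) \<xi>))\<^sup>2)))"
      unfolding * by (intro ennreal_leI mult_right_mono ln_e_power_le m) auto
    also have "\<dots> = ennreal ?C * (?F \<xi> + (\<Sum>i<N. ?G i \<xi>))"
      by (simp add: ennreal_mult ennreal_plus sum_nonneg sum_ennreal)
    finally show "ennreal (ln (exp 1 + RN_norm N \<xi>) ^ m * (cmod (fourier N f \<xi>))\<^sup>2) \<le> ennreal ?C * (?F \<xi> + (\<Sum>i<N. ?G i \<xi>))" .
  qed
  also have "\<dots> = ennreal ?C * ((\<integral>\<^sup>+\<xi>. ?F \<xi> \<partial>RN_leb N) + (\<integral>\<^sup>+\<xi>. (\<Sum>i<N. ?G i \<xi>) \<partial>RN_leb N))"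
    using Gm by (subst nn_integral_cmult, measurable) (subst nn_integral_add, auto)
  also have "(\<integral>\<^sup>+\<xi>. (\<Sum>i<N. ?G i \<xi>) \<partial>RN_leb N) = (\<Sum>i<N. \<integral>\<^sup>+\<xi>. ?G i \<xi> \<partial>RN_leb N)"
    using Gm by (intro nn_integral_sum) auto
  also have "ennreal ?C * ((\<integral>\<^sup>+\<xi>. ?F \<xi> \<partial>RN_leb N) + \<dots>) < \<infinity>"
    using F G by (auto simp: ennreal_mult_less_top less_top)
  finally show ?thesis .
qed

section \<open>The linear space of boxed L^2 functions with finite logarithmic energy\<close>

lemma integrable_of_square_integrable:
  fixes u :: "_ \<Rightarrow> real"
  assumes [measurable]: "u \<in> borel_measurable (RN_leb N)" and sq: "integrable (RN_leb N) (\<lambda>x. (u x)\<^sup>2)"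
    and supp: "\<And>x. x \<notin> open_box N R \<Longrightarrow> u x = 0"
  shows "integrable (RN_leb N) u"
proof -
  note [measurable] = openin_RN_sets[OF openin_open_box]
  have "integrable (RN_leb N) (\<lambda>x. indicator (open_box N R) x + (u x)\<^sup>2)"
    using emeasure_open_box[of N R] sq by (intro Bochner_Integration.integrable_add integrable_real_indicator) auto
  then show ?thesis
  proof (rule Bochner_Integration.integrable_bound)
    show "AE x in RN_leb N. norm (u x) \<le> norm (indicator (open_box N R) x + (u x)\<^sup>2)"
    proof (rule AE_I2)
      fix x
      have "\<bar>u x\<bar> \<le> 1 + (u x)\<^sup>2" using sum_squares_bound[of 1 "\<bar>u x\<bar>"] by simp
      then show "norm (u x) \<le> norm (indicator (open_box N R) x + (u x)\<^sup>2)"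
        using supp[of x] by (auto simp: indicator_def)
    qed
  qed measurable
qed

text \<open>
  A linear space that contains \<open>Hm0 m N \<Omega>\<close> whenever the box contains \<open>\<Omega>\<close>; using it avoids
  proving that \<open>Hm0 m N \<Omega>\<close> itself is linear.
\<close>

definition Hfin :: "nat \<Rightarrow> nat \<Rightarrow> real \<Rightarrow> ((nat \<Rightarrow> real) \<Rightarrow> real) set" where
  "Hfin m N R = {u. u \<in> borel_measurable (RN_leb N) \<and> integrable (RN_leb N) (\<lambda>x. (u x)\<^sup>2) \<and>
     (\<forall>x. x \<notin> open_box N R \<longrightarrow> u x = 0) \<and> Hm_norm_sq m N u < \<infinity>}"

lemma HfinD:
  assumes "u \<in> Hfin m N R"
  shows "u \<in> borel_measurable (RN_leb N)" "integrable (RN_leb N) (\<lambda>x. (u x)\<^sup>2)"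
    "\<And>x. x \<notin> open_box N R \<Longrightarrow> u x = 0" "Hm_norm_sq m N u < \<infinity>" "integrable (RN_leb N) u"
proof -
  show u: "u \<in> borel_measurable (RN_leb N)" "integrable (RN_leb N) (\<lambda>x. (u x)\<^sup>2)"
    "\<And>x. x \<notin> open_box N R \<Longrightarrow> u x = 0" "Hm_norm_sq m N u < \<infinity>"
    using assms by (auto simp: Hfin_def)
  show "integrable (RN_leb N) u" by (rule integrable_of_square_integrable[OF u(1-3)])
qed

lemma integrable_mult_L2:
  fixes u v :: "_ \<Rightarrow> real"
  assumes [measurable]: "u \<in> borel_measurable M" "v \<in> borel_measurable M"
    and "integrable M (\<lambda>x. (u x)\<^sup>2)" "integrable M (\<lambda>x. (v x)\<^sup>2)"
  shows "integrable M (\<lambda>x. u x * v x)"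
proof (rule Bochner_Integration.integrable_bound[OF Bochner_Integration.integrable_add[OF assms(3,4)]])
  show "AE x in M. norm (u x * v x) \<le> norm ((u x)\<^sup>2 + (v x)\<^sup>2)"
  proof (rule AE_I2)
    fix x show "norm (u x * v x) \<le> norm ((u x)\<^sup>2 + (v x)\<^sup>2)"
      using abs_mult_le_sum_squares[of "u x" "v x"] by simp
  qed
qed measurable

lemma fourier_linear:
  assumes "integrable (RN_leb N) u" "integrable (RN_leb N) v" "\<xi> \<in> space (RN_leb N)"
  shows "fourier N (\<lambda>x. a * u x + b * v x) \<xi> = of_real a * fourier N u \<xi> + of_real b * fourier N v \<xi>"
proof -
  have "fourier N (\<lambda>x. a * u x + b * v x) \<xi> = (LINT x|RN_leb N. of_real a * (exp (- (\<i> * of_real (RN_dot N \<xi> x))) * of_real (u x))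
     + of_real b * (exp (- (\<i> * of_real (RN_dot N \<xi> x))) * of_real (v x)))"
    unfolding fourier_def by (intro Bochner_Integration.integral_cong) (auto simp: algebra_simps)
  also have "\<dots> = of_real a * fourier N u \<xi> + of_real b * fourier N v \<xi>"
    unfolding fourier_def using integrable_fourier_kernel[OF assms(1,3)] integrable_fourier_kernel[OF assms(2,3)]
    by (subst Bochner_Integration.integral_add) auto
  finally show ?thesis .
qed

lemma Hm_norm_sq_linear:
  assumes u: "integrable (RN_leb N) u" and v: "integrable (RN_leb N) v"
  shows "Hm_norm_sq m N (\<lambda>x. a * u x + b * v x) \<le> ennreal (2 * a\<^sup>2) * Hm_norm_sq m N u + ennreal (2 * b\<^sup>2) * Hm_norm_sq m N v"
proof -
  have [measurable]: "u \<in> borel_measurable (RN_leb N)" "v \<in> borel_measurable (RN_leb N)" using u v by auto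
  let ?w = "\<lambda>\<xi>. ln (exp 1 + RN_norm N \<xi>) ^ m"
  have w: "?w \<xi> \<ge> 0" for \<xi> :: "nat \<Rightarrow> real"
  proof -
    have "1 \<le> exp 1 + RN_norm N \<xi>" using RN_norm_nonneg[of N \<xi>] exp_ge_add_one_self[of 1] by linarith
    then show ?thesis by simp
  qed
  have "Hm_norm_sq m N (\<lambda>x. a * u x + b * v x) \<le> (\<integral>\<^sup>+\<xi>. ennreal (2 * a\<^sup>2) * ennreal (?w \<xi> * (cmod (fourier N u \<xi>))\<^sup>2) + ennreal (2 * b\<^sup>2) * ennreal (?w \<xi> * (cmod (fourier N v \<xi>))\<^sup>2) \<partial>RN_leb N)"
    unfolding Hm_norm_sq_def
  proof (rule nn_integral_mono)
    fix \<xi> assume \<xi>: "\<xi> \<in> space (RN_leb N)"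
    let ?p = "\<bar>a\<bar> * cmod (fourier N u \<xi>)" and ?q = "\<bar>b\<bar> * cmod (fourier N v \<xi>)"
    have "(cmod (fourier N (\<lambda>x. a * u x + b * v x) \<xi>))\<^sup>2 \<le> (?p + ?q)\<^sup>2"
      unfolding fourier_linear[OF u v \<xi>] by (intro power_mono order_trans[OF norm_triangle_ineq]) (auto simp: norm_mult)
    also have "\<dots> \<le> 2 * ?p\<^sup>2 + 2 * ?q\<^sup>2" using sum_squares_bound[of ?p ?q] by (simp add: power2_sum)
    also have "\<dots> = 2 * a\<^sup>2 * (cmod (fourier N u \<xi>))\<^sup>2 + 2 * b\<^sup>2 * (cmod (fourier N v \<xi>))\<^sup>2"
      by (simp add: power_mult_distrib)
    finally have "?w \<xi> * (cmod (fourier N (\<lambda>x. a * u x + b * v x) \<xi>))\<^sup>2 \<le> ?w \<xi> * \<dots>"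
      by (intro mult_left_mono w)
    also have "\<dots> = 2 * a\<^sup>2 * (?w \<xi> * (cmod (fourier N u \<xi>))\<^sup>2) + 2 * b\<^sup>2 * (?w \<xi> * (cmod (fourier N v \<xi>))\<^sup>2)"
      by (simp add: algebra_simps)
    finally have "ennreal (?w \<xi> * (cmod (fourier N (\<lambda>x. a * u x + b * v x) \<xi>))\<^sup>2) \<le> ennreal \<dots>" by (rule ennreal_leI)
    also have "\<dots> = ennreal (2 * a\<^sup>2) * ennreal (?w \<xi> * (cmod (fourier N u \<xi>))\<^sup>2) + ennreal (2 * b\<^sup>2) * ennreal (?w \<xi> * (cmod (fourier N v \<xi>))\<^sup>2)"
      using w by (subst ennreal_plus) (auto simp: ennreal_mult)
    finally show "ennreal (?w \<xi> * (cmod (fourier N (\<lambda>x. a * u x + b * v x) \<xi>))\<^sup>2) \<le> \<dots>" .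
  qed
  also have "\<dots> = ennreal (2 * a\<^sup>2) * Hm_norm_sq m N u + ennreal (2 * b\<^sup>2) * Hm_norm_sq m N v"
    unfolding Hm_norm_sq_def by (subst nn_integral_add) (auto simp: nn_integral_cmult)
  finally show ?thesis .
qed

lemma Hfin_linear:
  assumes u: "u \<in> Hfin m N R" and v: "v \<in> Hfin m N R"
  shows "(\<lambda>x. a * u x + b * v x) \<in> Hfin m N R"
proof -
  note [measurable] = HfinD(1)[OF u] HfinD(1)[OF v]
  have "integrable (RN_leb N) (\<lambda>x. a\<^sup>2 * (u x)\<^sup>2 + 2 * a * b * (u x * v x) + b\<^sup>2 * (v x)\<^sup>2)"
    by (intro Bochner_Integration.integrable_add integrable_mult_right integrable_mult_L2 HfinD[OF u] HfinD[OF v])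
  moreover have "(\<lambda>x. a\<^sup>2 * (u x)\<^sup>2 + 2 * a * b * (u x * v x) + b\<^sup>2 * (v x)\<^sup>2) = (\<lambda>x. (a * u x + b * v x)\<^sup>2)"
    by (auto simp: power2_sum power_mult_distrib)
  ultimately have "integrable (RN_leb N) (\<lambda>x. (a * u x + b * v x)\<^sup>2)" by simp
  moreover have "Hm_norm_sq m N (\<lambda>x. a * u x + b * v x) < \<infinity>"
    by (rule le_less_trans[OF Hm_norm_sq_linear]) (use HfinD(4,5)[OF u] HfinD(4,5)[OF v] in \<open>auto simp: ennreal_mult_less_top\<close>)
  ultimately show ?thesis using HfinD(3)[OF u] HfinD(3)[OF v] by (auto simp: Hfin_def)
qed

lemma Hfin_zero: "(\<lambda>x. 0) \<in> Hfin m N R"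
  by (simp add: Hfin_def Hm_norm_sq_def fourier_def)

lemma Hfin_sum:
  assumes "\<And>i. i \<in> I \<Longrightarrow> u i \<in> Hfin m N R"
  shows "(\<lambda>x. \<Sum>i\<in>I. c i * u i x) \<in> Hfin m N R"
  using assms
proof (induction I rule: infinite_finite_induct)
  case (insert i I)
  then show ?case using Hfin_linear[of "u i" m N R "\<lambda>x. \<Sum>i\<in>I. c i * u i x" "c i" 1] by simp
qed (simp_all add: Hfin_zero)

text \<open>Convergence puts some test function at finite distance from u, and test functions have
  finite energy; u is the difference of these two.\<close>

lemma Hm0_subset_Hfin:
  assumes m: "m \<ge> 1" and \<Omega>: "\<Omega> \<subseteq> open_box N R"
  shows "Hm0 m N \<Omega> \<subseteq> Hfin m N R"
proof
  fix u assume u: "u \<in> Hm0 m N \<Omega>"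
  then obtain f where f: "\<And>n::nat. f n \<in> test_functions N \<Omega>" "(\<lambda>n. Hm_norm_sq m N (\<lambda>x. f n x - u x)) \<longlonglongrightarrow> 0"
    and u': "u \<in> borel_measurable (RN_leb N)" "integrable (RN_leb N) (\<lambda>x. (u x)\<^sup>2)" "\<And>x. x \<notin> \<Omega> \<Longrightarrow> u x = 0"
    by (auto simp: Hm0_def)
  have supp: "u x = 0" if "x \<notin> open_box N R" for x using u'(3) \<Omega> that by auto
  have iu: "integrable (RN_leb N) u" by (rule integrable_of_square_integrable[OF u'(1,2) supp])
  have "\<forall>\<^sub>F n in sequentially. Hm_norm_sq m N (\<lambda>x. f n x - u x) < 1"
    using f(2) by (rule order_tendstoD) simp
  then obtain n where n: "Hm_norm_sq m N (\<lambda>x. f n x - u x) < 1"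
    by (auto simp: eventually_sequentially)
  have cf: "continuous_map (RN_top N) euclideanreal (f n)"
    using f(1)[of n] unfolding test_functions_def smooth_RN_def by (auto elim!: allE[of _ "[]"])
  have "f n x = 0" if "x \<notin> open_box N R" for x
    using f(1)[of n] \<Omega> that by (auto simp: test_functions_def)
  then have intf: "integrable (RN_leb N) (f n)" by (intro continuous_box_integrable(1)[OF cf, of R])
  have "Hm_norm_sq m N (\<lambda>x. 1 * f n x + (-1) * (f n x - u x)) \<le> ennreal (2 * 1\<^sup>2) * Hm_norm_sq m N (f n) + ennreal (2 * (-1)\<^sup>2) * Hm_norm_sq m N (\<lambda>x. f n x - u x)"
    by (rule Hm_norm_sq_linear) (use intf iu in auto)
  also have "\<dots> < \<infinity>"
    using Hm_norm_sq_test_function[OF m f(1) \<Omega>, of n] n by (auto simp: ennreal_mult_less_top intro: less_trans)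
  finally have "Hm_norm_sq m N u < \<infinity>" by simp
  then show "u \<in> Hfin m N R" using u' supp by (auto simp: Hfin_def)
qed

section \<open>The logarithmic form and orthonormal systems\<close>

text \<open>Outside the unit ball the symbol is controlled by the weight ln (e + |\<xi>|). Inside,
  the transform is bounded by the L^1 norm of u and the power of the logarithm is
  integrable.\<close>

lemma log_energy_finite:
  assumes u: "u \<in> Hfin m N R" and N: "N \<ge> 1" and m: "m \<ge> 1"
  shows "(\<integral>\<^sup>+\<xi>. ennreal (\<bar>2 * ln (RN_norm N \<xi>)\<bar> ^ m * (cmod (fourier N u \<xi>))\<^sup>2) \<partial>RN_leb N) < \<infinity>"
proof -
  note [measurable] = HfinD(1)[OF u]
  let ?L = "LINT x|RN_leb N. \<bar>u x\<bar>"
  let ?f = "\<lambda>\<xi>. ennreal (ln (exp 1 + RN_norm N \<xi>) ^ m * (cmod (fourier N u \<xi>))\<^sup>2)"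
  let ?g = "\<lambda>\<xi>. ennreal (\<bar>ln (RN_norm N \<xi>)\<bar> ^ m * indicator {..<1} (RN_norm N \<xi>))"
  have "(\<integral>\<^sup>+\<xi>. ennreal (\<bar>2 * ln (RN_norm N \<xi>)\<bar> ^ m * (cmod (fourier N u \<xi>))\<^sup>2) \<partial>RN_leb N) \<le>
    (\<integral>\<^sup>+\<xi>. ennreal (2 ^ m) * ?f \<xi> + ennreal (2 ^ m * ?L\<^sup>2) * ?g \<xi> \<partial>RN_leb N)"
  proof (rule nn_integral_mono)
    fix \<xi> :: "nat \<Rightarrow> real"
    let ?r = "RN_norm N \<xi>" and ?c = "cmod (fourier N u \<xi>)"
    have e: "exp 1 + ?r \<ge> 1" "exp 1 + ?r \<ge> ?r"
      using RN_norm_nonneg[of N \<xi>] exp_ge_add_one_self[of 1] by linarith+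
    have "\<bar>ln ?r\<bar> ^ m * ?c\<^sup>2 \<le> ln (exp 1 + ?r) ^ m * ?c\<^sup>2 + ?L\<^sup>2 * (\<bar>ln ?r\<bar> ^ m * indicator {..<1} ?r)"
    proof (cases "?r < 1")
      case True
      have "?c\<^sup>2 \<le> ?L\<^sup>2" by (intro power_mono cmod_fourier_le) auto
      then have "\<bar>ln ?r\<bar> ^ m * ?c\<^sup>2 \<le> ?L\<^sup>2 * \<bar>ln ?r\<bar> ^ m"
        using mult_left_mono[of "?c\<^sup>2" "?L\<^sup>2" "\<bar>ln ?r\<bar> ^ m"] by (simp add: mult.commute)
      moreover have "0 \<le> ln (exp 1 + ?r) ^ m * ?c\<^sup>2" using e by simp
      ultimately show ?thesis using True by simp
    next
      case False
      then have "\<bar>ln ?r\<bar> \<le> ln (exp 1 + ?r)" using e by (simp add: ln_mono)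
      then show ?thesis using False by (auto intro!: mult_right_mono power_mono)
    qed
    then have "\<bar>2 * ln ?r\<bar> ^ m * ?c\<^sup>2 \<le> 2 ^ m * (ln (exp 1 + ?r) ^ m * ?c\<^sup>2 + ?L\<^sup>2 * (\<bar>ln ?r\<bar> ^ m * indicator {..<1} ?r))"
      by (simp add: abs_mult power_mult_distrib mult.assoc)
    then have "ennreal (\<bar>2 * ln ?r\<bar> ^ m * ?c\<^sup>2) \<le> ennreal (2 ^ m * (ln (exp 1 + ?r) ^ m * ?c\<^sup>2) + 2 ^ m * ?L\<^sup>2 * (\<bar>ln ?r\<bar> ^ m * indicator {..<1} ?r))"
      by (intro ennreal_leI) (simp add: algebra_simps)
    also have "\<dots> = ennreal (2 ^ m) * ?f \<xi> + ennreal (2 ^ m * ?L\<^sup>2) * ?g \<xi>"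
      using e by (subst ennreal_plus) (auto simp: ennreal_mult)
    finally show "ennreal (\<bar>2 * ln ?r\<bar> ^ m * ?c\<^sup>2) \<le> ennreal (2 ^ m) * ?f \<xi> + ennreal (2 ^ m * ?L\<^sup>2) * ?g \<xi>" .
  qed
  also have "\<dots> = ennreal (2 ^ m) * (\<integral>\<^sup>+\<xi>. ?f \<xi> \<partial>RN_leb N) + ennreal (2 ^ m * ?L\<^sup>2) * (\<integral>\<^sup>+\<xi>. ?g \<xi> \<partial>RN_leb N)"
    by (subst nn_integral_add) (auto simp: nn_integral_cmult)
  also have "\<dots> < \<infinity>"
    using HfinD(4)[OF u] nn_integral_ln_norm_power_finite[OF N m]
    by (auto simp: Hm_norm_sq_def ennreal_mult_less_top)
  finally show ?thesis .
qed

lemma integrable_log_form: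
  assumes u: "u \<in> Hfin m N R" and v: "v \<in> Hfin m N R" and N: "N \<ge> 1" and m: "m \<ge> 1"
  shows "integrable (RN_leb N) (\<lambda>\<xi>. of_real ((2 * ln (RN_norm N \<xi>)) ^ m) * fourier N u \<xi> * cnj (fourier N v \<xi>))"
proof (rule integrableI_bounded)
  note [measurable] = HfinD(1)[OF u] HfinD(1)[OF v]
  show "(\<lambda>\<xi>. of_real ((2 * ln (RN_norm N \<xi>)) ^ m) * fourier N u \<xi> * cnj (fourier N v \<xi>)) \<in> borel_measurable (RN_leb N)"
    by measurable
  let ?w = "\<lambda>\<xi>. \<bar>2 * ln (RN_norm N \<xi>)\<bar> ^ m"
  have "(\<integral>\<^sup>+\<xi>. ennreal (norm (of_real ((2 * ln (RN_norm N \<xi>)) ^ m) * fourier N u \<xi> * cnj (fourier N v \<xi>))) \<partial>RN_leb N) \<le>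
    (\<integral>\<^sup>+\<xi>. ennreal (?w \<xi> * (cmod (fourier N u \<xi>))\<^sup>2) + ennreal (?w \<xi> * (cmod (fourier N v \<xi>))\<^sup>2) \<partial>RN_leb N)"
  proof (rule nn_integral_mono)
    fix \<xi> :: "nat \<Rightarrow> real"
    have "norm (of_real ((2 * ln (RN_norm N \<xi>)) ^ m) * fourier N u \<xi> * cnj (fourier N v \<xi>)) = ?w \<xi> * \<bar>cmod (fourier N u \<xi>) * cmod (fourier N v \<xi>)\<bar>"
      unfolding norm_mult abs_mult complex_mod_cnj norm_of_real power_abs by simp
    also have "\<dots> \<le> ?w \<xi> * ((cmod (fourier N u \<xi>))\<^sup>2 + (cmod (fourier N v \<xi>))\<^sup>2)"
      by (intro mult_left_mono abs_mult_le_sum_squares) auto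
    finally have "ennreal (norm (of_real ((2 * ln (RN_norm N \<xi>)) ^ m) * fourier N u \<xi> * cnj (fourier N v \<xi>))) \<le> ennreal (?w \<xi> * ((cmod (fourier N u \<xi>))\<^sup>2 + (cmod (fourier N v \<xi>))\<^sup>2))"
      by (rule ennreal_leI)
    then show "ennreal (norm (of_real ((2 * ln (RN_norm N \<xi>)) ^ m) * fourier N u \<xi> * cnj (fourier N v \<xi>))) \<le> ennreal (?w \<xi> * (cmod (fourier N u \<xi>))\<^sup>2) + ennreal (?w \<xi> * (cmod (fourier N v \<xi>))\<^sup>2)"
      by (simp add: distrib_left ennreal_plus)
  qed
  also have "\<dots> < \<infinity>"
    using log_energy_finite[OF u N m] log_energy_finite[OF v N m] by (subst nn_integral_add) auto
  finally show "(\<integral>\<^sup>+\<xi>. ennreal (norm (of_real ((2 * ln (RN_norm N \<xi>)) ^ m) * fourier N u \<xi> * cnj (fourier N v \<xi>))) \<partial>RN_leb N) < \<infinity>" .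
qed

lemma log_form_linear:
  assumes u: "u \<in> Hfin m N R" and v: "v \<in> Hfin m N R" and w: "w \<in> Hfin m N R" and N: "N \<ge> 1" and m: "m \<ge> 1"
  shows "log_form m N (\<lambda>x. a * u x + b * v x) w = of_real a * log_form m N u w + of_real b * log_form m N v w"
proof -
  let ?w = "\<lambda>\<xi>. complex_of_real ((2 * ln (RN_norm N \<xi>)) ^ m)"
  have "(LINT \<xi>|RN_leb N. ?w \<xi> * fourier N (\<lambda>x. a * u x + b * v x) \<xi> * cnj (fourier N w \<xi>)) =
    (LINT \<xi>|RN_leb N. of_real a * (?w \<xi> * fourier N u \<xi> * cnj (fourier N w \<xi>)) + of_real b * (?w \<xi> * fourier N v \<xi> * cnj (fourier N w \<xi>)))"
  proof (intro Bochner_Integration.integral_cong refl)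
    fix \<xi> assume "\<xi> \<in> space (RN_leb N)"
    from fourier_linear[OF HfinD(5)[OF u] HfinD(5)[OF v] this, of a b]
    show "?w \<xi> * fourier N (\<lambda>x. a * u x + b * v x) \<xi> * cnj (fourier N w \<xi>) =
      of_real a * (?w \<xi> * fourier N u \<xi> * cnj (fourier N w \<xi>)) + of_real b * (?w \<xi> * fourier N v \<xi> * cnj (fourier N w \<xi>))"
      by (simp only: distrib_left distrib_right ac_simps)
  qed
  also have "\<dots> = of_real a * (LINT \<xi>|RN_leb N. ?w \<xi> * fourier N u \<xi> * cnj (fourier N w \<xi>)) + of_real b * (LINT \<xi>|RN_leb N. ?w \<xi> * fourier N v \<xi> * cnj (fourier N w \<xi>))"
    using integrable_log_form[OF u w N m] integrable_log_form[OF v w N m]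
    by (subst Bochner_Integration.integral_add) (simp_all only: integral_mult_right_zero integrable_mult_right)
  finally show ?thesis unfolding log_form_def by (simp only: distrib_left ac_simps)
qed

lemma log_form_cnj: "log_form m N v u = cnj (log_form m N u v)"
  unfolding log_form_def
  by (simp add: Bochner_Integration.integral_cnj[symmetric] ac_simps)

lemma log_form_zero: "log_form m N (\<lambda>x. 0) w = 0"
  by (simp add: log_form_def fourier_def)

lemma log_form_sum:
  assumes "\<And>i. i \<in> I \<Longrightarrow> u i \<in> Hfin m N R" and w: "w \<in> Hfin m N R" and N: "N \<ge> 1" and m: "m \<ge> 1"
  shows "log_form m N (\<lambda>x. \<Sum>i\<in>I. c i * u i x) w = (\<Sum>i\<in>I. of_real (c i) * log_form m N (u i) w)"
  using assms(1)
proof (induction I rule: infinite_finite_induct)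
  case (insert i I)
  then show ?case using log_form_linear[of "u i" m N R "\<lambda>x. \<Sum>i\<in>I. c i * u i x" w "c i" 1] Hfin_sum[of I u m N R c] w N m by simp
qed (simp_all add: log_form_zero)

lemma log_form_self:
  assumes u: "u \<in> Hfin m N R" and N: "N \<ge> 1" and m: "m \<ge> 1"
  shows "integrable (RN_leb N) (\<lambda>\<xi>. (2 * ln (RN_norm N \<xi>)) ^ m * (cmod (fourier N u \<xi>))\<^sup>2)"
    and "log_form m N u u = of_real (1 / (2 * pi) ^ N * (LINT \<xi>|RN_leb N. (2 * ln (RN_norm N \<xi>)) ^ m * (cmod (fourier N u \<xi>))\<^sup>2))"
proof -
  have eq: "of_real ((2 * ln (RN_norm N \<xi>)) ^ m) * fourier N u \<xi> * cnj (fourier N u \<xi>) = complex_of_real ((2 * ln (RN_norm N \<xi>)) ^ m * (cmod (fourier N u \<xi>))\<^sup>2)" for \<xi>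
    by (simp only: of_real_mult complex_norm_square mult.assoc)
  from integrable_log_form[OF u u N m]
  have "integrable (RN_leb N) (\<lambda>\<xi>. complex_of_real ((2 * ln (RN_norm N \<xi>)) ^ m * (cmod (fourier N u \<xi>))\<^sup>2))"
    unfolding eq .
  then show "integrable (RN_leb N) (\<lambda>\<xi>. (2 * ln (RN_norm N \<xi>)) ^ m * (cmod (fourier N u \<xi>))\<^sup>2)"
    by (subst (asm) complex_of_real_integrable_eq)
  show "log_form m N u u = of_real (1 / (2 * pi) ^ N * (LINT \<xi>|RN_leb N. (2 * ln (RN_norm N \<xi>)) ^ m * (cmod (fourier N u \<xi>))\<^sup>2))"
    unfolding log_form_def eq by (subst integral_complex_of_real) simp
qed

section \<open>Bessel's inequality and orthonormalisation for real square-integrable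
  functions\<close>

definition L2fun :: "'a measure \<Rightarrow> ('a \<Rightarrow> real) set" where
  "L2fun M = {u. u \<in> borel_measurable M \<and> integrable M (\<lambda>x. (u x)\<^sup>2)}"

definition ip :: "'a measure \<Rightarrow> ('a \<Rightarrow> real) \<Rightarrow> ('a \<Rightarrow> real) \<Rightarrow> real" where
  "ip M u v = (LINT x|M. u x * v x)"

lemma L2fun_mult_integrable: "u \<in> L2fun M \<Longrightarrow> v \<in> L2fun M \<Longrightarrow> integrable M (\<lambda>x. u x * v x)"
  unfolding L2fun_def by (intro integrable_mult_L2) auto

lemma L2fun_linear:
  assumes u: "u \<in> L2fun M" and v: "v \<in> L2fun M"
  shows "(\<lambda>x. a * u x + b * v x) \<in> L2fun M"
proof -
  have [measurable]: "u \<in> borel_measurable M" "v \<in> borel_measurable M" using u v by (auto simp: L2fun_def)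
  have "integrable M (\<lambda>x. a\<^sup>2 * (u x)\<^sup>2 + 2 * a * b * (u x * v x) + b\<^sup>2 * (v x)\<^sup>2)"
    using u v L2fun_mult_integrable[OF u v] by (intro Bochner_Integration.integrable_add integrable_mult_right) (auto simp: L2fun_def)
  moreover have "(\<lambda>x. a\<^sup>2 * (u x)\<^sup>2 + 2 * a * b * (u x * v x) + b\<^sup>2 * (v x)\<^sup>2) = (\<lambda>x. (a * u x + b * v x)\<^sup>2)"
    by (auto simp: power2_sum power_mult_distrib)
  ultimately show ?thesis by (simp add: L2fun_def)
qed

lemma L2fun_sum:
  assumes "\<And>i. i \<in> I \<Longrightarrow> u i \<in> L2fun M"
  shows "(\<lambda>x. \<Sum>i\<in>I. c i * u i x) \<in> L2fun M"
  using assms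
proof (induction I rule: infinite_finite_induct)
  case (insert i I)
  then show ?case using L2fun_linear[of "u i" M "\<lambda>x. \<Sum>i\<in>I. c i * u i x" "c i" 1] by simp
qed (simp_all add: L2fun_def)

lemma ip_commute: "ip M u v = ip M v u"
  by (simp add: ip_def mult.commute)

lemma ip_sum_left:
  assumes "\<And>i. i \<in> I \<Longrightarrow> u i \<in> L2fun M" "v \<in> L2fun M"
  shows "ip M (\<lambda>x. \<Sum>i\<in>I. c i * u i x) v = (\<Sum>i\<in>I. c i * ip M (u i) v)"
proof -
  have "ip M (\<lambda>x. \<Sum>i\<in>I. c i * u i x) v = (LINT x|M. (\<Sum>i\<in>I. c i * (u i x * v x)))"
    unfolding ip_def by (simp add: sum_distrib_right mult.assoc)
  also have "\<dots> = (\<Sum>i\<in>I. c i * ip M (u i) v)"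
    unfolding ip_def using L2fun_mult_integrable[OF assms(1) assms(2)]
    by (subst Bochner_Integration.integral_sum) auto
  finally show ?thesis .
qed

lemma ip_linear_left:
  assumes "u \<in> L2fun M" "v \<in> L2fun M" "w \<in> L2fun M"
  shows "ip M (\<lambda>x. a * u x + b * v x) w = a * ip M u w + b * ip M v w"
proof -
  have "ip M (\<lambda>x. a * u x + b * v x) w = (LINT x|M. a * (u x * w x) + b * (v x * w x))"
    unfolding ip_def by (simp add: distrib_right mult.assoc)
  also have "\<dots> = a * ip M u w + b * ip M v w"
    unfolding ip_def using L2fun_mult_integrable[OF assms(1,3)] L2fun_mult_integrable[OF assms(2,3)]
    by (subst Bochner_Integration.integral_add) auto
  finally show ?thesis .
qed

lemma bessel:
  assumes \<psi>: "\<And>i. i \<in> I \<Longrightarrow> \<psi> i \<in> L2fun M" and "finite I"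
    and on: "\<And>i j. i \<in> I \<Longrightarrow> j \<in> I \<Longrightarrow> ip M (\<psi> i) (\<psi> j) = (if i = j then 1 else 0)"
    and h: "h \<in> L2fun M"
  shows "(\<Sum>i\<in>I. (ip M h (\<psi> i))\<^sup>2) \<le> ip M h h"
proof -
  define c where "c i = ip M h (\<psi> i)" for i
  let ?s = "\<lambda>x. \<Sum>i\<in>I. c i * \<psi> i x"
  have s: "?s \<in> L2fun M" by (rule L2fun_sum[OF \<psi>])
  have g: "(\<lambda>x. 1 * h x + (-1) * ?s x) \<in> L2fun M" by (rule L2fun_linear[OF h s])
  have sh: "ip M ?s h = (\<Sum>i\<in>I. (c i)\<^sup>2)"
    using ip_sum_left[of I \<psi> M h c, OF \<psi> h] by (simp add: c_def ip_commute[of M _ h] power2_eq_square)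
  have ss: "ip M ?s ?s = (\<Sum>i\<in>I. (c i)\<^sup>2)"
  proof -
    have "ip M (\<psi> i) ?s = c i" if i: "i \<in> I" for i
    proof -
      have "ip M (\<psi> i) ?s = (\<Sum>j\<in>I. c j * ip M (\<psi> j) (\<psi> i))"
        by (subst ip_commute, rule ip_sum_left) (use \<psi> i in auto)
      also have "\<dots> = (\<Sum>j\<in>I. if j = i then c j else 0)" by (intro sum.cong) (auto simp: on i)
      finally show ?thesis using i assms(2) by simp
    qed
    then show ?thesis using ip_sum_left[of I \<psi> M ?s c, OF \<psi> s] by (simp add: power2_eq_square)
  qed
  have "0 \<le> ip M (\<lambda>x. 1 * h x + (-1) * ?s x) (\<lambda>x. 1 * h x + (-1) * ?s x)"
    unfolding ip_def by (intro integral_nonneg_AE) auto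
  also have "\<dots> = ip M h (\<lambda>x. 1 * h x + (-1) * ?s x) - ip M ?s (\<lambda>x. 1 * h x + (-1) * ?s x)"
    using ip_linear_left[OF h s g, of 1 "-1"] by simp
  also have "ip M h (\<lambda>x. 1 * h x + (-1) * ?s x) = ip M h h - ip M ?s h"
    using ip_linear_left[OF h s h, of 1 "-1"] by (subst ip_commute) simp
  also have "ip M ?s (\<lambda>x. 1 * h x + (-1) * ?s x) = ip M ?s h - ip M ?s ?s"
    using ip_linear_left[OF h s s, of 1 "-1"] by (subst ip_commute) (simp add: ip_commute)
  finally have "(\<Sum>i\<in>I. (c i)\<^sup>2) \<le> ip M h h" using sh ss by linarith
  then show ?thesis by (simp add: c_def)
qed

text \<open>The result is given by coefficients so that the orthonormal functions remain explicit
  combinations of the given ones. Later these are eigenfunctions, and the form is evaluated term by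
  term.\<close>

lemma gram_schmidt_L2:
  fixes \<phi> :: "nat \<Rightarrow> 'a \<Rightarrow> real"
  assumes "\<And>i. i < n \<Longrightarrow> \<phi> i \<in> L2fun M"
    and "\<And>c. (AE x in M. (\<Sum>i<n. c i * \<phi> i x) = 0) \<Longrightarrow> (\<forall>i<n. c i = 0)"
  shows "\<exists>c. \<forall>i<n. \<forall>j<n. ip M (\<lambda>x. \<Sum>l<n. c i l * \<phi> l x) (\<lambda>x. \<Sum>l<n. c j l * \<phi> l x) = (if i = j then 1 else 0)"
  using assms
proof (induction n)
  case (Suc n)
  have indep: "\<forall>i<n. c i = 0" if "AE x in M. (\<Sum>i<n. c i * \<phi> i x) = 0" for c
  proof -
    have "AE x in M. (\<Sum>i<Suc n. (if i < n then c i else 0) * \<phi> i x) = 0"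
      using that by simp
    from Suc.prems(2)[OF this] show ?thesis by (metis less_SucI)
  qed
  from Suc.IH[OF Suc.prems(1) indep] obtain c where
    c: "\<And>i j. i < n \<Longrightarrow> j < n \<Longrightarrow> ip M (\<lambda>x. \<Sum>l<n. c i l * \<phi> l x) (\<lambda>x. \<Sum>l<n. c j l * \<phi> l x) = (if i = j then 1 else 0)"
    by auto
  define \<psi> where "\<psi> i = (\<lambda>x. \<Sum>l<n. c i l * \<phi> l x)" for i
  have \<psi>: "\<psi> i \<in> L2fun M" for i unfolding \<psi>_def using Suc.prems(1) by (intro L2fun_sum) auto
  have on: "ip M (\<psi> i) (\<psi> j) = (if i = j then 1 else 0)" if "i < n" "j < n" for i j
    using c[OF that] by (simp add: \<psi>_def)
  have \<phi>n: "\<phi> n \<in> L2fun M" using Suc.prems(1) by simp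
  define d where "d i = ip M (\<phi> n) (\<psi> i)" for i
  let ?s = "\<lambda>x. \<Sum>i<n. d i * \<psi> i x"
  define g where "g = (\<lambda>x. 1 * \<phi> n x + (-1) * ?s x)"
  have s: "?s \<in> L2fun M" by (rule L2fun_sum[OF \<psi>])
  have g: "g \<in> L2fun M" unfolding g_def by (rule L2fun_linear[OF \<phi>n s])
  have g\<psi>: "ip M g (\<psi> j) = 0" if j: "j < n" for j
  proof -
    have "ip M ?s (\<psi> j) = (\<Sum>i<n. d i * ip M (\<psi> i) (\<psi> j))" by (rule ip_sum_left) (auto simp: \<psi>)
    also have "\<dots> = (\<Sum>i<n. if i = j then d i else 0)" by (intro sum.cong) (auto simp: on j)
    finally have "ip M ?s (\<psi> j) = d j" using j by simp
    then show ?thesis unfolding g_def using ip_linear_left[OF \<phi>n s \<psi>, of 1 "-1" j] by (simp add: d_def)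
  qed
  \<comment> \<open>Coefficients, in terms of the original functions, of the part of
    \<open>\<phi> n\<close> orthogonal to the earlier ones. The coefficient at n is 1.\<close>
  define e where "e l = (if l = n then 1 else - (\<Sum>i<n. d i * c i l))" for l
  have g_sum: "g x = (\<Sum>l<Suc n. e l * \<phi> l x)" for x
  proof -
    have "?s x = (\<Sum>l<n. (\<Sum>i<n. d i * c i l) * \<phi> l x)"
      unfolding \<psi>_def sum_distrib_left sum_distrib_right by (subst sum.swap) (simp add: mult.assoc)
    then show ?thesis by (simp add: g_def e_def sum_negf)
  qed
  define S where "S = ip M g g"
  \<comment> \<open>A zero norm would be an almost-everywhere linear relation with coefficient 1 at
    \<open>\<phi> n\<close>.\<close>
  have S: "S > 0"
  proof (rule ccontr)
    assume "\<not> S > 0"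
    moreover have "S \<ge> 0" unfolding S_def ip_def by (intro integral_nonneg_AE) auto
    ultimately have "S = 0" by linarith
    then have "(LINT x|M. g x * g x) = 0" unfolding S_def ip_def .
    then have "AE x in M. g x * g x = 0"
      using L2fun_mult_integrable[OF g g] by (subst (asm) integral_nonneg_eq_0_iff_AE) auto
    then have "AE x in M. (\<Sum>l<Suc n. e l * \<phi> l x) = 0" by (simp only: g_sum mult_eq_0_iff disj_absorb)
    from Suc.prems(2)[OF this] have "e n = 0" by blast
    then show False by (simp add: e_def)
  qed
  define c' where "c' i l = (if i < n then (if l < n then c i l else 0) else e l / sqrt S)" for i l
  have c'1: "(\<lambda>x. \<Sum>l<Suc n. c' i l * \<phi> l x) = \<psi> i" if "i < n" for i
    using that by (auto simp: c'_def \<psi>_def)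
  have c'2: "(\<lambda>x. \<Sum>l<Suc n. c' n l * \<phi> l x) = (\<lambda>x. g x / sqrt S)"
    by (auto simp: c'_def g_sum sum_divide_distrib simp del: sum.lessThan_Suc)
  have div: "ip M (\<lambda>x. g x / r) v = ip M g v / r" for r v
    unfolding ip_def by simp
  have n1: "ip M (\<lambda>x. g x / sqrt S) (\<lambda>x. g x / sqrt S) = 1"
  proof -
    have "ip M (\<lambda>x. g x / sqrt S) (\<lambda>x. g x / sqrt S) = ip M g g / sqrt S / sqrt S"
      unfolding div by (subst ip_commute) (simp only: div)
    then show ?thesis using S by (simp add: S_def[symmetric])
  qed
  have n2: "ip M (\<lambda>x. g x / sqrt S) (\<psi> j) = 0" if "j < n" for j unfolding div g\<psi>[OF that] by simp
  show ?case
  proof (intro exI[of _ c'] allI impI)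
    fix i j assume "i < Suc n" "j < Suc n"
    then consider "i < n" "j < n" | "i < n" "j = n" | "i = n" "j < n" | "i = n" "j = n" by linarith
    then show "ip M (\<lambda>x. \<Sum>l<Suc n. c' i l * \<phi> l x) (\<lambda>x. \<Sum>l<Suc n. c' j l * \<phi> l x) = (if i = j then 1 else 0)"
    proof cases
      case 1
      then show ?thesis unfolding c'1[OF 1(1)] c'1[OF 1(2)] by (rule on)
    next
      case 2
      then show ?thesis unfolding c'1[OF 2(1)] 2(2) c'2 using n2[OF 2(1)] by (simp add: ip_commute)
    next
      case 3
      then show ?thesis unfolding c'1[OF 3(2)] 3(1) c'2 using n2[OF 3(2)] by simp
    next
      case 4
      then show ?thesis unfolding 4 c'2 using n1 by simp
    qed
  qed
qed simp

section \<open>Eigenfunctions and the energy bound\<close>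

lemma bounded_domain_subset_open_box:
  assumes "bounded_domain N \<Omega>"
  obtains R where "\<Omega> \<subseteq> open_box N R"
proof -
  from assms obtain r where r: "\<And>x. x \<in> \<Omega> \<Longrightarrow> RN_norm N x \<le> r" by (auto simp: bounded_domain_def)
  have "\<Omega> \<subseteq> topspace (RN_top N)" using assms openin_subset by (auto simp: bounded_domain_def)
  then have s: "x \<in> {..<N} \<rightarrow>\<^sub>E UNIV" if "x \<in> \<Omega>" for x using that by (auto simp: topspace_RN)
  have "\<Omega> \<subseteq> open_box N (r + 1)"
  proof
    fix x assume x: "x \<in> \<Omega>"
    have "x i \<in> {- (r + 1)<..<r + 1}" if "i < N" for i
      using abs_component_le_RN_norm[OF that, of x] r[OF x] by auto
    then show "x \<in> open_box N (r + 1)" using s[OF x] by (auto simp: open_box_def PiE_def)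
  qed
  then show ?thesis by (rule that)
qed

lemma Hfin_L2fun: "u \<in> Hfin m N R \<Longrightarrow> u \<in> L2fun (RN_leb N)"
  using HfinD(1,2) by (auto simp: L2fun_def)

lemma eigenspaceD:
  assumes "\<phi> \<in> eigenspace m N \<Omega> \<mu>"
  shows "\<phi> \<in> Hm0 m N \<Omega>" "x \<notin> \<Omega> \<Longrightarrow> \<phi> x = 0"
    "v \<in> Hm0 m N \<Omega> \<Longrightarrow> log_form m N \<phi> v = of_real (\<mu> * ip (RN_leb N) \<phi> v)"
proof -
  show \<phi>: "\<phi> \<in> Hm0 m N \<Omega>" using assms by (simp add: eigenspace_def)
  then have 0: "x \<notin> \<Omega> \<Longrightarrow> \<phi> x = 0" for x by (simp add: Hm0_def)
  then show "x \<notin> \<Omega> \<Longrightarrow> \<phi> x = 0" by simp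
  assume "v \<in> Hm0 m N \<Omega>"
  then have "log_form m N \<phi> v = of_real (\<mu> * (LINT x:\<Omega>|RN_leb N. \<phi> x * v x))"
    using assms by (simp add: eigenspace_def)
  also have "(LINT x:\<Omega>|RN_leb N. \<phi> x * v x) = ip (RN_leb N) \<phi> v"
    unfolding set_lebesgue_integral_def ip_def using 0
    by (intro Bochner_Integration.integral_cong) (auto simp: indicator_def)
  finally show "log_form m N \<phi> v = of_real (\<mu> * ip (RN_leb N) \<phi> v)" .
qed

text \<open>The eigenvalue equation may be tested only against members of
  \<open>Hm0 m N \<Omega>\<close>, and combinations are known to lie only in
  \<open>Hfin m N R\<close>. Hence both arguments are expanded and the equation is used for single
  pairs; the second argument is expanded through Hermitian symmetry.\<close>

lemma log_form_span:
  assumes N: "N \<ge> 1" and m: "m \<ge> 1" and \<Omega>: "\<Omega> \<subseteq> open_box N R"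
    and \<phi>: "\<And>l. l < n \<Longrightarrow> \<phi> l \<in> eigenspace m N \<Omega> \<mu>"
    and \<phi>': "\<And>l. l < n' \<Longrightarrow> \<phi>' l \<in> eigenspace m N \<Omega> \<mu>'"
  shows "log_form m N (\<lambda>x. \<Sum>l<n. c l * \<phi> l x) (\<lambda>x. \<Sum>l<n'. c' l * \<phi>' l x) =
    of_real (\<mu> * ip (RN_leb N) (\<lambda>x. \<Sum>l<n. c l * \<phi> l x) (\<lambda>x. \<Sum>l<n'. c' l * \<phi>' l x))"
proof -
  let ?v = "\<lambda>x. \<Sum>l<n'. c' l * \<phi>' l x"
  have H: "\<phi> l \<in> Hfin m N R" if "l < n" for l
    using eigenspaceD(1)[OF \<phi>[OF that]] Hm0_subset_Hfin[OF m \<Omega>] by auto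
  have H': "\<phi>' l \<in> Hfin m N R" if "l < n'" for l
    using eigenspaceD(1)[OF \<phi>'[OF that]] Hm0_subset_Hfin[OF m \<Omega>] by auto
  have v: "?v \<in> Hfin m N R" using H' by (intro Hfin_sum) auto
  have *: "log_form m N (\<phi> l) ?v = of_real (\<mu> * ip (RN_leb N) (\<phi> l) ?v)" if l: "l < n" for l
  proof -
    have "log_form m N ?v (\<phi> l) = (\<Sum>k<n'. of_real (c' k) * log_form m N (\<phi>' k) (\<phi> l))"
      by (rule log_form_sum[OF _ H[OF l] N m]) (simp add: H')
    also have "\<dots> = (\<Sum>k<n'. of_real (c' k * (\<mu> * ip (RN_leb N) (\<phi> l) (\<phi>' k))))"
    proof (intro sum.cong refl)
      fix k assume "k \<in> {..<n'}"
      then have "log_form m N (\<phi> l) (\<phi>' k) = of_real (\<mu> * ip (RN_leb N) (\<phi> l) (\<phi>' k))"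
        using eigenspaceD(3)[OF \<phi>[OF l] eigenspaceD(1)[OF \<phi>']] by auto
      then have "log_form m N (\<phi>' k) (\<phi> l) = of_real (\<mu> * ip (RN_leb N) (\<phi> l) (\<phi>' k))"
        by (subst log_form_cnj) (simp only: complex_cnj_complex_of_real)
      then show "of_real (c' k) * log_form m N (\<phi>' k) (\<phi> l) = of_real (c' k * (\<mu> * ip (RN_leb N) (\<phi> l) (\<phi>' k)))"
        by (simp only: of_real_mult)
    qed
    also have "\<dots> = of_real (\<mu> * (\<Sum>k<n'. c' k * ip (RN_leb N) (\<phi>' k) (\<phi> l)))"
      unfolding of_real_sum[symmetric] sum_distrib_left
      by (intro arg_cong[where f = of_real] sum.cong refl) (simp add: ip_commute[of _ "\<phi> l"])
    also have "(\<Sum>k<n'. c' k * ip (RN_leb N) (\<phi>' k) (\<phi> l)) = ip (RN_leb N) (\<phi> l) ?v"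
      using ip_sum_left[of "{..<n'}" \<phi>' "RN_leb N" "\<phi> l" c'] Hfin_L2fun[OF H'] Hfin_L2fun[OF H[OF l]]
      by (simp add: ip_commute[of _ "\<phi> l"])
    finally have "log_form m N ?v (\<phi> l) = of_real (\<mu> * ip (RN_leb N) (\<phi> l) ?v)" .
    then show ?thesis by (subst log_form_cnj) (simp only: complex_cnj_complex_of_real)
  qed
  have "log_form m N (\<lambda>x. \<Sum>l<n. c l * \<phi> l x) ?v = (\<Sum>l<n. of_real (c l) * log_form m N (\<phi> l) ?v)"
    by (rule log_form_sum[OF _ v N m]) (simp add: H)
  also have "\<dots> = (\<Sum>l<n. of_real (\<mu> * (c l * ip (RN_leb N) (\<phi> l) ?v)))"
    by (intro sum.cong refl) (simp add: * del: of_real_mult add: of_real_mult[symmetric] mult.left_commute)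
  also have "\<dots> = of_real (\<mu> * (\<Sum>l<n. c l * ip (RN_leb N) (\<phi> l) ?v))"
    unfolding of_real_sum[symmetric] sum_distrib_left ..
  also have "(\<Sum>l<n. c l * ip (RN_leb N) (\<phi> l) ?v) = ip (RN_leb N) (\<lambda>x. \<Sum>l<n. c l * \<phi> l x) ?v"
    by (rule ip_sum_left[symmetric]) (use Hfin_L2fun[OF H] Hfin_L2fun[OF v] in auto)
  finally show ?thesis .
qed

text \<open>Each eigenspace is orthonormalised separately, and index j receives the member of the
  basis for \<open>lam j\<close> that its rank among equal eigenvalues selects. Different
  eigenspaces are orthogonal because the form is symmetric.\<close>

lemma orthonormal_eigenfunctions:
  assumes N: "N \<ge> 1" and m: "m \<ge> 1" and \<Omega>: "\<Omega> \<subseteq> open_box N R"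
    and ev: "dirichlet_eigenvalues m N \<Omega> lam"
  obtains \<psi> where "\<And>j::nat. j \<ge> 1 \<Longrightarrow> \<psi> j \<in> Hfin m N R"
    "\<And>j x. j \<ge> 1 \<Longrightarrow> x \<notin> \<Omega> \<Longrightarrow> \<psi> j x = 0"
    "\<And>i j. i \<ge> 1 \<Longrightarrow> j \<ge> 1 \<Longrightarrow> ip (RN_leb N) (\<psi> i) (\<psi> j) = (if i = j then 1 else 0)"
    "\<And>j. j \<ge> 1 \<Longrightarrow> log_form m N (\<psi> j) (\<psi> j) = of_real (lam j)"
proof -
  define S where "S \<mu> = {j. 1 \<le> j \<and> lam j = \<mu>}" for \<mu>
  define n where "n \<mu> = card (S \<mu>)" for \<mu>
  have fin: "finite (S \<mu>)" and dim: "has_dim_ae N (eigenspace m N \<Omega> \<mu>) (n \<mu>)" for \<mu>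
    using ev by (auto simp: dirichlet_eigenvalues_def S_def n_def)
  have H: "\<phi> \<in> Hfin m N R" if "\<phi> \<in> eigenspace m N \<Omega> \<mu>" for \<phi> \<mu>
    using eigenspaceD(1)[OF that] Hm0_subset_Hfin[OF m \<Omega>] by auto
  \<comment> \<open>Bases are chosen for all real numbers at once; for one that is not an eigenvalue
    \<open>n \<mu> = 0\<close> and the condition is vacuous.\<close>
  define Q where "Q \<mu> \<phi> c \<longleftrightarrow> (\<forall>l<n \<mu>. \<phi> l \<in> eigenspace m N \<Omega> \<mu>) \<and>
     (\<forall>i<n \<mu>. \<forall>j<n \<mu>. ip (RN_leb N) (\<lambda>x. \<Sum>l<n \<mu>. c i l * \<phi> l x) (\<lambda>x. \<Sum>l<n \<mu>. c j l * \<phi> l x) = (if i = j then 1 else 0))"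
    for \<mu> \<phi> and c :: "nat \<Rightarrow> nat \<Rightarrow> real"
  have "\<exists>\<phi> c. Q \<mu> \<phi> c" for \<mu>
  proof -
    from dim[of \<mu>] obtain \<phi> where \<phi>: "\<forall>i<n \<mu>. \<phi> i \<in> eigenspace m N \<Omega> \<mu>" "indep_ae N (n \<mu>) \<phi>"
      by (auto simp: has_dim_ae_def)
    have "\<exists>c. \<forall>i<n \<mu>. \<forall>j<n \<mu>. ip (RN_leb N) (\<lambda>x. \<Sum>l<n \<mu>. c i l * \<phi> l x) (\<lambda>x. \<Sum>l<n \<mu>. c j l * \<phi> l x) = (if i = j then 1 else 0)"
      by (rule gram_schmidt_L2) (use \<phi> Hfin_L2fun[OF H] in \<open>auto simp: indep_ae_def\<close>)
    with \<phi>(1) show ?thesis unfolding Q_def by blast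
  qed
  then obtain \<phi> where "\<forall>\<mu>. \<exists>c. Q \<mu> (\<phi> \<mu>) c"
    using choice[of "\<lambda>\<mu> \<phi>. \<exists>c. Q \<mu> \<phi> c"] by blast
  then obtain c where "\<forall>\<mu>. Q \<mu> (\<phi> \<mu>) (c \<mu>)"
    using choice[of "\<lambda>\<mu> c. Q \<mu> (\<phi> \<mu>) c"] by blast
  then have \<phi>: "\<And>\<mu> l. l < n \<mu> \<Longrightarrow> \<phi> \<mu> l \<in> eigenspace m N \<Omega> \<mu>"
    and on: "\<And>\<mu> i j. i < n \<mu> \<Longrightarrow> j < n \<mu> \<Longrightarrow>
      ip (RN_leb N) (\<lambda>x. \<Sum>l<n \<mu>. c \<mu> i l * \<phi> \<mu> l x) (\<lambda>x. \<Sum>l<n \<mu>. c \<mu> j l * \<phi> \<mu> l x) = (if i = j then 1 else 0)"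
    unfolding Q_def by blast+
  define \<Psi> where "\<Psi> \<mu> i = (\<lambda>x. \<Sum>l<n \<mu>. c \<mu> i l * \<phi> \<mu> l x)" for \<mu> i
  \<comment> \<open>Zero-based rank of j among the indices carrying the same eigenvalue; it is
    injective there and stays below the multiplicity.\<close>
  define r where "r j = card {i \<in> S (lam j). i < j}" for j
  define \<psi> where "\<psi> j = \<Psi> (lam j) (r j)" for j
  have r_less: "r i < r j" if "i \<in> S (lam j)" "i < j" "lam i = lam j" for i j
  proof -
    have "{l \<in> S (lam i). l < i} \<subset> {l \<in> S (lam j). l < j}" using that by auto
    then show ?thesis unfolding r_def using fin by (intro psubset_card_mono) auto
  qed
  have r_n: "r j < n (lam j)" if "j \<ge> 1" for j
  proof -
    have "{i \<in> S (lam j). i < j} \<subset> S (lam j)" using that by (auto simp: S_def)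
    then show ?thesis unfolding r_def n_def by (intro psubset_card_mono fin)
  qed
  have lf: "log_form m N (\<psi> i) (\<psi> j) = of_real (lam i * ip (RN_leb N) (\<psi> i) (\<psi> j))" for i j
    unfolding \<psi>_def \<Psi>_def by (rule log_form_span[OF N m \<Omega>]) (auto intro: \<phi>)
  have on': "ip (RN_leb N) (\<psi> i) (\<psi> j) = (if i = j then 1 else 0)" if ij: "i \<ge> 1" "j \<ge> 1" for i j
  proof (cases "lam i = lam j")
    case True
    have "r i < r j" if "i < j" by (rule r_less) (use that True ij in \<open>auto simp: S_def\<close>)
    moreover have "r j < r i" if "j < i" by (rule r_less) (use that True ij in \<open>auto simp: S_def\<close>)
    ultimately have "r i = r j \<longleftrightarrow> i = j" by (metis less_irrefl nat_neq_iff)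
    moreover have "ip (RN_leb N) (\<psi> i) (\<psi> j) = (if r i = r j then 1 else 0)"
      unfolding \<psi>_def \<Psi>_def True using r_n[OF ij(1)] r_n[OF ij(2)] True by (intro on) auto
    ultimately show ?thesis by simp
  next
    case False
    \<comment> \<open>Evaluating the form from either side shows that the inner product is
      multiplied equally by two different eigenvalues, so it is 0.\<close>
    have "log_form m N (\<psi> i) (\<psi> j) = cnj (log_form m N (\<psi> j) (\<psi> i))" by (rule log_form_cnj)
    then have "complex_of_real (lam i * ip (RN_leb N) (\<psi> i) (\<psi> j)) = of_real (lam j * ip (RN_leb N) (\<psi> j) (\<psi> i))"
      unfolding lf complex_cnj_complex_of_real .
    then have "lam i * ip (RN_leb N) (\<psi> i) (\<psi> j) = lam j * ip (RN_leb N) (\<psi> i) (\<psi> j)"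
      by (simp only: of_real_eq_iff ip_commute[of _ "\<psi> j" "\<psi> i"])
    then show ?thesis using False by auto
  qed
  show ?thesis
  proof (rule that)
    show "\<psi> j \<in> Hfin m N R" for j
      unfolding \<psi>_def \<Psi>_def by (rule Hfin_sum) (auto intro: H \<phi>)
    show "\<psi> j x = 0" if "x \<notin> \<Omega>" for j x
      unfolding \<psi>_def \<Psi>_def using eigenspaceD(2)[OF \<phi> that] by (intro sum.neutral) auto
    show "ip (RN_leb N) (\<psi> i) (\<psi> j) = (if i = j then 1 else 0)" if "i \<ge> 1" "j \<ge> 1" for i j
      by (rule on'[OF that])
    show "log_form m N (\<psi> j) (\<psi> j) = of_real (lam j)" if "j \<ge> 1" for j
      using lf[of j j] on'[OF that that] by simp
  qed
qed

text \<open>Bessel's inequality in the real space, applied separately to the cosine and the sine of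
  \<xi> . x cut off to the domain. Their squared norms add up to its volume because the squares add
  up to 1 there.\<close>

lemma sum_fourier_sq_le:
  assumes \<psi>: "\<And>j. j \<in> J \<Longrightarrow> \<psi> j \<in> Hfin m N R" and "finite J"
    and supp: "\<And>j x. j \<in> J \<Longrightarrow> x \<notin> \<Omega> \<Longrightarrow> \<psi> j x = 0"
    and on: "\<And>i j. i \<in> J \<Longrightarrow> j \<in> J \<Longrightarrow> ip (RN_leb N) (\<psi> i) (\<psi> j) = (if i = j then 1 else 0)"
    and \<Omega>: "openin (RN_top N) \<Omega>" "\<Omega> \<subseteq> open_box N R" and \<xi>: "\<xi> \<in> space (RN_leb N)"
  shows "(\<Sum>j\<in>J. (cmod (fourier N (\<psi> j) \<xi>))\<^sup>2) \<le> measure (RN_leb N) \<Omega>"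
proof -
  let ?M = "RN_leb N"
  note [measurable] = openin_RN_sets[OF \<Omega>(1)]
  note \<xi>[simp]
  have "emeasure ?M \<Omega> \<le> emeasure ?M (open_box N R)"
    using \<Omega>(2) openin_RN_sets[OF openin_open_box] by (intro emeasure_mono) auto
  then have fin: "emeasure ?M \<Omega> < \<infinity>" using emeasure_open_box[of N R] by (auto intro: le_less_trans)
  have i\<Omega>: "integrable ?M (\<lambda>x. indicator \<Omega> x :: real)" using fin by (intro integrable_real_indicator) auto
  define C where "C = (\<lambda>x. indicator \<Omega> x * cos (RN_dot N \<xi> x))"
  define S where "S = (\<lambda>x. indicator \<Omega> x * sin (RN_dot N \<xi> x))"
  have [measurable]: "C \<in> borel_measurable ?M" "S \<in> borel_measurable ?M"
    unfolding C_def S_def by measurable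
  have i: "integrable ?M (\<lambda>x. (C x)\<^sup>2)" "integrable ?M (\<lambda>x. (S x)\<^sup>2)"
    by (rule Bochner_Integration.integrable_bound[OF i\<Omega>];
        force simp: C_def S_def indicator_def power_le_one_iff abs_square_le_1 intro!: AE_I2)+
  then have CS: "C \<in> L2fun ?M" "S \<in> L2fun ?M" by (auto simp: L2fun_def)
  have f: "(cmod (fourier N (\<psi> j) \<xi>))\<^sup>2 = (ip ?M C (\<psi> j))\<^sup>2 + (ip ?M S (\<psi> j))\<^sup>2" if j: "j \<in> J" for j
  proof -
    have ic: "integrable ?M (\<lambda>x. C x * \<psi> j x)" "integrable ?M (\<lambda>x. S x * \<psi> j x)"
      using CS Hfin_L2fun[OF \<psi>[OF j]] by (auto intro: L2fun_mult_integrable)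
    have "fourier N (\<psi> j) \<xi> = (LINT x|?M. complex_of_real (C x * \<psi> j x) - \<i> * complex_of_real (S x * \<psi> j x))"
      unfolding fourier_def
    proof (intro Bochner_Integration.integral_cong refl)
      fix x
      have e: "exp (- (\<i> * complex_of_real t)) = of_real (cos t) - \<i> * of_real (sin t)" for t
        using cis_conv_exp[of "- t"] by (simp add: complex_eq_iff cis.simps)
      show "exp (- (\<i> * of_real (RN_dot N \<xi> x))) * of_real (\<psi> j x) = complex_of_real (C x * \<psi> j x) - \<i> * complex_of_real (S x * \<psi> j x)"
        unfolding e using supp[OF j, of x] by (cases "x \<in> \<Omega>") (auto simp: C_def S_def algebra_simps)
    qed
    also have "\<dots> = of_real (ip ?M C (\<psi> j)) - \<i> * of_real (ip ?M S (\<psi> j))"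
      unfolding ip_def using ic by (subst Bochner_Integration.integral_diff) (auto simp: integral_complex_of_real simp del: of_real_mult)
    finally show ?thesis by (simp add: cmod_power2)
  qed
  have "(\<Sum>j\<in>J. (cmod (fourier N (\<psi> j) \<xi>))\<^sup>2) = (\<Sum>j\<in>J. (ip ?M C (\<psi> j))\<^sup>2) + (\<Sum>j\<in>J. (ip ?M S (\<psi> j))\<^sup>2)"
    by (simp add: f sum.distrib)
  also have "\<dots> \<le> ip ?M C C + ip ?M S S"
    by (intro add_mono bessel[OF Hfin_L2fun[OF \<psi>] assms(2) on CS(1)] bessel[OF Hfin_L2fun[OF \<psi>] assms(2) on CS(2)]) auto
  also have "\<dots> = (LINT x|?M. (C x)\<^sup>2 + (S x)\<^sup>2)"
    using i by (simp add: ip_def power2_eq_square)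
  also have "\<dots> = (LINT x|?M. indicator \<Omega> x)"
    by (intro Bochner_Integration.integral_cong) (auto simp: C_def S_def indicator_def)
  also have "\<dots> = measure ?M \<Omega>"
    using sets.sets_into_space[OF openin_RN_sets[OF \<Omega>(1)]] by (simp add: Int_absorb2)
  finally show ?thesis .
qed

text \<open>
  In the variable \<open>s = \<bar>\<xi>\<bar>\<^sup>N\<close> the symbol becomes \<open>(2 / N)\<^sup>m (ln s)\<^sup>m\<close>, so that the dimension enters only
  through constants.
\<close>

lemma eigenvalue_sum_bound:
  assumes N: "N \<ge> 1" and m: "m \<ge> 1" and \<Omega>: "bounded_domain N \<Omega>"
    and ev: "dirichlet_eigenvalues m N \<Omega> lam" and A: "A \<ge> 0"
    and P: "A ^ m = (real N / 2) ^ m * (lam k + P)" and k: "k \<ge> 1"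
  shows "(2 * pi) ^ N * real k * ((real N / 2) ^ m * P) \<le>
    measure (RN_leb N) \<Omega> * (unit_ball_vol (real N) * (real m * (A ^ (m - 1) * exp A) + 2 * (2 * real m) ^ m))"
proof -
  let ?M = "RN_leb N" and ?V = "measure (RN_leb N) \<Omega>"
  obtain R where R: "\<Omega> \<subseteq> open_box N R" using bounded_domain_subset_open_box[OF \<Omega>] by blast
  have op: "openin (RN_top N) \<Omega>" using \<Omega> by (simp add: bounded_domain_def)
  obtain \<psi> where \<psi>: "\<And>j::nat. j \<ge> 1 \<Longrightarrow> \<psi> j \<in> Hfin m N R"
    "\<And>j x. j \<ge> 1 \<Longrightarrow> x \<notin> \<Omega> \<Longrightarrow> \<psi> j x = 0"
    "\<And>i j. i \<ge> 1 \<Longrightarrow> j \<ge> 1 \<Longrightarrow> ip ?M (\<psi> i) (\<psi> j) = (if i = j then 1 else 0)"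
    "\<And>j. j \<ge> 1 \<Longrightarrow> log_form m N (\<psi> j) (\<psi> j) = of_real (lam j)"
    by (rule orthonormal_eigenfunctions[OF N m R ev]) blast
  define F where "F \<xi> = (\<Sum>j=1..k. (cmod (fourier N (\<psi> j) \<xi>))\<^sup>2)" for \<xi>
  have F0: "F \<xi> \<ge> 0" for \<xi> unfolding F_def by (intro sum_nonneg) auto
  have FV: "F \<xi> \<le> ?V" if "\<xi> \<in> space ?M" for \<xi>
    unfolding F_def by (rule sum_fourier_sq_le[where m = m, OF _ _ _ _ op R that]) (simp_all add: \<psi>)
  let ?w = "\<lambda>\<xi>. (2 * ln (RN_norm N \<xi>)) ^ m"
  have mass: "integrable ?M (\<lambda>\<xi>. (cmod (fourier N (\<psi> j) \<xi>))\<^sup>2)" "(LINT \<xi>|?M. (cmod (fourier N (\<psi> j) \<xi>))\<^sup>2) = (2 * pi) ^ N" if j: "j \<ge> 1" for j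
  proof -
    note H = HfinD[OF \<psi>(1)[OF j]]
    note [measurable] = H(1)
    have "(LINT x|?M. (\<psi> j x)\<^sup>2) = 1" using \<psi>(3)[OF j j] by (simp add: ip_def power2_eq_square)
    then have *: "(\<integral>\<^sup>+\<xi>. ennreal ((cmod (fourier N (\<psi> j) \<xi>))\<^sup>2) \<partial>?M) = ennreal ((2 * pi) ^ N)"
      using plancherel[OF H(5) H(2) H(3)] by simp
    show "integrable ?M (\<lambda>\<xi>. (cmod (fourier N (\<psi> j) \<xi>))\<^sup>2)"
      by (rule integrableI_nonneg) (auto simp: *)
    show "(LINT \<xi>|?M. (cmod (fourier N (\<psi> j) \<xi>))\<^sup>2) = (2 * pi) ^ N"
      by (subst integral_eq_nn_integral) (auto simp: *)
  qed
  have energy: "integrable ?M (\<lambda>\<xi>. ?w \<xi> * (cmod (fourier N (\<psi> j) \<xi>))\<^sup>2)"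
    "(LINT \<xi>|?M. ?w \<xi> * (cmod (fourier N (\<psi> j) \<xi>))\<^sup>2) = (2 * pi) ^ N * lam j" if j: "j \<ge> 1" for j
  proof -
    note lf = log_form_self[OF \<psi>(1)[OF j] N m]
    show "integrable ?M (\<lambda>\<xi>. ?w \<xi> * (cmod (fourier N (\<psi> j) \<xi>))\<^sup>2)" by (rule lf(1))
    have "1 / (2 * pi) ^ N * (LINT \<xi>|?M. ?w \<xi> * (cmod (fourier N (\<psi> j) \<xi>))\<^sup>2) = lam j"
      using lf(2) \<psi>(4)[OF j] by (simp only: of_real_eq_iff)
    then show "(LINT \<xi>|?M. ?w \<xi> * (cmod (fourier N (\<psi> j) \<xi>))\<^sup>2) = (2 * pi) ^ N * lam j"
      by (simp add: field_simps)
  qed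
  have iF: "integrable ?M F" and IF: "(LINT \<xi>|?M. F \<xi>) = (2 * pi) ^ N * real k"
    unfolding F_def using mass by (auto simp: Bochner_Integration.integral_sum)
  have wF: "?w \<xi> * F \<xi> = (\<Sum>j=1..k. ?w \<xi> * (cmod (fourier N (\<psi> j) \<xi>))\<^sup>2)" for \<xi>
    by (simp add: F_def sum_distrib_left)
  have iwF: "integrable ?M (\<lambda>\<xi>. ?w \<xi> * F \<xi>)" and IwF: "(LINT \<xi>|?M. ?w \<xi> * F \<xi>) = (2 * pi) ^ N * (\<Sum>j=1..k. lam j)"
    unfolding wF using energy by (auto simp: Bochner_Integration.integral_sum sum_distrib_left)
  \<comment> \<open>The energies of the first k eigenfunctions are replaced by k times the largest,
    which turns a bound on the sum into one on \<open>lam k\<close>.\<close>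
  have "(\<Sum>j=1..k. lam j) \<le> (\<Sum>j=1..k. lam k)"
    using ev k by (intro sum_mono) (auto simp: dirichlet_eigenvalues_def)
  then have lam: "(\<Sum>j=1..k. lam j) \<le> real k * lam k" by simp
  let ?h = "\<lambda>\<xi>. log_majorant m A (RN_norm N \<xi> ^ N)"
  have hm: "?h \<in> borel_measurable ?M" unfolding log_majorant_def by measurable
  have h0: "?h \<xi> \<ge> 0" for \<xi> by (rule log_majorant_nonneg[OF A])
  let ?B = "unit_ball_vol (real N) * (real m * (A ^ (m - 1) * exp A) + 2 * (2 * real m) ^ m)"
  have B: "?B \<ge> 0" using A by (intro mult_nonneg_nonneg add_nonneg_nonneg) auto
  have hB: "(\<integral>\<^sup>+\<xi>. ennreal (?h \<xi>) \<partial>?M) \<le> ennreal ?B" by (rule nn_integral_log_majorant[OF A m N])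
  have ih: "integrable ?M ?h"
    using hm h0 hB by (intro integrableI_nonneg) (auto intro: le_less_trans)
  have Ih: "(LINT \<xi>|?M. ?h \<xi>) \<le> ?B"
    using hm h0 hB B by (subst integral_eq_nn_integral) (auto intro: enn2real_leI)
  \<comment> \<open>The left factor of F changes sign, so F cannot be replaced by its upper bound at
    once. The nonnegative majorant is inserted first, and then F is at most the volume.\<close>
  have pt: "A ^ m * F \<xi> - (real N / 2) ^ m * (?w \<xi> * F \<xi>) \<le> ?V * ?h \<xi>" if \<xi>: "\<xi> \<in> space ?M" for \<xi>
  proof -
    have "ln (RN_norm N \<xi> ^ N) = real N * ln (RN_norm N \<xi>)"
      using N RN_norm_nonneg[of N \<xi>] by (cases "RN_norm N \<xi> = 0") (auto simp: ln_realpow less_le)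
    then have "real N / 2 * (2 * ln (RN_norm N \<xi>)) = ln (RN_norm N \<xi> ^ N)" by simp
    then have "(real N / 2) ^ m * ?w \<xi> = ln (RN_norm N \<xi> ^ N) ^ m"
      by (simp only: power_mult_distrib[symmetric])
    then have "A ^ m - (real N / 2) ^ m * ?w \<xi> \<le> ?h \<xi>"
      using diff_le_log_majorant[OF A m, of "RN_norm N \<xi> ^ N"] by simp
    then have "(A ^ m - (real N / 2) ^ m * ?w \<xi>) * F \<xi> \<le> ?h \<xi> * F \<xi>" by (intro mult_right_mono F0)
    also have "\<dots> \<le> ?h \<xi> * ?V" by (intro mult_left_mono FV \<xi> h0)
    finally show ?thesis by (simp add: algebra_simps)
  qed
  have "(2 * pi) ^ N * real k * ((real N / 2) ^ m * P) = A ^ m * ((2 * pi) ^ N * real k) - (real N / 2) ^ m * ((2 * pi) ^ N * (real k * lam k))"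
    unfolding P by (simp add: algebra_simps)
  also have "\<dots> \<le> A ^ m * ((2 * pi) ^ N * real k) - (real N / 2) ^ m * ((2 * pi) ^ N * (\<Sum>j=1..k. lam j))"
    by (intro diff_left_mono mult_left_mono lam) auto
  also have "\<dots> = (LINT \<xi>|?M. A ^ m * F \<xi> - (real N / 2) ^ m * (?w \<xi> * F \<xi>))"
    using iF iwF by (subst Bochner_Integration.integral_diff) (simp_all only: integrable_mult_right integral_mult_right_zero IF IwF)
  also have "\<dots> \<le> (LINT \<xi>|?M. ?V * ?h \<xi>)"
    using iF iwF ih by (intro integral_mono pt Bochner_Integration.integrable_diff integrable_mult_right)
  also have "\<dots> = ?V * (LINT \<xi>|?M. ?h \<xi>)" by (rule integral_mult_right_zero)
  also have "\<dots> \<le> ?V * ?B" by (intro mult_left_mono Ih) auto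
  finally show ?thesis .
qed

text \<open>The symbol is nonnegative for even m, and an eigenvalue is the energy of a normalised
  eigenfunction. In part (i) this takes the place of the sign hypothesis made for odd m.\<close>

lemma eigenvalue_nonneg_of_even:
  assumes N: "N \<ge> 1" and m: "m \<ge> 1" "even m" and \<Omega>: "bounded_domain N \<Omega>"
    and ev: "dirichlet_eigenvalues m N \<Omega> lam" and k: "k \<ge> 1"
  shows "lam k \<ge> 0"
proof -
  obtain R where R: "\<Omega> \<subseteq> open_box N R" using bounded_domain_subset_open_box[OF \<Omega>] by blast
  obtain \<psi> where \<psi>: "\<psi> \<in> Hfin m N R" "log_form m N \<psi> \<psi> = of_real (lam k)"
    using orthonormal_eigenfunctions[OF N m(1) R ev] k by metis
  have "lam k = 1 / (2 * pi) ^ N * (LINT \<xi>|RN_leb N. (2 * ln (RN_norm N \<xi>)) ^ m * (cmod (fourier N \<psi> \<xi>))\<^sup>2)"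
    using log_form_self(2)[OF \<psi>(1) N m(1)] \<psi>(2) by (simp only: of_real_eq_iff)
  also have "\<dots> \<ge> 0"
    using m(2) by (intro mult_nonneg_nonneg integral_nonneg_AE AE_I2) (auto simp: zero_le_even_power)
  finally show ?thesis .
qed

section \<open>The lower bounds\<close>

text \<open>Origin of the exponent m/(m-1): it takes A^(m-1) to A^m, so that both alternatives bound
  the same power.\<close>

lemma powr_min_bound:
  fixes A X Y \<tau> :: real
  assumes m: "m \<ge> 2" and A: "A \<ge> 1" and X: "X \<ge> 0"
    and alt: "X / exp \<tau> \<le> A ^ (m - 1) \<or> Y ^ m \<le> A ^ m"
  shows "min ((X / exp \<tau>) powr (real m / (real m - 1))) (Y ^ m) \<le> A ^ m"
  using alt
proof
  assume le: "X / exp \<tau> \<le> A ^ (m - 1)"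
  have "(X / exp \<tau>) powr (real m / (real m - 1)) \<le> (A ^ (m - 1)) powr (real m / (real m - 1))"
    using le X m by (intro powr_mono2) auto
  also have "A ^ (m - 1) = A powr (real m - 1)"
    using A m by (subst powr_realpow[symmetric]) (auto simp: of_nat_diff)
  also have "(A powr (real m - 1)) powr (real m / (real m - 1)) = A powr real m"
    using m by (simp add: powr_powr)
  also have "\<dots> = A ^ m" using A by (simp add: powr_realpow)
  finally show ?thesis by simp
qed simp

theorem theorem1p2:
  fixes m :: nat
  assumes "m \<ge> 2"
  shows "\<exists>\<tau>0 :: real. \<tau>0 > 1 \<and>
    (\<forall>(N :: nat) (k :: nat) (\<Omega> :: (nat \<Rightarrow> real) set) (lam :: nat \<Rightarrow> real).
      N \<ge> 1 \<longrightarrow> k \<ge> 2 \<longrightarrow> bounded_domain N \<Omega> \<longrightarrow> (N \<ge> 2 \<longrightarrow> lipschitz_boundary N \<Omega>) \<longrightarrow>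
      dirichlet_eigenvalues m N \<Omega> lam \<longrightarrow>
      (let vol = measure (RN_leb N) \<Omega>;
           a = a_const m N; b = b_const m N; c = c_const m N;
           q = real m / (real m - 1);
           P = - lam 1 + b
       in
        ((odd m \<and> lam 1 \<ge> 0) \<or> even m \<longrightarrow>
          lam k \<ge> (2 / real N) ^ m *
            min ((c / exp \<tau>0) powr q * (real k / vol) powr q)
                ((ln (c * (real k / vol) + \<tau>0 ^ (m - 1) * exp \<tau>0)
                  - (real m - 1) * ln (ln (c * (real k / vol) + exp 1)) - ln 2) ^ m)
            - b) \<and>
        (odd m \<and> lam 1 < 0 \<longrightarrow>
          lam k \<ge> (2 / real N) ^ m *
            min ((a / exp \<tau>0) powr q * (P / vol) powr q * real k powr q)
                ((ln (a * (P / vol) * real k + \<tau>0 ^ (m - 1) * exp \<tau>0)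
                  - (real m - 1) * ln (2 * ln (a * (P / vol) * real k + exp 1))) ^ m)
            - P)))"
proof -
  have m1: "m \<ge> 1" using assms by simp
  \<comment> \<open>The bound 2 (2m)^m of the correction integral, divided by the factor m by which
    the energy bound is normalised.\<close>
  define C where "C = 2 * (2 * real m) ^ m / real m"
  obtain \<tau> where \<tau>: "\<tau> > 1"
    and Y0: "\<And>X. X \<ge> 0 \<Longrightarrow> 0 \<le> ln (X + \<tau> ^ (m - 1) * exp \<tau>) - real (m - 1) * ln (ln (X + exp 1)) - ln 2"
    and YA: "\<And>A X. A \<ge> 1 \<Longrightarrow> X \<ge> 0 \<Longrightarrow> X \<le> A ^ (m - 1) * exp A + C \<Longrightarrow> A ^ (m - 1) < X / exp \<tau> \<Longrightarrow>
       ln (X + \<tau> ^ (m - 1) * exp \<tau>) - real (m - 1) * ln (ln (X + exp 1)) - ln 2 \<le> A"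
    by (rule scalar_threshold[of "m - 1" C]) (use assms in \<open>auto simp: C_def\<close>)
  have rm: "real (m - 1) = real m - 1" using m1 by (simp add: of_nat_diff)
  define Y where "Y X = ln (X + \<tau> ^ (m - 1) * exp \<tau>) - (real m - 1) * ln (ln (X + exp 1)) - ln 2" for X
  note Y0 = Y0[unfolded rm, folded Y_def] and YA = YA[unfolded rm, folded Y_def]
  \<comment> \<open>Serves both parts. In part (i) Z is \<open>Y X\<close>, whose nonnegativity
    allows m-th powers to be compared. In part (ii) Z is only known to be at most \<open>Y X\<close>
    and may be negative, but there m is odd and the power is monotone on the whole line.\<close>
  have key: "lam k \<ge> (2 / real N) ^ m * min ((X / exp \<tau>) powr (real m / (real m - 1))) (Z ^ m) - P \<and> X > 0 \<and> measure (RN_leb N) \<Omega> > 0"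
    if N: "N \<ge> 1" and k: "k \<ge> 1" and \<Omega>: "bounded_domain N \<Omega>" and ev: "dirichlet_eigenvalues m N \<Omega> lam"
      and P: "P > 0" "lam k + P \<ge> b_const m N" and X: "X = a_const m N * (P / measure (RN_leb N) \<Omega>) * real k"
      and Z: "Z = Y X \<or> odd m \<and> Z \<le> Y X"
    for N k \<Omega> lam P X Z
  proof -
    let ?V = "measure (RN_leb N) \<Omega>" and ?\<beta> = "unit_ball_vol (real N)"
    have \<beta>: "?\<beta> > 0" by simp
    define L where "L = (real N / 2) ^ m * (lam k + P)"
    have "(real N / 2) ^ m * b_const m N = (real m - 1) ^ m + 1 / 2 ^ m"
      using N by (simp add: b_const_def power_divide field_simps)
    moreover have "(real N / 2) ^ m * b_const m N \<le> L" unfolding L_def by (intro mult_left_mono P) auto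
    moreover have "(real m - 1) ^ m \<ge> 1" using assms by (intro one_le_power) auto
    ultimately have L: "L \<ge> 1" by (smt (verit) divide_nonneg_nonneg zero_le_one zero_le_power zero_le_numeral)
    define A where "A = root m L"
    have A: "A \<ge> 1" and Am: "A ^ m = L" using L m1 by (auto simp: A_def)
    have bd: "(2 * pi) ^ N * real k * ((real N / 2) ^ m * P) \<le> ?V * (?\<beta> * (real m * (A ^ (m - 1) * exp A) + 2 * (2 * real m) ^ m))"
      by (rule eigenvalue_sum_bound[OF N m1 \<Omega> ev _ _ k]) (use A Am L_def in auto)
    have pos: "(2 * pi) ^ N * real k * ((real N / 2) ^ m * P) > 0" using N k P by (intro mult_pos_pos) auto
    \<comment> \<open>Zero volume would annihilate the right side of \<open>bd\<close>, whose left
      side is positive.\<close>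
    have "?V \<noteq> 0"
    proof
      assume "?V = 0"
      with bd have "(2 * pi) ^ N * real k * ((real N / 2) ^ m * P) \<le> 0" by (simp only: mult_zero_left)
      with pos show False by linarith
    qed
    then have V: "?V > 0" using measure_nonneg[of "RN_leb N" \<Omega>] by linarith
    \<comment> \<open>With \<open>omega N\<close> equal to N times the volume of the unit ball,
      \<open>a_const\<close> is exactly the factor that remains when \<open>bd\<close> is divided by
      m, the volume of the domain and the volume of the unit ball.\<close>
    have Xeq: "X = (2 * pi) ^ N * real k * ((real N / 2) ^ m * P) / (real m * ?V * ?\<beta>)"
      unfolding X a_const_def omega_eq[OF N] using N V \<beta> m1 by (simp add: field_simps power_divide)
    have X0: "X > 0" unfolding Xeq by (rule divide_pos_pos[OF pos]) (use V \<beta> m1 in simp)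
    have cancel: "v * (b * (r * w + 2 * d)) / (r * v * b) = w + 2 * d / r" if "v > 0" "b > 0" "r > 0" for v b r w d :: real
      using that by (simp add: field_simps)
    have "X \<le> ?V * (?\<beta> * (real m * (A ^ (m - 1) * exp A) + 2 * (2 * real m) ^ m)) / (real m * ?V * ?\<beta>)"
      unfolding Xeq using V \<beta> by (intro divide_right_mono bd) auto
    also have "\<dots> = A ^ (m - 1) * exp A + C"
      unfolding C_def using V \<beta> m1 by (intro cancel) auto
    finally have XA: "X \<le> A ^ (m - 1) * exp A + C" .
    have "Z ^ m \<le> A ^ m" if "Y X \<le> A"
      using Z
    proof
      assume "Z = Y X"
      then show ?thesis using that Y0[of X] X0 by (auto intro!: power_mono)
    next
      assume "odd m \<and> Z \<le> Y X"
      then show ?thesis using that by (intro power_mono_odd) auto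
    qed
    then have alt: "X / exp \<tau> \<le> A ^ (m - 1) \<or> Z ^ m \<le> A ^ m"
      using YA[OF A _ XA] X0 by linarith
    have "(2 / real N) ^ m * min ((X / exp \<tau>) powr (real m / (real m - 1))) (Z ^ m) \<le> (2 / real N) ^ m * A ^ m"
      by (intro mult_left_mono powr_min_bound[OF assms A _ alt]) (use X0 in auto)
    also have "\<dots> = lam k + P"
      unfolding Am L_def using N by (simp add: power_divide)
    finally show ?thesis using X0 V by simp
  qed
  have b_pos: "b_const m N > 0" if "N \<ge> 1" for N
    using that assms unfolding b_const_def by (intro add_nonneg_pos) auto
  have a_nonneg: "a_const m N \<ge> 0" if "N \<ge> 1" for N
    unfolding a_const_def omega_eq[OF that] by (intro mult_nonneg_nonneg divide_nonneg_nonneg) auto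
  show ?thesis
  proof (intro exI[of _ \<tau>] conjI allI impI \<tau>)
    fix N k :: nat and \<Omega> lam
    assume N: "1 \<le> N" and k: "2 \<le> k" and \<Omega>: "bounded_domain N \<Omega>" and ev: "dirichlet_eigenvalues m N \<Omega> lam"
    have k1: "k \<ge> 1" using k by simp
    let ?V = "measure (RN_leb N) \<Omega>" and ?q = "real m / (real m - 1)"
    let ?a = "a_const m N" and ?b = "b_const m N" and ?c = "c_const m N"
    let ?P = "- lam 1 + ?b"
    have mono: "lam 1 \<le> lam k" using ev k by (simp add: dirichlet_eigenvalues_def)
    have i: "lam k \<ge> (2 / real N) ^ m * min ((?c / exp \<tau>) powr ?q * (real k / ?V) powr ?q)
        ((ln (?c * (real k / ?V) + \<tau> ^ (m - 1) * exp \<tau>) - (real m - 1) * ln (ln (?c * (real k / ?V) + exp 1)) - ln 2) ^ m) - ?b"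
      if "odd m \<and> lam 1 \<ge> 0 \<or> even m"
    proof -
      have "lam k \<ge> 0"
        using that mono eigenvalue_nonneg_of_even[OF N m1 _ \<Omega> ev k1] by linarith
      define X where "X = ?c * (real k / ?V)"
      have "X = ?a * (?b / ?V) * real k" by (simp add: X_def c_const_def)
      from key[OF N k1 \<Omega> ev b_pos[OF N] _ this, of "Y X"] \<open>lam k \<ge> 0\<close>
      have "lam k \<ge> (2 / real N) ^ m * min ((X / exp \<tau>) powr ?q) (Y X ^ m) - ?b" by simp
      moreover have "(?c / exp \<tau>) powr ?q * (real k / ?V) powr ?q = (X / exp \<tau>) powr ?q"
        using a_nonneg[OF N] b_pos[OF N] unfolding X_def c_const_def by (subst powr_mult[symmetric]) (auto simp: ac_simps)
      ultimately show ?thesis unfolding Y_def X_def by simp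
    qed
    have ii: "lam k \<ge> (2 / real N) ^ m * min ((?a / exp \<tau>) powr ?q * (?P / ?V) powr ?q * real k powr ?q)
        ((ln (?a * (?P / ?V) * real k + \<tau> ^ (m - 1) * exp \<tau>) - (real m - 1) * ln (2 * ln (?a * (?P / ?V) * real k + exp 1))) ^ m) - ?P"
      if neg: "odd m \<and> lam 1 < 0"
    proof -
      have P: "?P > 0" using neg b_pos[OF N] by simp
      define X where "X = ?a * (?P / ?V) * real k"
      define Z where "Z = ln (X + \<tau> ^ (m - 1) * exp \<tau>) - (real m - 1) * ln (2 * ln (X + exp 1))"
      have X0: "X \<ge> 0" unfolding X_def using a_nonneg[OF N] P by simp
      have "ln (X + exp 1) > 0" using X0 exp_gt_one[of 1] by (intro ln_gt_zero) linarith
      \<comment> \<open>In part (ii) the factor 2 stands inside the iterated logarithm and costs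
        (m-1) ln 2 instead of ln 2; m \<ge> 2 makes this the weaker bound.\<close>
      then have "Z = Y X - (real m - 2) * ln 2" unfolding Z_def Y_def by (simp add: ln_mult algebra_simps)
      then have "Z \<le> Y X" using assms by simp
      from key[OF N k1 \<Omega> ev P _ X_def, of Z] this neg mono
      have "lam k \<ge> (2 / real N) ^ m * min ((X / exp \<tau>) powr ?q) (Z ^ m) - ?P" by simp
      moreover have "(?a / exp \<tau>) powr ?q * (?P / ?V) powr ?q * real k powr ?q = (X / exp \<tau>) powr ?q"
        using a_nonneg[OF N] P unfolding X_def by (simp add: powr_mult[symmetric] ac_simps)
      ultimately show ?thesis unfolding Z_def X_def by simp
    qed
    show "let vol = ?V; a = ?a; b = ?b; c = ?c; q = ?q; P = - lam 1 + b in
        ((odd m \<and> lam 1 \<ge> 0) \<or> even m \<longrightarrow>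
          lam k \<ge> (2 / real N) ^ m *
            min ((c / exp \<tau>) powr q * (real k / vol) powr q)
                ((ln (c * (real k / vol) + \<tau> ^ (m - 1) * exp \<tau>)
                  - (real m - 1) * ln (ln (c * (real k / vol) + exp 1)) - ln 2) ^ m)
            - b) \<and>
        (odd m \<and> lam 1 < 0 \<longrightarrow>
          lam k \<ge> (2 / real N) ^ m *
            min ((a / exp \<tau>) powr q * (P / vol) powr q * real k powr q)
                ((ln (a * (P / vol) * real k + \<tau> ^ (m - 1) * exp \<tau>)
                  - (real m - 1) * ln (2 * ln (a * (P / vol) * real k + exp 1))) ^ m)
            - P)"
      unfolding Let_def using i ii by blast
  qed
qed

end
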